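(* Let $\mathcal X$ be a space of homogeneous type with degree $(\alpha_0,n_0,N_0)$, let $\varphi$ be a growth function on $\mathcal X\times[0,\infty)$, and let $\{A_t\}_{t>0}$ satisfy Assumption A. (i) Assume $\varphi\in\mathbb A_1(\mathcal X)$. Then, for different $\widetilde p\in[1,\infty)$, the spaces $\widetilde{\mathrm{BMO}}^{\varphi,\,\widetilde p}_A(\mathcal X)$ coincide with equivalent norms. (ii) Assume $p(\varphi)\le1+\frac1{[r(\varphi)]'}$. Then, for different $\widetilde p\in[1,[p(\varphi)]')$, the spaces $\widetilde{\mathrm{BMO}}^{\varphi,\,\widetilde p}_A(\mathcal X)$ coincide with equivalent norms. Here $s'$ denotes the conjugate index of $s\in[1,\infty]$, $1/s+1/s'=1$.
   Context: **Spaces of homogeneous type.** $(\mathcal X,d,\mu)$: $d:\mathcal X\times\mathcal X\to[0,\infty)$ is a quasi-metric ($d(x,y)=0$ iff $x=y$; $d(x,y)=d(y,x)$; $d(x,y)\le C_1[d(x,z)+d(z,y)]$ for a constant $C_1\in[1,\infty)$), and $\mu$ is a nonnegative Borel measure for which there is $C_2\in[1,\infty)$ with $\mu(B(x,2r))\le C_2\mu(B(x,r))<\infty$ for all balls $B(x,r)=\{y: d(y,x)<r\}$ (balls have positive measure). Consider the conditions: ($D_n$), $n\in(0,\infty)$: $\exists C$ with $\mu(B(x,\lambda r))\le C\lambda^n\mu(B(x,r))$ for all $x\in\mathcal X$, $r>0$, $\lambda\ge1$; ($E_N$), $N\in[0,\infty)$: $\exists C$ with $\mu(B(y,r))\le C[1+d(x,y)/r]^N\mu(B(x,r))$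 for all $x,y\in\mathcal X$, $r>0$; ($R_\alpha$), $\alpha\in[0,n]$ with $n$ as in ($D_n$): $\exists C\ge1$ with $C^{-1}\lambda^\alpha\mu(B(x,r))\le\mu(B(x,\lambda r))$ for all $x\in\mathcal X$, $r\in(0,2\,\mathrm{diam}(\mathcal X))$, $\lambda\in[1,2\,\mathrm{diam}(\mathcal X)/r)$. Set $n_0=\inf\{n:(D_n)\}$, $N_0=\inf\{N:(E_N)\}$, $\alpha_0=\sup\{\alpha:(R_\alpha)\}$; $(\alpha_0,n_0,N_0)$ is the degree of $\mathcal X$. **Growth functions.** $\varphi:\mathcal X\times[0,\infty)\to[0,\infty)$ is of uniformly upper type $p$ (resp. uniformly lower type $p$) if $\exists C$ with $\varphi(x,st)\le Cs^p\varphi(x,t)$ for all $x\in\mathcal X$, $t\ge0$ and $s\ge1$ (resp. $s\in(0,1)$). For $p\in(1,\infty)$, $\varphi\in\mathbb A_p(\mathcal X)$ means $\sup_{t>0}\sup_{B}\frac1{\mu(B)}\int_B\varphi(x,t)\,d\mu(x)\{\frac1{\mu(B)}\int_B[\varphi(x,t)]^{-1/(p-1)}d\mu(x)\}^{p-1}<\infty$; $\varphi\in\mathbb A_1(\mathcal X)$ means $\sup_{t>0}\sup_B\frac1{\mu(B)}\int_B\varphi(x,t)d\mu(x)\,\{\mathrm{ess\,sup}_{y\in B}[\varphi(y,t)]^{-1}\}<\infty$; $\mathbb A_\infty=\bigcup_{p\in[1,\infty)}\mathbb A_p$. For $q\in(1,\infty)$, $\varphi\in\mathbb{RH}_q(\mathcal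 X)$ means $\sup_{t>0}\sup_B\{\frac1{\mu(B)}\int_B[\varphi(x,t)]^qd\mu(x)\}^{1/q}\{\frac1{\mu(B)}\int_B\varphi(x,t)d\mu(x)\}^{-1}<\infty$; for $q=\infty$ the first factor is replaced by $\mathrm{ess\,sup}_{y\in B}\varphi(y,t)$. (Suprema over all balls $B$.) $\varphi$ is a growth function if: for each $x$, $\varphi(x,\cdot)$ is an Orlicz function (nondecreasing, $\varphi(x,0)=0$, $\varphi(x,t)>0$ for $t>0$, $\lim_{t\to\infty}\varphi(x,t)=\infty$; not necessarily convex); $\varphi(\cdot,t)$ is measurable for each $t$; $\varphi\in\mathbb A_\infty(\mathcal X)$; and $\varphi$ is of uniformly upper type $1$ and of uniformly lower type $p$ for some $p\in(0,1]$. Indices: $i(\varphi)=\sup\{p\in(0,\infty):\varphi$ is of uniformly lower type $p\}$, $p(\varphi)=\inf\{p\in[1,\infty):\varphi\in\mathbb A_p(\mathcal X)\}$, $r(\varphi)=\sup\{q\in(1,\infty]:\varphi\in\mathbb{RH}_q(\mathcal X)\}$, with $(r-1)/r:=1$ if $r=\infty$. $\|f\|_{L^\varphi(\mathcal X)}=\inf\{\lambda>0:\int_{\mathcal X}\varphi(x,|f(x)|/\lambda)\,d\mu(x)\le1\}$; $\chi_B$ is the characteristic function of $B$. **Generalized approximation to the identity.** Fix $M>n_0[1+p(\varphi)/i(\varphi)]-\alpha_0$, a constant $m>0$, and a positive, bounded, decreasing function $g$ on $[0,\infty)$ with $\lim_{r\to\infty}r^Mg(r^m)=0$. The operators are $A_tf(x)=\int_{\mathcal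 X}a_t(x,y)f(y)\,d\mu(y)$, $t>0$, with $|a_t(x,y)|\le h_t(x,y):=\frac1{\mu(B(x,t^{1/m}))}g\big(\frac{[d(x,y)]^m}{t}\big)$ for all $x,y\in\mathcal X$. They act on $f\in\mathcal M(\mathcal X):=\bigcup_{x_0\in\mathcal X}\bigcup_\beta\mathcal M_{(x_0,\beta)}(\mathcal X)$, the union over $0<\beta<M-n_0[1+p(\varphi)/i(\varphi)]+\alpha_0$, where $\mathcal M_{(x_0,\beta)}(\mathcal X)$ is the set of $f\in L^1_{\rm loc}(\mathcal X)$ with $\int_{\mathcal X}\frac{|f(x)|}{[1+d(x_0,x)]^{n_0p(\varphi)/i(\varphi)-\alpha_0+\beta}\,\mu(B(x_0,1+d(x_0,x)))}\,d\mu(x)<\infty$. **Assumption A.** $\{A_t\}_{t>0}$ is a generalized approximation to the identity, that is, $A_tf(x)=\int_{\mathcal X}a_t(x,y)f(y)\,d\mu(y)$ with $|a_t(x,y)|\le\frac1{\mu(B(x,t^{1/m}))}g\big(\frac{[d(x,y)]^m}{t}\big)$ for all $t>0$ and $x,y\in\mathcal X$, where $g$ is positive, bounded, decreasing and $\lim_{r\to\infty}r^Mg(r^m)=0$; $A_0:=I$ (identity), $A_tA_sf=A_{t+s}f$ almost everywhere for all $s,t\in[0,\infty)$ and $f\in\mathcal M(\mathcal X)$, and in addition $M>n_0+\frac{2n_0p(\varphi)}{i(\varphi)}+N_0-\frac{n_0[r(\varphi)-1]}{r(\varphi)}-\alpha_0.$ **Spaces.** For $\widetilde p\in[1,\infty)$,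 $\widetilde{\mathrm{BMO}}^{\varphi,\,\widetilde p}_A(\mathcal X)$ is the set of $f\in\mathcal M(\mathcal X)$ with $$\|f\|_{\widetilde{\mathrm{BMO}}^{\varphi,\,\widetilde p}_A(\mathcal X)}=\sup_{B}\frac1{\|\chi_B\|_{L^\varphi(\mathcal X)}}\left\{\int_B\left|\frac{f(x)-A_{t_B}f(x)}{\varphi(x,\|\chi_B\|_{L^\varphi(\mathcal X)}^{-1})}\right|^{\widetilde p}\varphi\left(x,\|\chi_B\|_{L^\varphi(\mathcal X)}^{-1}\right)d\mu(x)\right\}^{1/\widetilde p}<\infty,$$ the supremum over all balls $B\subset\mathcal X$, $t_B:=r_B^m$, $r_B$ the radius of $B$. (For $\widetilde p=1$ this is the space $\mathrm{BMO}^\varphi_A(\mathcal X)$.) *)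

theory Defs
  imports "HOL-Analysis.Analysis" "HOL-Probability.Essential_Supremum"
begin

section \<open>Spaces of homogeneous type\<close>

text \<open>
  The underlying set is the whole type \<^typ>\<open>'a\<close>; balls are indexed by centre and radius, since a
  ball, as a set, need not determine its radius.
\<close>

definition qball :: "('a \<Rightarrow> 'a \<Rightarrow> real) \<Rightarrow> 'a \<Rightarrow> real \<Rightarrow> 'a set" where
  "qball d x r = {y. d y x < r}"

definition quasi_metric :: "('a \<Rightarrow> 'a \<Rightarrow> real) \<Rightarrow> bool" where
  "quasi_metric d \<longleftrightarrow>
     (\<forall>x y. 0 \<le> d x y) \<and> (\<forall>x y. d x y = 0 \<longleftrightarrow> x = y) \<and> (\<forall>x y. d x y = d y x) \<and>
     (\<exists>C1\<ge>1. \<forall>x y z. d x y \<le> C1 * (d x z + d z y))"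

definition quasi_open :: "('a \<Rightarrow> 'a \<Rightarrow> real) \<Rightarrow> 'a set \<Rightarrow> bool" where
  "quasi_open d U \<longleftrightarrow> (\<forall>x\<in>U. \<exists>r>0. qball d x r \<subseteq> U)"

text \<open>
  Balls of a quasi-metric need not be Borel sets of the induced topology, so their measurability,
  tacit in writing \<open>\<mu>(B(x,r))\<close>, is a separate requirement.
\<close>

definition homogeneous_type :: "('a \<Rightarrow> 'a \<Rightarrow> real) \<Rightarrow> 'a measure \<Rightarrow> bool" where
  "homogeneous_type d \<mu> \<longleftrightarrow>
     quasi_metric d \<and>
     space \<mu> = UNIV \<and> sets \<mu> = sigma_sets UNIV {U. quasi_open d U} \<and>
     (\<forall>x. \<forall>r>0. qball d x r \<in> sets \<mu> \<and> 0 < emeasure \<mu> (qball d x r)) \<and>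
     (\<exists>C2::real. C2 \<ge> 1 \<and>
       (\<forall>x. \<forall>r>0. emeasure \<mu> (qball d x (2 * r)) \<le> ennreal C2 * emeasure \<mu> (qball d x r) \<and>
                  ennreal C2 * emeasure \<mu> (qball d x r) < \<infinity>))"

definition cond_D :: "('a \<Rightarrow> 'a \<Rightarrow> real) \<Rightarrow> 'a measure \<Rightarrow> real \<Rightarrow> bool" where
  "cond_D d \<mu> n \<longleftrightarrow> 0 < n \<and>
     (\<exists>C. \<forall>x. \<forall>r>0. \<forall>l\<ge>1.
        measure \<mu> (qball d x (l * r)) \<le> C * l powr n * measure \<mu> (qball d x r))"

definition cond_E :: "('a \<Rightarrow> 'a \<Rightarrow> real) \<Rightarrow> 'a measure \<Rightarrow> real \<Rightarrow> bool" where
  "cond_E d \<mu> N \<longleftrightarrow> 0 \<le> N \<and>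
     (\<exists>C. \<forall>x y. \<forall>r>0.
        measure \<mu> (qball d y r) \<le> C * (1 + d x y / r) powr N * measure \<mu> (qball d x r))"

definition quasi_diam :: "('a \<Rightarrow> 'a \<Rightarrow> real) \<Rightarrow> ereal" where
  "quasi_diam d = (SUP x. SUP y. ereal (d x y))"

text \<open>
  The restriction \<open>\<alpha> \<le> n\<close> is imposed for every \<open>n\<close> as in \<^const>\<open>cond_D\<close>. If the space has at least
  two points this follows from the growth estimate; on a one-point space the estimate is vacuous and
  the restriction keeps the set of admissible \<open>\<alpha>\<close> bounded.
\<close>

definition cond_R :: "('a \<Rightarrow> 'a \<Rightarrow> real) \<Rightarrow> 'a measure \<Rightarrow> real \<Rightarrow> bool" where
  "cond_R d \<mu> \<alpha> \<longleftrightarrow> 0 \<le> \<alpha> \<and> (\<forall>n. cond_D d \<mu> n \<longrightarrow> \<alpha> \<le> n) \<and>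
     (\<exists>C\<ge>1. \<forall>x. \<forall>r>0. \<forall>l\<ge>1.
        ereal r < 2 * quasi_diam d \<and> ereal l < 2 * quasi_diam d / ereal r \<longrightarrow>
        inverse C * l powr \<alpha> * measure \<mu> (qball d x r) \<le> measure \<mu> (qball d x (l * r)))"

definition deg_n0 :: "('a \<Rightarrow> 'a \<Rightarrow> real) \<Rightarrow> 'a measure \<Rightarrow> real" where
  "deg_n0 d \<mu> = Inf {n. cond_D d \<mu> n}"

definition deg_N0 :: "('a \<Rightarrow> 'a \<Rightarrow> real) \<Rightarrow> 'a measure \<Rightarrow> real" where
  "deg_N0 d \<mu> = Inf {N. cond_E d \<mu> N}"

definition deg_alpha0 :: "('a \<Rightarrow> 'a \<Rightarrow> real) \<Rightarrow> 'a measure \<Rightarrow> real" where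
  "deg_alpha0 d \<mu> = Sup {\<alpha>. cond_R d \<mu> \<alpha>}"


section \<open>Growth functions\<close>

definition orlicz_function :: "(real \<Rightarrow> real) \<Rightarrow> bool" where
  "orlicz_function \<Phi> \<longleftrightarrow>
     mono_on {0..} \<Phi> \<and> \<Phi> 0 = 0 \<and> (\<forall>t>0. 0 < \<Phi> t) \<and> filterlim \<Phi> at_top at_top"

definition upper_type :: "('a \<Rightarrow> real \<Rightarrow> real) \<Rightarrow> real \<Rightarrow> bool" where
  "upper_type \<phi> p \<longleftrightarrow> (\<exists>C. \<forall>x. \<forall>t\<ge>0. \<forall>s\<ge>1. \<phi> x (s * t) \<le> C * s powr p * \<phi> x t)"

definition lower_type :: "('a \<Rightarrow> real \<Rightarrow> real) \<Rightarrow> real \<Rightarrow> bool" where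
  "lower_type \<phi> p \<longleftrightarrow>
     (\<exists>C. \<forall>x. \<forall>t\<ge>0. \<forall>s. 0 < s \<and> s < 1 \<longrightarrow> \<phi> x (s * t) \<le> C * s powr p * \<phi> x t)"

text \<open>Only used with positive exponents, whence the value at infinity.\<close>

definition ennpowr :: "ennreal \<Rightarrow> real \<Rightarrow> ennreal" where
  "ennpowr u p = (if u = \<infinity> then \<infinity> else ennreal (enn2real u powr p))"

definition ball_avg ::
  "('a \<Rightarrow> 'a \<Rightarrow> real) \<Rightarrow> 'a measure \<Rightarrow> 'a \<Rightarrow> real \<Rightarrow> ('a \<Rightarrow> ennreal) \<Rightarrow> ennreal" where
  "ball_avg d \<mu> x r w = (\<integral>\<^sup>+y\<in>qball d x r. w y \<partial>\<mu>) / emeasure \<mu> (qball d x r)"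

definition ball_esssup ::
  "('a \<Rightarrow> 'a \<Rightarrow> real) \<Rightarrow> 'a measure \<Rightarrow> 'a \<Rightarrow> real \<Rightarrow> ('a \<Rightarrow> ennreal) \<Rightarrow> ennreal" where
  "ball_esssup d \<mu> x r w = esssup (restrict_space \<mu> (qball d x r)) w"

definition muckenhoupt ::
  "('a \<Rightarrow> 'a \<Rightarrow> real) \<Rightarrow> 'a measure \<Rightarrow> real \<Rightarrow> ('a \<Rightarrow> real \<Rightarrow> real) \<Rightarrow> bool" where
  "muckenhoupt d \<mu> p \<phi> \<longleftrightarrow> 1 \<le> p \<and>
     (if p = 1 then
        (SUP t\<in>{0<..}. SUP x. SUP r\<in>{0<..}.
           ball_avg d \<mu> x r (\<lambda>y. ennreal (\<phi> y t)) *
           ball_esssup d \<mu> x r (\<lambda>y. ennreal (inverse (\<phi> y t)))) < \<infinity>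
      else
        (SUP t\<in>{0<..}. SUP x. SUP r\<in>{0<..}.
           ball_avg d \<mu> x r (\<lambda>y. ennreal (\<phi> y t)) *
           ennpowr (ball_avg d \<mu> x r (\<lambda>y. ennreal (\<phi> y t powr (- 1 / (p - 1))))) (p - 1)) < \<infinity>)"

definition muckenhoupt_infinity ::
  "('a \<Rightarrow> 'a \<Rightarrow> real) \<Rightarrow> 'a measure \<Rightarrow> ('a \<Rightarrow> real \<Rightarrow> real) \<Rightarrow> bool" where
  "muckenhoupt_infinity d \<mu> \<phi> \<longleftrightarrow> (\<exists>p\<ge>1. muckenhoupt d \<mu> p \<phi>)"

definition reverse_holder ::
  "('a \<Rightarrow> 'a \<Rightarrow> real) \<Rightarrow> 'a measure \<Rightarrow> ereal \<Rightarrow> ('a \<Rightarrow> real \<Rightarrow> real) \<Rightarrow> bool" where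
  "reverse_holder d \<mu> q \<phi> \<longleftrightarrow> 1 < q \<and>
     (if q = \<infinity> then
        (SUP t\<in>{0<..}. SUP x. SUP r\<in>{0<..}.
           ball_esssup d \<mu> x r (\<lambda>y. ennreal (\<phi> y t)) *
           inverse (ball_avg d \<mu> x r (\<lambda>y. ennreal (\<phi> y t)))) < \<infinity>
      else
        (SUP t\<in>{0<..}. SUP x. SUP r\<in>{0<..}.
           ennpowr (ball_avg d \<mu> x r (\<lambda>y. ennreal (\<phi> y t powr real_of_ereal q)))
             (1 / real_of_ereal q) *
           inverse (ball_avg d \<mu> x r (\<lambda>y. ennreal (\<phi> y t)))) < \<infinity>)"

definition growth_function ::
  "('a \<Rightarrow> 'a \<Rightarrow> real) \<Rightarrow> 'a measure \<Rightarrow> ('a \<Rightarrow> real \<Rightarrow> real) \<Rightarrow> bool" where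
  "growth_function d \<mu> \<phi> \<longleftrightarrow>
     (\<forall>x. orlicz_function (\<phi> x)) \<and>
     (\<forall>t\<ge>0. (\<lambda>x. \<phi> x t) \<in> borel_measurable \<mu>) \<and>
     muckenhoupt_infinity d \<mu> \<phi> \<and>
     upper_type \<phi> 1 \<and> (\<exists>p. 0 < p \<and> p \<le> 1 \<and> lower_type \<phi> p)"

definition index_i :: "('a \<Rightarrow> real \<Rightarrow> real) \<Rightarrow> real" where
  "index_i \<phi> = Sup {p. 0 < p \<and> lower_type \<phi> p}"

definition index_p ::
  "('a \<Rightarrow> 'a \<Rightarrow> real) \<Rightarrow> 'a measure \<Rightarrow> ('a \<Rightarrow> real \<Rightarrow> real) \<Rightarrow> real" where
  "index_p d \<mu> \<phi> = Inf {p. 1 \<le> p \<and> muckenhoupt d \<mu> p \<phi>}"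

definition index_r ::
  "('a \<Rightarrow> 'a \<Rightarrow> real) \<Rightarrow> 'a measure \<Rightarrow> ('a \<Rightarrow> real \<Rightarrow> real) \<Rightarrow> ereal" where
  "index_r d \<mu> \<phi> = Sup {q. 1 < q \<and> reverse_holder d \<mu> q \<phi>}"

text \<open>The quotient \<open>(r - 1) / r\<close>, read as \<open>1\<close> for \<open>r = \<infinity>\<close>.\<close>

definition pred_quot :: "ereal \<Rightarrow> real" where
  "pred_quot r = (if r = \<infinity> then 1 else (real_of_ereal r - 1) / real_of_ereal r)"

text \<open>
  The solution \<open>s'\<close> of \<open>1/s + 1/s' = 1\<close> for \<open>s \<in> [1,\<infinity>]\<close>; as \<open>1/0 = \<infinity>\<close> and \<open>1/\<infinity> = 0\<close> in
  \<^typ>\<open>ereal\<close>, the endpoints give \<open>1' = \<infinity>\<close> and \<open>\<infinity>' = 1\<close>.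
\<close>

definition conj_index :: "ereal \<Rightarrow> ereal" where
  "conj_index s = 1 / (1 - 1 / s)"

text \<open>
  The infimum is taken in the reals; it is only applied to characteristic functions of balls, for
  which the set is nonempty.
\<close>

definition lux_norm :: "'a measure \<Rightarrow> ('a \<Rightarrow> real \<Rightarrow> real) \<Rightarrow> ('a \<Rightarrow> real) \<Rightarrow> real" where
  "lux_norm \<mu> \<phi> f = Inf {l. 0 < l \<and> (\<integral>\<^sup>+x. ennreal (\<phi> x (\<bar>f x\<bar> / l)) \<partial>\<mu>) \<le> 1}"


section \<open>Generalized approximations to the identity\<close>

definition L1_loc :: "('a \<Rightarrow> 'a \<Rightarrow> real) \<Rightarrow> 'a measure \<Rightarrow> ('a \<Rightarrow> complex) set" where
  "L1_loc d \<mu> = {f \<in> borel_measurable \<mu>. \<forall>x. \<forall>r>0. set_integrable \<mu> (qball d x r) f}"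

definition M_class_at ::
  "('a \<Rightarrow> 'a \<Rightarrow> real) \<Rightarrow> 'a measure \<Rightarrow> ('a \<Rightarrow> real \<Rightarrow> real) \<Rightarrow> 'a \<Rightarrow> real \<Rightarrow> ('a \<Rightarrow> complex) set" where
  "M_class_at d \<mu> \<phi> x0 \<beta> = {f \<in> L1_loc d \<mu>.
     (\<integral>\<^sup>+x. ennreal (cmod (f x) /
        ((1 + d x0 x) powr (deg_n0 d \<mu> * index_p d \<mu> \<phi> / index_i \<phi> - deg_alpha0 d \<mu> + \<beta>) *
         measure \<mu> (qball d x0 (1 + d x0 x)))) \<partial>\<mu>) < \<infinity>}"

definition M_class ::
  "('a \<Rightarrow> 'a \<Rightarrow> real) \<Rightarrow> 'a measure \<Rightarrow> ('a \<Rightarrow> real \<Rightarrow> real) \<Rightarrow> real \<Rightarrow> ('a \<Rightarrow> complex) set" where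
  "M_class d \<mu> \<phi> M =
     (\<Union>x0. \<Union>\<beta>\<in>{0<..<M - deg_n0 d \<mu> * (1 + index_p d \<mu> \<phi> / index_i \<phi>) + deg_alpha0 d \<mu>}.
        M_class_at d \<mu> \<phi> x0 \<beta>)"

definition ai_op ::
  "'a measure \<Rightarrow> (real \<Rightarrow> 'a \<Rightarrow> 'a \<Rightarrow> complex) \<Rightarrow> real \<Rightarrow> ('a \<Rightarrow> complex) \<Rightarrow> 'a \<Rightarrow> complex" where
  "ai_op \<mu> a t f x = (if t = 0 then f x else (LINT y|\<mu>. a t x y * f y))"

definition gen_approx_identity ::
  "('a \<Rightarrow> 'a \<Rightarrow> real) \<Rightarrow> 'a measure \<Rightarrow> ('a \<Rightarrow> real \<Rightarrow> real) \<Rightarrow> real \<Rightarrow> real \<Rightarrow> (real \<Rightarrow> real) \<Rightarrow>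
   (real \<Rightarrow> 'a \<Rightarrow> 'a \<Rightarrow> complex) \<Rightarrow> bool" where
  "gen_approx_identity d \<mu> \<phi> M m g a \<longleftrightarrow>
     M > deg_n0 d \<mu> * (1 + index_p d \<mu> \<phi> / index_i \<phi>) - deg_alpha0 d \<mu> \<and>
     0 < m \<and>
     (\<forall>s\<ge>0. 0 < g s) \<and> bounded (g ` {0..}) \<and> antimono_on {0..} g \<and>
     ((\<lambda>r. r powr M * g (r powr m)) \<longlongrightarrow> 0) at_top \<and>
     (\<forall>t>0. (\<lambda>(x, y). a t x y) \<in> borel_measurable (\<mu> \<Otimes>\<^sub>M \<mu>)) \<and>
     (\<forall>t>0. \<forall>x y. cmod (a t x y) \<le>
        1 / measure \<mu> (qball d x (t powr (1 / m))) * g (d x y powr m / t))"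

definition assumption_A ::
  "('a \<Rightarrow> 'a \<Rightarrow> real) \<Rightarrow> 'a measure \<Rightarrow> ('a \<Rightarrow> real \<Rightarrow> real) \<Rightarrow> real \<Rightarrow> real \<Rightarrow> (real \<Rightarrow> real) \<Rightarrow>
   (real \<Rightarrow> 'a \<Rightarrow> 'a \<Rightarrow> complex) \<Rightarrow> bool" where
  "assumption_A d \<mu> \<phi> M m g a \<longleftrightarrow>
     gen_approx_identity d \<mu> \<phi> M m g a \<and>
     (\<forall>s\<ge>0. \<forall>t\<ge>0. \<forall>f\<in>M_class d \<mu> \<phi> M.
        AE x in \<mu>. ai_op \<mu> a t (ai_op \<mu> a s f) x = ai_op \<mu> a (t + s) f x) \<and>
     M > deg_n0 d \<mu> + 2 * deg_n0 d \<mu> * index_p d \<mu> \<phi> / index_i \<phi> + deg_N0 d \<mu>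
         - deg_n0 d \<mu> * pred_quot (index_r d \<mu> \<phi>) - deg_alpha0 d \<mu>"


section \<open>The spaces\<close>

definition bmo_norm ::
  "('a \<Rightarrow> 'a \<Rightarrow> real) \<Rightarrow> 'a measure \<Rightarrow> ('a \<Rightarrow> real \<Rightarrow> real) \<Rightarrow> real \<Rightarrow>
   (real \<Rightarrow> 'a \<Rightarrow> 'a \<Rightarrow> complex) \<Rightarrow> real \<Rightarrow> ('a \<Rightarrow> complex) \<Rightarrow> ennreal" where
  "bmo_norm d \<mu> \<phi> m a p f =
     (SUP x. SUP r\<in>{0<..}.
        let B = qball d x r; L = lux_norm \<mu> \<phi> (indicator B) in
        ennreal (1 / L) *
        ennpowr
          (\<integral>\<^sup>+y\<in>B. ennreal
             ((cmod (f y - ai_op \<mu> a (r powr m) f y) / \<phi> y (1 / L)) powr p * \<phi> y (1 / L)) \<partial>\<mu>)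
          (1 / p))"

definition bmo_space ::
  "('a \<Rightarrow> 'a \<Rightarrow> real) \<Rightarrow> 'a measure \<Rightarrow> ('a \<Rightarrow> real \<Rightarrow> real) \<Rightarrow> real \<Rightarrow> real \<Rightarrow>
   (real \<Rightarrow> 'a \<Rightarrow> 'a \<Rightarrow> complex) \<Rightarrow> real \<Rightarrow> ('a \<Rightarrow> complex) set" where
  "bmo_space d \<mu> \<phi> M m a p = {f \<in> M_class d \<mu> \<phi> M. bmo_norm d \<mu> \<phi> m a p f < \<infinity>}"

definition coincide_equiv_norms ::
  "'f set \<Rightarrow> ('f \<Rightarrow> ennreal) \<Rightarrow> 'f set \<Rightarrow> ('f \<Rightarrow> ennreal) \<Rightarrow> bool" where
  "coincide_equiv_norms S N S' N' \<longleftrightarrow>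
     S = S' \<and> (\<exists>C::real. C > 0 \<and> (\<forall>f\<in>S. N f \<le> ennreal C * N' f \<and> N' f \<le> ennreal C * N f))"

end

theory Submission
  imports Defs
begin

text \<open>
  Part (i) is a special case of part (ii), as \<open>p(\<phi>) = 1\<close> has the conjugate index \<open>\<infinity>\<close>. Every exponent is
  compared with the exponent 1. One direction is Hoelder's inequality. The other one is a weighted
  John--Nirenberg inequality in the spirit of Muckenhoupt and Wheeden.

  Write \<open>u\<^bsub>B\<^esub> = f - A f\<close> at the scale of the ball \<open>B\<close>, and \<open>w = \<phi>(\<cdot>, 1 / L)\<close> with \<open>L\<close> the norm of the indicator
  of \<open>B\<close>, so that \<open>w(B)\<close> is comparable with 1. Upper type 1 gives \<open>L' \<le> C L w(B')\<close> for the balls \<open>B'\<close> in \<open>B\<close>, so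
  the norm bound for the exponent 1 reads \<open>\<integral>|u| \<le> C K L w(B')\<close> over \<open>B'\<close>, with the single weight \<open>w\<close>. Stop at the
  points of \<open>B\<close> with a ball around them over which the integral of \<open>|u\<^bsub>B\<^esub>|\<close> exceeds \<open>\<lambda> K L\<close> times its
  weight. Vitali's lemma covers them by balls \<open>P\<close> of total weight at most \<open>C / \<lambda>\<close>; off these balls
  \<open>|u\<^bsub>B\<^esub>| \<le> C \<lambda> K L w\<close> by differentiation. On each \<open>P\<close> the semigroup property gives
  \<open>u\<^bsub>B\<^esub> - u\<^bsub>P\<^esub> = A\<^bsub>P\<^esub> u\<^bsub>B\<^esub> - A\<^bsub>B\<^esub> u\<^bsub>P\<^esub>\<close>, which the kernel bounds and the stopping rule control by
  \<open>C \<lambda> K L w(P) / \<mu>(P) + C K L / \<mu>(B)\<close>. Now iterate inside the balls \<open>P\<close>. The integrals of the \<open>p\<close>-th powers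
  against \<open>w\<close> to the power \<open>1 - p\<close> add up by the \<open>A\<^bsub>p'\<^esub>\<close> condition, which is available because \<open>p < p(\<phi>)'\<close> means
  \<open>p' > p(\<phi>)\<close>.
\<close>

section \<open>Quasi-metric measure spaces\<close>

text \<open>The stopping argument cannot be closed by absorbing the \<open>p\<close>-th power
  integral into itself, since that integral is not known to be finite for any \<open>p > 1\<close>.
  So every generation is allowed a leftover set, and two quantities shrink together: the coefficient
  of the inherited bound, through the weight of the stopping balls, and the leftover set, through
  their measure. The weight changes between generations, as a stopping ball has a norm of its own.
  The exchange costs the power \<open>p - 1\<close> of the ratio of the norms. This leaves the norm
  of the stopping ball to the first power, which its weight controls and which can be summed. The
  extremal exponents \<open>n0\<close>, \<open>p(\<phi>)\<close> and \<open>i(\<phi>)\<close> need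
  not be attained. Nearby \<open>n\<close>, \<open>q\<close>, \<open>i\<close> with
  \<open>n * q / i < M\<close> replace them; the strict bound on \<open>M\<close> permits this. That
  quotient governs the growth of norms of balls under dilation, so the kernel integrals converge.
  Balls need not be open and separability is not assumed, so regularity, covering and
  differentiation are derived from the measure.\<close>

locale quasi_metric_measure =
  fixes d :: "'a \<Rightarrow> 'a \<Rightarrow> real" and \<mu> :: "'a measure" and \<kappa> :: real
  assumes \<kappa>_ge_1: "1 \<le> \<kappa>"
    and d_nonneg: "0 \<le> d x y"
    and d_eq_0: "d x y = 0 \<longleftrightarrow> x = y"
    and d_sym: "d x y = d y x"
    and d_triangle: "d x y \<le> \<kappa> * (d x z + d z y)"
    and space_\<mu>: "space \<mu> = UNIV"
    and sets_\<mu>: "sets \<mu> = sigma_sets UNIV {U. quasi_open d U}"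
    and ball_sets: "0 < r \<Longrightarrow> qball d x r \<in> sets \<mu>"
    and ball_pos: "0 < r \<Longrightarrow> 0 < emeasure \<mu> (qball d x r)"
    and ball_finite: "0 < r \<Longrightarrow> emeasure \<mu> (qball d x r) < \<infinity>"
begin

abbreviation B :: "'a \<Rightarrow> real \<Rightarrow> 'a set" where "B \<equiv> qball d"

lemma ball_sets' [measurable, simp]: "B x r \<in> sets \<mu>"
proof (cases "0 < r")
  case False
  then have "B x r = {}"
    using d_nonneg by (auto simp: qball_def) (smt (verit))
  then show ?thesis by simp
qed (rule ball_sets)

lemma in_B [simp]: "y \<in> B x r \<longleftrightarrow> d y x < r"
  by (simp add: qball_def)

lemma center_in_B: "0 < r \<Longrightarrow> x \<in> B x r"
  using d_eq_0[of x x] by simp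

lemma B_mono: "r \<le> s \<Longrightarrow> B x r \<subseteq> B x s"
  by auto

definition V :: "'a \<Rightarrow> real \<Rightarrow> real" where "V x r = measure \<mu> (B x r)"

lemma emeasure_B: "0 < r \<Longrightarrow> emeasure \<mu> (B x r) = ennreal (V x r)"
  using ball_finite[of r x] by (simp add: V_def emeasure_eq_ennreal_measure less_top[symmetric])

lemma V_pos: "0 < r \<Longrightarrow> 0 < V x r"
  using ball_pos[of r x] emeasure_B[of r x] by simp

lemma V_mono: "B y s \<subseteq> B x r \<Longrightarrow> 0 < r \<Longrightarrow> V y s \<le> V x r"
  unfolding V_def using ball_finite[of r x]
  by (intro measure_mono_fmeasurable) (auto simp: fmeasurable_def)

lemma ball_subset: "d y x \<le> D \<Longrightarrow> \<kappa> * (D + s) \<le> r \<Longrightarrow> B y s \<subseteq> B x r"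
proof
  fix z assume a: "d y x \<le> D" "\<kappa> * (D + s) \<le> r" "z \<in> B y s"
  have "d z x \<le> \<kappa> * (d z y + d y x)" by (rule d_triangle)
  also have "\<dots> < \<kappa> * (D + s)"
    using a \<kappa>_ge_1 by (intro mult_strict_left_mono) auto
  finally show "z \<in> B x r" using a by simp
qed

text \<open>Balls need not be quasi-open, but each contains a quasi-open neighbourhood of its centre:
  attach to the centre balls of geometrically decreasing radii, again and again.\<close>

lemma quasi_open_in_ball:
  assumes "0 < r"
  obtains U where "quasi_open d U" "x \<in> U" "U \<subseteq> B x r"
proof
  \<comment> \<open>With this ratio \<open>2 * \<kappa> * \<rho> (Suc j) = \<rho> j\<close>: the
    remainder of a chain beyond step \<open>j\<close> spans less than \<open>\<rho> j\<close>, as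
    the step itself does, so the factor \<open>\<kappa>\<close> is absorbed at every link.\<close>
  define \<rho> where "\<rho> k = r * (1 / (2 * \<kappa>)) ^ Suc k" for k
  define U where "U = (\<lambda>k. rec_nat {x} (\<lambda>k U. \<Union>z\<in>U. B z (\<rho> k)) k)"
  have \<rho>: "0 < \<rho> k" for k using assms \<kappa>_ge_1 by (simp add: \<rho>_def)
  have U0: "U 0 = {x}" and US: "U (Suc k) = (\<Union>z\<in>U k. B z (\<rho> k))" for k
    by (simp_all add: U_def)
  show "quasi_open d (\<Union>k. U k)"
    unfolding quasi_open_def
  proof
    fix z assume "z \<in> (\<Union>k. U k)"
    then obtain k where "z \<in> U k" by auto
    then have "B z (\<rho> k) \<subseteq> U (Suc k)" by (auto simp: US)
    then show "\<exists>r>0. B z r \<subseteq> (\<Union>k. U k)" using \<rho> by blast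
  qed
  show "x \<in> (\<Union>k. U k)" using U0 by auto
  text \<open>The quasi-triangle inequality has to be iterated from the far end of a chain of points, whence
    the detour through chains of fixed length.\<close>
  have chain: "\<exists>c. c 0 = x \<and> c k = y \<and> (\<forall>j<k. d (c (Suc j)) (c j) < \<rho> j)" if "y \<in> U k" for y k
    using that
  proof (induction k arbitrary: y)
    case 0 then show ?case by (auto simp: U0 intro!: exI[of _ "\<lambda>_. x"])
  next
    case (Suc k)
    then obtain z where z: "z \<in> U k" "d y z < \<rho> k" by (auto simp: US)
    from Suc.IH[OF z(1)] obtain c where c: "c 0 = x" "c k = z" "\<forall>j<k. d (c (Suc j)) (c j) < \<rho> j" by auto
    then show ?case using z by (intro exI[of _ "c(Suc k := y)"]) (auto simp: less_Suc_eq)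
  qed
  have dist: "j < k \<Longrightarrow> (\<forall>j<k. d (c (Suc j)) (c j) < \<rho> j) \<Longrightarrow> d (c k) (c j) < 2 * \<kappa> * \<rho> j"
    for c k j
  proof (induction "k - j" arbitrary: j)
    case (Suc m)
    have rs: "2 * \<kappa> * \<rho> (Suc j) = \<rho> j" using \<kappa>_ge_1 by (simp add: \<rho>_def field_simps)
    show ?case
    proof (cases "Suc j = k")
      case True
      then have "d (c k) (c j) < \<rho> j" using Suc by auto
      also have "\<dots> \<le> 2 * \<kappa> * \<rho> j" using \<rho>[of j] \<kappa>_ge_1 mult_right_mono[of 1 "2*\<kappa>" "\<rho> j"] by simp
      finally show ?thesis .
    next
      case False
      then have "d (c k) (c (Suc j)) < \<rho> j" using Suc.hyps(1)[of "Suc j"] Suc.hyps(2) Suc.prems rs by auto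
      moreover have "d (c (Suc j)) (c j) < \<rho> j" using Suc by auto
      ultimately have "\<kappa> * (d (c k) (c (Suc j)) + d (c (Suc j)) (c j)) < \<kappa> * (\<rho> j + \<rho> j)"
        using \<kappa>_ge_1 by (intro mult_strict_left_mono) auto
      then show ?thesis using d_triangle[of "c k" "c j" "c (Suc j)"] by (simp add: algebra_simps)
    qed
  qed simp
  show "(\<Union>k. U k) \<subseteq> B x r"
  proof
    fix y assume "y \<in> (\<Union>k. U k)"
    then obtain k where "y \<in> U k" by auto
    then obtain c where c: "c 0 = x" "c k = y" "\<forall>j<k. d (c (Suc j)) (c j) < \<rho> j" using chain by blast
    show "y \<in> B x r"
    proof (cases "k = 0")
      case True then show ?thesis using c center_in_B[OF assms] by auto
    next
      case False
      then have "d y x < 2 * \<kappa> * \<rho> 0" using dist[of 0 k c] c by auto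
      also have "\<dots> = r" using \<kappa>_ge_1 by (simp add: \<rho>_def)
      finally show ?thesis by simp
    qed
  qed
qed

section \<open>Outer regularity by quasi-open sets\<close>

lemma quasi_open_sets: "quasi_open d U \<Longrightarrow> U \<in> sets \<mu>"
  unfolding sets_\<mu> by (rule sigma_sets.Basic) simp

lemma quasi_open_UN: "(\<And>i. i \<in> I \<Longrightarrow> quasi_open d (U i)) \<Longrightarrow> quasi_open d (\<Union>i\<in>I. U i)"
  unfolding quasi_open_def by (metis UN_E UN_I UN_upper order_trans)

lemma quasi_open_Int: "quasi_open d U \<Longrightarrow> quasi_open d U' \<Longrightarrow> quasi_open d (U \<inter> U')"
  unfolding quasi_open_def
proof
  fix x assume "\<forall>x\<in>U. \<exists>r>0. B x r \<subseteq> U" "\<forall>x\<in>U'. \<exists>r>0. B x r \<subseteq> U'" "x \<in> U \<inter> U'"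
  then obtain r s where "r > 0" "B x r \<subseteq> U" "s > 0" "B x s \<subseteq> U'" by blast
  then show "\<exists>r>0. B x r \<subseteq> U \<inter> U'" by (intro exI[of _ "min r s"]) auto
qed

lemma quasi_open_INT:
  "finite I \<Longrightarrow> (\<And>i. i \<in> I \<Longrightarrow> quasi_open d (U i)) \<Longrightarrow> quasi_open d (\<Inter>i\<in>I. U i)"
proof (induction I rule: finite_induct)
  case empty then show ?case by (auto simp: quasi_open_def intro!: exI[of _ 1])
next
  case (insert i I) then show ?case by (auto intro!: quasi_open_Int)
qed

text \<open>Closed sets are intersections of shrinking neighbourhoods, along which a finite measure
  is continuous. The neighbourhoods are built from the sets of \<open>quasi_open_in_ball\<close>,
  because unions of balls need not be quasi-open.\<close>

lemma quasi_closed_approx: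
  assumes \<nu>: "finite_measure \<nu>" "sets \<nu> = sets \<mu>" and F: "quasi_open d (- F)" and "0 < e"
  shows "\<exists>U. quasi_open d U \<and> F \<subseteq> U \<and> measure \<nu> (U - F) < e"
proof -
  interpret finite_measure \<nu> by fact
  have "\<forall>x k. \<exists>U. quasi_open d U \<and> x \<in> U \<and> U \<subseteq> B x (1 / Suc k)" for k::nat
    by (metis quasi_open_in_ball of_nat_0_less_iff zero_less_Suc zero_less_divide_1_iff)
  then obtain N where N: "\<And>x k. quasi_open d (N x k)" "\<And>x k. x \<in> N x k" "\<And>x k. N x k \<subseteq> B x (1 / Suc k)"
    by metis
  \<comment> \<open>The intersection over \<open>j \<le> k\<close> makes the sequence decreasing:
    the neighbourhoods \<open>N x k\<close> of a point need not be nested.\<close>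
  define U where "U k = (\<Inter>j\<in>{..k}. \<Union>x\<in>F. N x j)" for k
  have oU: "quasi_open d (U k)" for k
    unfolding U_def by (intro quasi_open_INT quasi_open_UN N) auto
  have FU: "F \<subseteq> U k" for k using N(2) by (auto simp: U_def)
  have Fs: "F \<in> sets \<mu>" using quasi_open_sets[OF F] space_\<mu>
    by (metis Compl_eq_Diff_UNIV double_compl sets.compl_sets)
  have "(\<Inter>k. U k) \<subseteq> F"
  proof (rule ccontr)
    assume "\<not> (\<Inter>k. U k) \<subseteq> F"
    then obtain z where z: "z \<in> (\<Inter>k. U k)" "z \<notin> F" by auto
    then obtain r where r: "r > 0" "B z r \<subseteq> - F" using F unfolding quasi_open_def by blast
    obtain k where k: "1 / Suc k < r" using r(1) by (meson nat_approx_posE)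
    have "z \<in> U k" using z by auto
    then obtain x where "x \<in> F" "z \<in> N x k" by (auto simp: U_def)
    then have "d z x < 1 / Suc k" using N(3)[of x k] by auto
    then have "x \<in> B z r" using k by (simp add: d_sym[of x z])
    then show False using r \<open>x \<in> F\<close> by auto
  qed
  then have eq: "(\<Inter>k. U k - F) = {}" by auto
  have "(\<lambda>k. measure \<nu> (U k - F)) \<longlonglongrightarrow> measure \<nu> (\<Inter>k. U k - F)"
  proof (rule finite_Lim_measure_decseq)
    show "range (\<lambda>k. U k - F) \<subseteq> sets \<nu>" using quasi_open_sets[OF oU] Fs \<nu> by auto
    show "decseq (\<lambda>k. U k - F)" by (fastforce simp: decseq_def U_def)
  qed
  then have "\<forall>\<^sub>F k in sequentially. measure \<nu> (U k - F) < e"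
    using \<open>0 < e\<close> unfolding eq by (simp add: order_tendsto_iff)
  then obtain k where "measure \<nu> (U k - F) < e" by (auto simp: eventually_sequentially)
  then show ?thesis using oU FU by blast
qed

text \<open>The induction over the sigma-algebra carries a set and its complement together, since
  approximation from outside does not pass to complements by itself. For the generators the
  complements are the closed sets of \<open>quasi_closed_approx\<close>.\<close>

lemma outer_regular:
  assumes \<nu>: "finite_measure \<nu>" "sets \<nu> = sets \<mu>" and A: "A \<in> sets \<mu>"
  shows "\<forall>e>0. \<exists>U. quasi_open d U \<and> A \<subseteq> U \<and> measure \<nu> (U - A) < e"
proof -
  interpret finite_measure \<nu> by fact
  note qs [measurable] = quasi_open_sets[folded \<nu>(2)]
  define OR where "OR A \<longleftrightarrow> (\<forall>e>0. \<exists>U. quasi_open d U \<and> A \<subseteq> U \<and> measure \<nu> (U - A) < e)" for A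
  have "OR A \<and> OR (- A) \<and> A \<in> sets \<nu>"
    using A unfolding sets_\<mu>
  proof (induction rule: sigma_sets.induct)
    case (Basic U)
    then have U: "quasi_open d U" by simp
    show ?case unfolding OR_def
      using quasi_closed_approx[OF \<nu>, of "- U"] U quasi_open_sets[OF U] \<nu> by (auto intro!: exI[of _ U])
  next
    case Empty
    have 1: "quasi_open d {}" and 2: "quasi_open d UNIV"
      by (auto simp: quasi_open_def intro!: exI[of _ 1])
    have "OR {}" unfolding OR_def using 1 by (intro allI impI exI[of _ "{}"]) simp
    moreover have "OR UNIV" unfolding OR_def using 2 by (intro allI impI exI[of _ UNIV]) simp
    ultimately show ?case by simp
  next
    case (Compl A)
    then show ?case using \<nu> space_\<mu> by (auto simp: Compl_eq_Diff_UNIV[symmetric])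
         (metis Compl_eq_Diff_UNIV sets.compl_sets)
  next
    case (Union A)
    then have A: "\<And>i. OR (A i)" "\<And>i. OR (- A i)" and As [measurable]: "\<And>i. A i \<in> sets \<nu>" by auto
    have AC [measurable]: "- A i \<in> sets \<nu>" for i
      using As[of i] \<nu> space_\<mu> by (metis Compl_eq_Diff_UNIV sets.compl_sets sets_eq_imp_space_eq)
    have "OR (\<Union>i. A i)" unfolding OR_def
    proof (intro allI impI)
      fix e :: real assume e: "0 < e"
      have "\<forall>i. \<exists>U. quasi_open d U \<and> A i \<subseteq> U \<and> measure \<nu> (U - A i) < (e/2) * (1/2) ^ Suc i"
      proof
        fix i show "\<exists>U. quasi_open d U \<and> A i \<subseteq> U \<and> measure \<nu> (U - A i) < (e/2) * (1/2) ^ Suc i"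
          using A(1)[of i] e unfolding OR_def by (elim allE[of _ "(e/2) * (1/2) ^ Suc i"]) simp
      qed
      then obtain U where U: "\<And>i. quasi_open d (U i)" "\<And>i. A i \<subseteq> U i"
        "\<And>i. measure \<nu> (U i - A i) < (e/2) * (1/2) ^ Suc i" by metis
      have [measurable]: "U i \<in> sets \<nu>" for i using U(1) qs by blast
      have sm: "(\<lambda>i. (e/2) * (1/2::real) ^ Suc i) sums (e/2)"
        using sums_mult[OF power_half_series, of "e/2"] by simp
      have s1: "summable (\<lambda>i. measure \<nu> (U i - A i))"
        by (rule summable_comparison_test'[OF sums_summable[OF sm], of 0]) (use U(3) less_imp_le in auto)
      have "measure \<nu> ((\<Union>i. U i) - (\<Union>i. A i)) \<le> measure \<nu> (\<Union>i. U i - A i)"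
        by (intro finite_measure_mono) auto
      also have "\<dots> \<le> (\<Sum>i. measure \<nu> (U i - A i))"
        by (intro finite_measure_subadditive_countably s1) auto
      also have "\<dots> \<le> (\<Sum>i. (e/2) * (1/2) ^ Suc i)"
        by (intro suminf_le s1 sums_summable[OF sm] less_imp_le U)
      also have "\<dots> < e" using sums_unique[OF sm] e by simp
      finally show "\<exists>V'. quasi_open d V' \<and> (\<Union>i. A i) \<subseteq> V' \<and> measure \<nu> (V' - (\<Union>i. A i)) < e"
        using U by (intro exI[of _ "\<Union>i. U i"]) (auto intro!: quasi_open_UN)
    qed
    moreover have "OR (- (\<Union>i. A i))" unfolding OR_def
    proof (intro allI impI)
      fix e :: real assume e: "0 < e"
      \<comment> \<open>An infinite intersection of quasi-open sets need not be quasi-open, so only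
        the complements up to a suitable \<open>n\<close> are approximated. Their errors share one
        half of \<open>e\<close>, the truncation takes the other.\<close>
      define C where "C n = (\<Inter>i\<le>n. - A i)" for n
      have [measurable]: "C n \<in> sets \<nu>" for n unfolding C_def by auto
      have lim: "(\<lambda>n. measure \<nu> (C n - (\<Inter>i. - A i))) \<longlonglongrightarrow> measure \<nu> (\<Inter>n. C n - (\<Inter>i. - A i))"
        by (rule finite_Lim_measure_decseq) (fastforce simp: decseq_def C_def)+
      have eq: "(\<Inter>n. C n - (\<Inter>i. - A i)) = {}" by (auto simp: C_def)
      have "\<forall>\<^sub>F n in sequentially. measure \<nu> (C n - (\<Inter>i. - A i)) < e / 2"
        using lim e unfolding eq by (intro order_tendstoD(2)[where y = 0]) simp_all
      then obtain n where n: "measure \<nu> (C n - (\<Inter>i. - A i)) < e / 2" by (auto simp: eventually_sequentially)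
      have "\<forall>i. \<exists>U. quasi_open d U \<and> - A i \<subseteq> U \<and> measure \<nu> (U - (- A i)) < e / (2 * Suc n)"
      proof
        fix i show "\<exists>U. quasi_open d U \<and> - A i \<subseteq> U \<and> measure \<nu> (U - - A i) < e / (2 * Suc n)"
          using A(2)[of i] e unfolding OR_def by (elim allE[of _ "e / (2 * Suc n)"]) simp
      qed
      then obtain U where U: "\<And>i. quasi_open d (U i)" "\<And>i. - A i \<subseteq> U i"
        "\<And>i. measure \<nu> (U i - (- A i)) < e / (2 * Suc n)" by metis
      have [measurable]: "U i \<in> sets \<nu>" for i using U(1) qs by blast
      define V' where "V' = (\<Inter>i\<in>{..n}. U i)"
      have oV: "quasi_open d V'" unfolding V'_def by (intro quasi_open_INT U) auto
      have sub: "- (\<Union>i. A i) \<subseteq> V'" using U(2) by (auto simp: V'_def)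
      have "measure \<nu> (V' - (- (\<Union>i. A i))) \<le> measure \<nu> ((C n - (\<Inter>i. - A i)) \<union> (\<Union>i\<in>{..n}. U i - (- A i)))"
        by (intro finite_measure_mono) (auto simp: V'_def C_def)
      also have "\<dots> \<le> measure \<nu> (C n - (\<Inter>i. - A i)) + measure \<nu> (\<Union>i\<in>{..n}. U i - (- A i))"
        by (intro measure_Un_le) auto
      also have "measure \<nu> (\<Union>i\<in>{..n}. U i - (- A i)) \<le> (\<Sum>i\<in>{..n}. measure \<nu> (U i - (- A i)))"
        by (intro measure_UNION_le) auto
      also have "\<dots> \<le> (\<Sum>i\<in>{..n}. e / (2 * Suc n))" by (intro sum_mono less_imp_le U)
      also have "\<dots> = e / 2" by (simp add: field_simps)
      finally show "\<exists>U. quasi_open d U \<and> - (\<Union>i. A i) \<subseteq> U \<and> measure \<nu> (U - - (\<Union>i. A i)) < e"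
        using n oV sub by (intro exI[of _ V']) auto
    qed
    ultimately show ?case by auto
  qed
  then show ?thesis unfolding OR_def by blast
qed

section \<open>Vitali coverings by balls of bounded radius\<close>

lemma countable_disjoint_positive:
  assumes D: "disjoint_family_on F I" and F: "\<And>i. i \<in> I \<Longrightarrow> F i \<in> sets \<mu> \<and> 0 < emeasure \<mu> (F i) \<and> F i \<subseteq> Z"
    and Z: "Z \<in> sets \<mu>" "emeasure \<mu> Z < \<infinity>"
  shows "countable I"
proof -
  \<comment> \<open>Inside a set of finite measure only finitely many disjoint sets can have measure
    above a given threshold; this takes the place of separability.\<close>
  define N where "N k = {i \<in> I. measure \<mu> (F i) > 1 / Suc k}" for k :: nat
  have fmF: "emeasure \<mu> (F i) < \<infinity>" if "i \<in> I" for i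
    using F[OF that] Z by (metis emeasure_mono order_le_less_trans)
  have "finite (N k)" for k
  proof (rule ccontr)
    assume inf: "infinite (N k)"
    obtain b :: nat where b: "measure \<mu> Z * Suc k < b" using reals_Archimedean2 by blast
    obtain T where T: "T \<subseteq> N k" "finite T" "card T = b" using infinite_arbitrarily_large[OF inf] by blast
    have TI: "T \<subseteq> I" using T by (auto simp: N_def)
    have "b / Suc k = (\<Sum>i\<in>T. 1 / Suc k)" using T by simp
    also have "\<dots> \<le> (\<Sum>i\<in>T. measure \<mu> (F i))" using T by (intro sum_mono) (auto simp: N_def less_imp_le)
    also have "\<dots> = measure \<mu> (\<Union>i\<in>T. F i)"
    proof (rule measure_finite_Union[symmetric])
      show "disjoint_family_on F T" using D TI by (auto simp: disjoint_family_on_def)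
    qed (use T TI F fmF in \<open>auto simp: less_top[symmetric]\<close>)
    also have "\<dots> \<le> measure \<mu> Z"
      by (rule measure_mono_fmeasurable) (use F TI Z T in \<open>auto simp: fmeasurable_def intro!: sets.finite_UN\<close>)
    finally show False using b by (simp add: field_simps)
  qed
  moreover have "I = (\<Union>k. N k)"
  proof
    show "I \<subseteq> (\<Union>k. N k)"
    proof
      fix i assume i: "i \<in> I"
      have "0 < measure \<mu> (F i)" using F[OF i] fmF[OF i] by (simp add: measure_def enn2real_positive_iff)
      then obtain k where "1 / Suc k < measure \<mu> (F i)" by (meson nat_approx_posE)
      then show "i \<in> (\<Union>k. N k)" using i by (auto simp: N_def)
    qed
  qed (auto simp: N_def)
  ultimately show ?thesis by (metis countable_UN countable_finite countableI_type)
qed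

text \<open>The balls may be uncountably many, so Zorn's lemma replaces a greedy selection. Only the
  centres are covered: meeting a ball of at least half the radius puts a centre within
  \<open>3 * \<kappa>\<close> radii, rounded up to \<open>4 * \<kappa>\<close>.\<close>

lemma vitali_set:
  assumes s: "\<And>x. x \<in> X \<Longrightarrow> 0 < s x \<and> s x \<le> R"
  shows "\<exists>Y\<subseteq>X. disjoint_family_on (\<lambda>y. B y (s y)) Y \<and> (\<forall>x\<in>X. \<exists>y\<in>Y. d x y < 4 * \<kappa> * s y)"
proof -
  define meets where "meets x y \<longleftrightarrow> B x (s x) \<inter> B y (s y) \<noteq> {}" for x y
  \<comment> \<open>The last clause is what a greedy selection would guarantee. It survives unions
    of chains, whereas a merely maximal disjoint family would give no comparison of radii.\<close>
  define \<A> where "\<A> = {Y. Y \<subseteq> X \<and> disjoint_family_on (\<lambda>y. B y (s y)) Y \<and>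
     (\<forall>x\<in>X. (\<exists>y\<in>Y. meets x y) \<longrightarrow> (\<exists>y\<in>Y. meets x y \<and> s x \<le> 2 * s y))}"
  have "\<exists>M\<in>\<A>. \<forall>Y\<in>\<A>. M \<subseteq> Y \<longrightarrow> Y = M"
  proof (rule subset_Zorn')
    fix C assume C: "subset.chain \<A> C"
    then have CA: "C \<subseteq> \<A>" and ch: "\<And>Y Z. Y \<in> C \<Longrightarrow> Z \<in> C \<Longrightarrow> Y \<subseteq> Z \<or> Z \<subseteq> Y"
      by (auto simp: subset_chain_def)
    have "disjoint_family_on (\<lambda>y. B y (s y)) (\<Union>C)"
      unfolding disjoint_family_on_def
    proof (intro ballI impI)
      fix y z assume "y \<in> \<Union>C" "z \<in> \<Union>C" "y \<noteq> z"
      then obtain Y where "Y \<in> C" "y \<in> Y" "z \<in> Y" using ch by blast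
      then show "B y (s y) \<inter> B z (s z) = {}" using CA \<open>y \<noteq> z\<close>
        unfolding \<A>_def disjoint_family_on_def by blast
    qed
    moreover have "\<exists>y\<in>\<Union>C. meets x y \<and> s x \<le> 2 * s y" if "x \<in> X" "\<exists>y\<in>\<Union>C. meets x y" for x
      using that CA unfolding \<A>_def by blast
    ultimately show "\<Union>C \<in> \<A>" using CA unfolding \<A>_def by blast
  qed
  then obtain Y where Y: "Y \<in> \<A>" and mx: "\<And>Z. Z \<in> \<A> \<Longrightarrow> Y \<subseteq> Z \<Longrightarrow> Z = Y" by blast
  have YX: "Y \<subseteq> X" and Yd: "disjoint_family_on (\<lambda>y. B y (s y)) Y"
    and Ym: "\<And>x. x \<in> X \<Longrightarrow> \<exists>y\<in>Y. meets x y \<Longrightarrow> \<exists>y\<in>Y. meets x y \<and> s x \<le> 2 * s y"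
    using Y by (auto simp: \<A>_def)
  have all: "\<exists>y\<in>Y. meets x y" if x: "x \<in> X" for x
  proof (rule ccontr)
    define T where "T = {x \<in> X. \<forall>y\<in>Y. \<not> meets x y}"
    assume "\<not> (\<exists>y\<in>Y. meets x y)"
    then have xT: "x \<in> T" using x by (auto simp: T_def)
    \<comment> \<open>Among the balls that meet no chosen one, a ball of more than half the supremal
      radius could be added: any other of them that meets it is at most twice as large.\<close>
    define S where "S = Sup (s ` T)"
    have bdd: "bdd_above (s ` T)" using s by (auto simp: T_def intro!: bdd_aboveI[of _ R])
    have "s x \<le> S" unfolding S_def using xT bdd by (intro cSup_upper) auto
    then have S0: "0 < S" using s x by force
    then have "S / 2 < Sup (s ` T)" by (simp add: S_def)
    then have "\<exists>y\<in>s ` T. S / 2 < y" using xT by (intro iffD1[OF less_cSup_iff[OF _ bdd]]) auto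
    then obtain z where z: "z \<in> T" "S / 2 < s z" by auto
    have zX: "z \<in> X" using z by (auto simp: T_def)
    have zz: "meets z z" using center_in_B[of "s z" z] s[OF zX] unfolding meets_def by blast
    have zY: "z \<notin> Y" using z zz by (auto simp: T_def)
    have "insert z Y \<in> \<A>"
    proof -
      have "disjoint_family_on (\<lambda>y. B y (s y)) (insert z Y)"
        using Yd z by (auto simp: disjoint_family_on_insert zY T_def meets_def)
      moreover have "\<exists>y\<in>insert z Y. meets w y \<and> s w \<le> 2 * s y"
        if w: "w \<in> X" "\<exists>y\<in>insert z Y. meets w y" for w
      proof (cases "\<exists>y\<in>Y. meets w y")
        case True then show ?thesis using Ym[OF w(1)] by blast
      next
        case False
        then have "w \<in> T" "meets w z" using w by (auto simp: T_def)
        then have "s w \<le> S" unfolding S_def using bdd by (intro cSup_upper) auto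
        then show ?thesis using z \<open>meets w z\<close> by (intro bexI[of _ z]) auto
      qed
      ultimately show ?thesis using YX zX unfolding \<A>_def by blast
    qed
    then show False using mx zY by blast
  qed
  have "\<exists>y\<in>Y. d x y < 4 * \<kappa> * s y" if x: "x \<in> X" for x
  proof -
    obtain y where y: "y \<in> Y" "meets x y" "s x \<le> 2 * s y" using Ym[OF x all[OF x]] by blast
    then obtain z where z: "d z x < s x" "d z y < s y" by (auto simp: meets_def)
    have "d x y \<le> \<kappa> * (d x z + d z y)" by (rule d_triangle)
    also have "\<dots> < \<kappa> * (s x + s y)" using z d_sym[of x z] \<kappa>_ge_1 by (intro mult_strict_left_mono) auto
    also have "\<dots> \<le> \<kappa> * (4 * s y)" using y \<kappa>_ge_1 s YX by (intro mult_left_mono) force+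
    finally show ?thesis using y by (auto simp: algebra_simps)
  qed
  then show ?thesis using YX Yd by blast
qed

text \<open>The finite measure of \<open>Z\<close> makes the disjoint family countable. Its indices
  form a subset \<open>J\<close> of the naturals, as it may be finite or empty; sums over it become
  series with the factor \<open>indicator J j\<close>.\<close>

lemma vitali:
  assumes s: "\<And>x. x \<in> X \<Longrightarrow> 0 < s x \<and> s x \<le> R \<and> B x (s x) \<subseteq> Z"
    and Z: "Z \<in> sets \<mu>" "emeasure \<mu> Z < \<infinity>"
  obtains y :: "nat \<Rightarrow> 'a" and J :: "nat set" where "\<And>j. j \<in> J \<Longrightarrow> y j \<in> X"
    "disjoint_family_on (\<lambda>j. B (y j) (s (y j))) J"
    "X \<subseteq> (\<Union>j\<in>J. B (y j) (4 * \<kappa> * s (y j)))"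
proof -
  obtain Y where Y: "Y \<subseteq> X" "disjoint_family_on (\<lambda>y. B y (s y)) Y"
    "\<forall>x\<in>X. \<exists>y\<in>Y. d x y < 4 * \<kappa> * s y"
    using vitali_set[of X s R] s by blast
  have c: "countable Y"
    by (rule countable_disjoint_positive[OF Y(2) _ Z]) (use s Y ball_pos in auto)
  have inj: "inj_on (from_nat_into Y) (to_nat_on Y ` Y)"
    using c by (auto simp: inj_on_def)
  show ?thesis
  proof (rule that[of "to_nat_on Y ` Y" "from_nat_into Y"])
    show "disjoint_family_on (\<lambda>j. B (from_nat_into Y j) (s (from_nat_into Y j))) (to_nat_on Y ` Y)"
      unfolding disjoint_family_on_def
    proof (intro ballI impI)
      fix i j assume ij: "i \<in> to_nat_on Y ` Y" "j \<in> to_nat_on Y ` Y" "i \<noteq> j"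
      then have "from_nat_into Y i \<noteq> from_nat_into Y j" using inj by (auto dest: inj_onD)
      moreover have "from_nat_into Y i \<in> Y" "from_nat_into Y j \<in> Y" using ij c by auto
      ultimately show "B (from_nat_into Y i) (s (from_nat_into Y i)) \<inter>
        B (from_nat_into Y j) (s (from_nat_into Y j)) = {}"
        using Y(2) by (auto simp: disjoint_family_on_def)
    qed
  qed (use Y c in auto)
qed

section \<open>Series over disjoint and covering families, and comparison of measures\<close>

lemma emeasure_suminf_disjoint:
  assumes "disjoint_family_on F J" "\<And>j. j \<in> J \<Longrightarrow> F j \<in> sets M"
  shows "(\<Sum>j::nat. indicator J j * emeasure M (F j)) = emeasure M (\<Union>j\<in>J. F j)"
proof -
  define G where "G j = (if j \<in> J then F j else {})" for j
  have "(\<Sum>j. indicator J j * emeasure M (F j)) = (\<Sum>j. emeasure M (G j))"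
    by (intro suminf_cong) (auto simp: G_def)
  also have "\<dots> = emeasure M (\<Union>j. G j)"
    by (rule suminf_emeasure) (use assms in \<open>auto simp: G_def disjoint_family_on_def\<close>)
  also have "(\<Union>j. G j) = (\<Union>j\<in>J. F j)" by (auto simp: G_def)
  finally show ?thesis .
qed

lemma emeasure_suminf_cover:
  assumes "A \<subseteq> (\<Union>j\<in>J. F j)" "\<And>j. j \<in> J \<Longrightarrow> F j \<in> sets M"
  shows "emeasure M A \<le> (\<Sum>j::nat. indicator J j * emeasure M (F j))"
proof -
  define G where "G j = (if j \<in> J then F j else {})" for j
  have "emeasure M A \<le> emeasure M (\<Union>j. G j)"
    by (rule emeasure_mono) (use assms in \<open>auto simp: G_def split: if_splits\<close>)
  also have "\<dots> \<le> (\<Sum>j. emeasure M (G j))"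
    by (rule emeasure_subadditive_countably) (use assms in \<open>auto simp: G_def\<close>)
  also have "\<dots> = (\<Sum>j. indicator J j * emeasure M (F j))"
    by (intro suminf_cong) (auto simp: G_def)
  finally show ?thesis .
qed

text \<open>Meant for \<open>a j\<close> the mass of an enlarged ball, bounded through doubling by
  the mass of the small ball \<open>F j\<close>.\<close>

lemma suminf_le_disjoint:
  assumes "disjoint_family_on F J" "\<And>j. j \<in> J \<Longrightarrow> F j \<in> sets M"
    and le: "\<And>j. j \<in> J \<Longrightarrow> a j \<le> c * emeasure M (F j)"
  shows "(\<Sum>j::nat. indicator J j * a j) \<le> c * emeasure M (\<Union>j\<in>J. F j)"
proof -
  have "(\<Sum>j. indicator J j * a j) \<le> (\<Sum>j. c * (indicator J j * emeasure M (F j)))"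
    using le by (intro suminf_le summableI) (auto split: split_indicator)
  also have "\<dots> = c * emeasure M (\<Union>j\<in>J. F j)"
    by (simp add: emeasure_suminf_disjoint[OF assms(1,2), symmetric])
  finally show ?thesis .
qed

text \<open>This takes the place of Lebesgue's differentiation theorem. A quasi-open set of nearly
  the same mass as \<open>A\<close> confines the disjoint Vitali balls, and the doubling constant
  pays for their enlargement.\<close>

lemma domination:
  assumes \<nu>: "finite_measure \<nu>" "sets \<nu> = sets \<mu>" and \<tau>: "sets \<tau> = sets \<mu>" and A: "A \<in> sets \<mu>"
    and \<delta>: "0 < \<delta>"
    and Z: "Z \<in> sets \<mu>" "emeasure \<mu> Z < \<infinity>" "\<And>x. x \<in> A \<Longrightarrow> B x \<delta> \<subseteq> Z"
    and le: "\<And>x s. x \<in> A \<Longrightarrow> 0 < s \<Longrightarrow> s \<le> \<delta> \<Longrightarrow> emeasure \<tau> (B x s) \<le> ennreal l * emeasure \<nu> (B x s)"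
    and dbl: "\<And>x s. x \<in> A \<Longrightarrow> 0 < s \<Longrightarrow> s \<le> \<delta> \<Longrightarrow> emeasure \<nu> (B x (4 * \<kappa> * s)) \<le> ennreal D * emeasure \<nu> (B x s)"
  shows "emeasure \<tau> A \<le> ennreal l * ennreal D * emeasure \<nu> A"
proof -
  interpret finite_measure \<nu> by fact
  have "emeasure \<tau> A \<le> ennreal l * ennreal D * (emeasure \<nu> A + ennreal e)" if e: "0 < e" for e
  proof -
    obtain U where U: "quasi_open d U" "A \<subseteq> U" "measure \<nu> (U - A) < e"
      using outer_regular[OF \<nu> A] e by blast
    have "\<forall>x\<in>A. \<exists>s>0. B x s \<subseteq> U"
      using U(1,2) unfolding quasi_open_def by blast
    then obtain s0 where s0: "\<And>x. x \<in> A \<Longrightarrow> 0 < s0 x" "\<And>x. x \<in> A \<Longrightarrow> B x (s0 x) \<subseteq> U" by metis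
    \<comment> \<open>The cap on the radii keeps the enlarged balls within radius
      \<open>\<delta>\<close>, where \<open>le\<close> applies.\<close>
    define s where "s x = min (s0 x) (\<delta> / (4 * \<kappa>))" for x
    have k: "0 < \<delta> / (4 * \<kappa>)" "\<delta> / (4 * \<kappa>) \<le> \<delta>" using \<delta> \<kappa>_ge_1 by (auto simp: field_simps)
    have s: "0 < s x \<and> s x \<le> \<delta> / (4 * \<kappa>) \<and> B x (s x) \<subseteq> U \<and> B x (s x) \<subseteq> Z" if "x \<in> A" for x
      using s0[OF that] B_mono[of "s x" "s0 x" x] B_mono[of "s x" \<delta> x] Z(3)[OF that] k
      by (auto simp: s_def)
    obtain y :: "nat \<Rightarrow> 'a" and J where y: "\<And>j. j \<in> J \<Longrightarrow> y j \<in> A"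
      "disjoint_family_on (\<lambda>j. B (y j) (s (y j))) J"
      "A \<subseteq> (\<Union>j\<in>J. B (y j) (4 * \<kappa> * s (y j)))"
      by (rule vitali[of A s "\<delta> / (4 * \<kappa>)" Z]) (use s Z in auto)
    have "emeasure \<tau> A \<le> (\<Sum>j. indicator J j * emeasure \<tau> (B (y j) (4 * \<kappa> * s (y j))))"
      by (rule emeasure_suminf_cover[OF y(3)]) (simp add: \<tau>)
    also have "\<dots> \<le> (ennreal l * ennreal D) * emeasure \<nu> (\<Union>j\<in>J. B (y j) (s (y j)))"
    proof (rule suminf_le_disjoint[OF y(2)])
      fix j assume j: "j \<in> J"
      note sy = s[OF y(1)[OF j]]
      have 4: "4 * \<kappa> * s (y j) \<le> \<delta>" using sy \<kappa>_ge_1 by (auto simp: field_simps)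
      have "emeasure \<tau> (B (y j) (4 * \<kappa> * s (y j))) \<le> ennreal l * emeasure \<nu> (B (y j) (4 * \<kappa> * s (y j)))"
        using le[OF y(1)[OF j], of "4 * \<kappa> * s (y j)"] sy 4 \<kappa>_ge_1 by auto
      also have "\<dots> \<le> ennreal l * (ennreal D * emeasure \<nu> (B (y j) (s (y j))))"
        using dbl[OF y(1)[OF j], of "s (y j)"] sy k by (intro mult_left_mono) auto
      finally show "emeasure \<tau> (B (y j) (4 * \<kappa> * s (y j))) \<le> ennreal l * ennreal D * emeasure \<nu> (B (y j) (s (y j)))"
        by (simp add: mult.assoc)
    qed (simp add: \<nu>)
    also have "emeasure \<nu> (\<Union>j\<in>J. B (y j) (s (y j))) \<le> emeasure \<nu> U"
      using s y(1) quasi_open_sets[OF U(1)] \<nu> by (intro emeasure_mono) blast+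
    also have "emeasure \<nu> U = emeasure \<nu> A + emeasure \<nu> (U - A)"
      using U A \<nu> quasi_open_sets[OF U(1)] by (subst plus_emeasure) (auto simp: Un_absorb1)
    also have "emeasure \<nu> (U - A) \<le> ennreal e" using U(3) by (simp add: emeasure_eq_measure ennreal_leI less_imp_le)
    finally show ?thesis by (simp add: mult_left_mono)
  qed
  note main = this
  show ?thesis
  proof (rule ennreal_le_epsilon)
    fix e :: real assume e: "0 < e"
    \<comment> \<open>\<open>l\<close> and \<open>D\<close> may be negative, in which case
      \<open>ennreal\<close> truncates them to 0. The divisor \<open>c + 1\<close> below avoids a
      division by 0.\<close>
    define c where "c = max l 0 * max D 0"
    have c: "ennreal l * ennreal D = ennreal c" "0 \<le> c"
      by (simp_all add: c_def ennreal_mult max_def ennreal_neg)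
    have "emeasure \<tau> A \<le> ennreal c * (emeasure \<nu> A + ennreal (e / (c + 1)))"
      using main[of "e / (c+1)"] e c by simp
    also have "\<dots> = ennreal c * emeasure \<nu> A + ennreal (c * (e / (c+1)))"
      using c e by (subst ennreal_mult) (auto simp: distrib_left)
    also have "\<dots> \<le> ennreal c * emeasure \<nu> A + ennreal e"
      using c e by (intro add_left_mono ennreal_leI) (simp add: field_simps)
    finally show "emeasure \<tau> A \<le> ennreal l * ennreal D * emeasure \<nu> A + ennreal e" by (simp add: c)
  qed
qed

end

section \<open>Muckenhoupt weights\<close>

lemma ennpowr_pos: "0 < u \<Longrightarrow> 0 < ennpowr u p"
  by (cases u) (auto simp: ennpowr_def enn2real_positive_iff top.not_eq_extremum)

text \<open>Integrated with \<open>c\<close> the mean of \<open>g\<close>, this is Jensen's inequality up to a factor 2.\<close>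

lemma powr_interpolate:
  fixes g c \<theta> :: real
  assumes "0 < g" "0 < c" "0 \<le> \<theta>" "\<theta> \<le> 1"
  shows "g powr \<theta> \<le> c powr \<theta> + c powr (\<theta> - 1) * g"
proof (cases "g \<le> c")
  case True
  then have "g powr \<theta> \<le> c powr \<theta>" using assms by (intro powr_mono2) auto
  moreover have "0 \<le> c powr (\<theta> - 1) * g" using assms by simp
  ultimately show ?thesis by simp
next
  case False
  have "g powr \<theta> = g powr (\<theta> - 1) * g" using assms by (simp add: powr_diff)
  also have "\<dots> \<le> c powr (\<theta> - 1) * g"
    using False assms by (intro mult_right_mono powr_mono2') auto
  also have "\<dots> \<le> c powr \<theta> + c powr (\<theta> - 1) * g" by simp
  finally show ?thesis .
qed

locale weight_family = quasi_metric_measure +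
  fixes \<phi> :: "'a \<Rightarrow> real \<Rightarrow> real"
  assumes \<phi>_meas: "0 \<le> t \<Longrightarrow> (\<lambda>x. \<phi> x t) \<in> borel_measurable \<mu>"
    and \<phi>_pos: "0 < t \<Longrightarrow> 0 < \<phi> x t"
begin

definition \<nu> :: "real \<Rightarrow> 'a measure" where "\<nu> t = density \<mu> (\<lambda>y. ennreal (\<phi> y t))"

definition W :: "real \<Rightarrow> 'a \<Rightarrow> real \<Rightarrow> real" where "W t x r = measure (\<nu> t) (B x r)"

definition Wpow :: "real \<Rightarrow> real \<Rightarrow> 'a \<Rightarrow> real \<Rightarrow> ennreal" where
  "Wpow e t x r = (\<integral>\<^sup>+y\<in>B x r. ennreal (\<phi> y t powr e) \<partial>\<mu>)"

text \<open>Finiteness is recorded separately because \<open>measure\<close> and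
  \<open>enn2real\<close> send infinite values to 0, which would make the product inequality
  vacuous.\<close>

definition muckenhoupt_bound :: "real \<Rightarrow> real \<Rightarrow> bool" where
  "muckenhoupt_bound q C \<longleftrightarrow> (\<forall>t>0. \<forall>x. \<forall>r>0.
     emeasure (\<nu> t) (B x r) < \<infinity> \<and> Wpow (- 1 / (q - 1)) t x r < \<infinity> \<and>
     W t x r * enn2real (Wpow (- 1 / (q - 1)) t x r) powr (q - 1) \<le> C * V x r powr q)"

lemma sets_\<nu> [simp, measurable_cong]: "sets (\<nu> t) = sets \<mu>"
  by (simp add: \<nu>_def)

lemma emeasure_\<nu>: "0 < t \<Longrightarrow> A \<in> sets \<mu> \<Longrightarrow> emeasure (\<nu> t) A = (\<integral>\<^sup>+y\<in>A. ennreal (\<phi> y t) \<partial>\<mu>)"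
  using \<phi>_meas[of t] by (simp add: \<nu>_def emeasure_density)

lemma null_sets_\<nu>: "0 < t \<Longrightarrow> A \<in> sets \<mu> \<Longrightarrow> emeasure (\<nu> t) A = 0 \<Longrightarrow> emeasure \<mu> A = 0"
proof -
  assume t: "0 < t" "A \<in> sets \<mu>" "emeasure (\<nu> t) A = 0"
  have [measurable]: "(\<lambda>y. \<phi> y t) \<in> borel_measurable \<mu>" using t by (intro \<phi>_meas) auto
  have "A \<in> null_sets (\<nu> t)" using t by (auto simp: null_sets_def)
  then have "AE x in \<mu>. x \<in> A \<longrightarrow> \<phi> x t \<le> 0"
    using t unfolding \<nu>_def by (subst (asm) null_sets_density_iff) (auto simp: ennreal_eq_0_iff)
  then have "AE x in \<mu>. x \<notin> A" using \<phi>_pos[OF t(1)] by (auto elim!: eventually_mono simp: not_le[symmetric])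
  then show ?thesis using t(2) AE_iff_null_sets[of A \<mu>] by auto
qed

lemma emeasure_\<nu>_pos: "0 < t \<Longrightarrow> 0 < r \<Longrightarrow> 0 < emeasure (\<nu> t) (B x r)"
  using null_sets_\<nu>[of t "B x r"] ball_pos[of r x] by (auto simp: zero_less_iff_neq_zero)

lemma Wpow_pos:
  assumes t: "0 < t" and r: "0 < r"
  shows "0 < Wpow e t x r"
proof (rule ccontr)
  have [measurable]: "(\<lambda>y. \<phi> y t) \<in> borel_measurable \<mu>" using t by (intro \<phi>_meas) auto
  assume "\<not> ?thesis"
  then have "AE y in \<mu>. ennreal (\<phi> y t powr e) * indicator (B x r) y = 0"
    unfolding Wpow_def by (subst (asm) not_gr_zero, subst (asm) nn_integral_0_iff_AE) auto
  then have "AE y in \<mu>. y \<notin> B x r"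
    using less_imp_neq[OF \<phi>_pos[OF t]] by (auto elim!: eventually_mono split: split_indicator_asm)
  then have "B x r \<in> null_sets \<mu>" using AE_iff_null_sets[of "B x r" \<mu>] by simp
  then show False using ball_pos[OF r, of x] by auto
qed

text \<open>Neither factor of the Muckenhoupt product can vanish, since \<open>\<phi>\<close> is
  positive and balls have positive measure. A finite product therefore makes both factors
  finite.\<close>

lemma muckenhoupt_boundI:
  assumes q: "1 < q" and A: "muckenhoupt d \<mu> q \<phi>"
  shows "\<exists>C. muckenhoupt_bound q C"
proof -
  define S where "S = (SUP t\<in>{0<..}. SUP x. SUP r\<in>{0<..}.
           ball_avg d \<mu> x r (\<lambda>y. ennreal (\<phi> y t)) *
           ennpowr (ball_avg d \<mu> x r (\<lambda>y. ennreal (\<phi> y t powr (- 1 / (q - 1))))) (q - 1))"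
  have "S < \<infinity>" using assms by (simp add: muckenhoupt_def S_def)
  then obtain s where s: "S = ennreal s" "0 \<le> s" by (cases S) auto
  have "emeasure (\<nu> t) (B x r) < \<infinity> \<and> Wpow (- 1 / (q - 1)) t x r < \<infinity> \<and>
     W t x r * enn2real (Wpow (- 1 / (q - 1)) t x r) powr (q - 1) \<le> s * V x r powr q"
    if t: "0 < t" and r: "0 < r" for t x r
  proof -
    define I where "I = emeasure (\<nu> t) (B x r)"
    define J where "J = Wpow (- 1 / (q - 1)) t x r"
    define v where "v = V x r"
    have v0: "0 < v" using V_pos[OF r] by (simp add: v_def)
    have I0: "0 < I" and J0: "0 < J"
      unfolding I_def J_def using t r by (auto intro: emeasure_\<nu>_pos Wpow_pos)
    have le: "I / ennreal v * ennpowr (J / ennreal v) (q - 1) \<le> ennreal s"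
      unfolding s(1)[symmetric] S_def I_def J_def v_def emeasure_B[OF r, symmetric] emeasure_\<nu>[OF t ball_sets']
        Wpow_def ball_avg_def
      using t r by (intro SUP_upper2[of t] SUP_upper2[of x] SUP_upper2[of r]) auto
    have Jv: "0 < J / ennreal v"
      using J0 by (auto simp: zero_less_iff_neq_zero ennreal_divide_eq_0_iff)
    have If: "I < \<infinity>"
    proof (rule ccontr)
      assume "\<not> I < \<infinity>"
      then have "I / ennreal v * ennpowr (J / ennreal v) (q - 1) = \<infinity>"
        using ennpowr_pos[OF Jv, of "q - 1"] v0
        by (simp add: ennreal_top_divide ennreal_top_mult less_top[symmetric])
      then show False using le by (simp add: top_unique)
    qed
    have Jf: "J < \<infinity>"
    proof (rule ccontr)
      assume "\<not> J < \<infinity>"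
      then have "J / ennreal v = \<infinity>" using v0 by (simp add: ennreal_top_divide less_top[symmetric])
      then have "I / ennreal v * ennpowr (J / ennreal v) (q - 1) = \<infinity>"
        using I0 by (simp add: ennpowr_def ennreal_mult_top)
      then show False using le by (simp add: top_unique)
    qed
    obtain a where a: "I = ennreal a" "0 \<le> a" using If by (cases I) auto
    obtain b where b: "J = ennreal b" "0 \<le> b" using Jf by (cases J) auto
    have "ennreal (a / v * (b / v) powr (q - 1)) \<le> ennreal s"
      using le v0 a b by (simp add: ennpowr_def divide_ennreal flip: ennreal_mult)
    then have "a / v * (b / v) powr (q - 1) \<le> s" using s(2) by (simp add: ennreal_le_iff)
    moreover have "a / v * (b / v) powr (q - 1) = a * b powr (q - 1) / v powr q"
      using v0 b by (simp add: powr_divide powr_diff)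
    ultimately have "a * b powr (q - 1) / v powr q \<le> s" by (simp only:)
    then have "enn2real I * enn2real J powr (q - 1) \<le> s * v powr q"
      using v0 a b by (simp add: pos_divide_le_eq)
    then show ?thesis using If Jf unfolding I_def J_def v_def W_def measure_def by blast
  qed
  then show ?thesis unfolding muckenhoupt_bound_def by blast
qed

text \<open>The exponent \<open>- 1 / (q - 1)\<close> is \<open>\<theta> < 1\<close> times
  \<open>- 1 / (q0 - 1)\<close>, so Jensen's inequality passes from one mean to the other. Its crude
  form \<open>powr_interpolate\<close> costs only a constant.\<close>

lemma muckenhoupt_bound_mono:
  assumes q0: "1 < q0" "q0 < q" and C: "muckenhoupt_bound q0 C"
  shows "muckenhoupt_bound q (2 powr (q - 1) * C)"
  unfolding muckenhoupt_bound_def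
proof (intro allI impI)
  fix t r :: real and x :: 'a assume t: "0 < t" and r: "0 < r"
  have [measurable]: "(\<lambda>y. \<phi> y t) \<in> borel_measurable \<mu>" using t by (intro \<phi>_meas) auto
  define J where "J = Wpow (- 1 / (q0 - 1)) t x r"
  define J' where "J' = Wpow (- 1 / (q - 1)) t x r"
  have fin: "emeasure (\<nu> t) (B x r) < \<infinity>" "J < \<infinity>"
    and le: "W t x r * enn2real J powr (q0 - 1) \<le> C * V x r powr q0"
    using C t r by (auto simp: muckenhoupt_bound_def J_def)
  define v where "v = V x r"
  have v: "emeasure \<mu> (B x r) = ennreal v" and v0: "0 < v"
    using emeasure_B[OF r] V_pos[OF r] by (auto simp: v_def)
  define j where "j = enn2real J"
  have Jj: "J = ennreal j" "0 < j"
    using fin Wpow_pos[OF t r] by (auto simp: j_def J_def enn2real_positive_iff less_top[symmetric])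
  define \<theta> where "\<theta> = (q0 - 1) / (q - 1)"
  have \<theta>: "0 \<le> \<theta>" "\<theta> \<le> 1" using q0 by (auto simp: \<theta>_def)
  \<comment> \<open>The mean of \<open>\<phi>\<close> to the power \<open>- 1 / (q0 - 1)\<close>;
    with it both terms of the interpolation integrate to \<open>c powr \<theta> * v\<close>.\<close>
  define c where "c = j / v"
  have c: "0 < c" using Jj v0 by (simp add: c_def)
  have "J' \<le> (\<integral>\<^sup>+y. ennreal (c powr \<theta>) * indicator (B x r) y +
      ennreal (c powr (\<theta> - 1)) * (ennreal (\<phi> y t powr (- 1 / (q0 - 1))) * indicator (B x r) y) \<partial>\<mu>)"
    unfolding J'_def Wpow_def
  proof (intro nn_integral_mono)
    fix y
    have "\<phi> y t powr (- 1 / (q - 1)) = (\<phi> y t powr (- 1 / (q0 - 1))) powr \<theta>"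
      using q0 by (simp add: powr_powr \<theta>_def field_simps)
    also have "\<dots> \<le> c powr \<theta> + c powr (\<theta> - 1) * \<phi> y t powr (- 1 / (q0 - 1))"
      using c \<theta> \<phi>_pos[OF t, of y] by (intro powr_interpolate) auto
    finally have "ennreal (\<phi> y t powr (- 1 / (q - 1))) \<le>
        ennreal (c powr \<theta>) + ennreal (c powr (\<theta> - 1)) * ennreal (\<phi> y t powr (- 1 / (q0 - 1)))"
      by (simp add: ennreal_leI flip: ennreal_mult ennreal_plus)
    then show "ennreal (\<phi> y t powr (- 1 / (q - 1))) * indicator (B x r) y \<le> ennreal (c powr \<theta>) * indicator (B x r) y +
      ennreal (c powr (\<theta> - 1)) * (ennreal (\<phi> y t powr (- 1 / (q0 - 1))) * indicator (B x r) y)"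
      by (auto split: split_indicator)
  qed
  also have "\<dots> = ennreal (c powr \<theta>) * ennreal v + ennreal (c powr (\<theta> - 1)) * J"
    unfolding J_def Wpow_def by (simp add: nn_integral_add nn_integral_cmult nn_integral_cmult_indicator v)
  also have "\<dots> = ennreal (c powr \<theta> * v + c powr (\<theta> - 1) * j)"
    using v0 Jj by (simp add: ennreal_mult ennreal_plus)
  also have "c powr \<theta> * v + c powr (\<theta> - 1) * j = 2 * c powr \<theta> * v"
    using c v0 Jj by (simp add: powr_diff c_def)
  finally have J'le: "J' \<le> ennreal (2 * c powr \<theta> * v)" .
  then have J'f: "J' < \<infinity>" by (metis ennreal_less_top infinity_ennreal_def order_le_less_trans)
  have "enn2real J' \<le> 2 * c powr \<theta> * v" using J'le v0 by (intro enn2real_leI) auto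
  then have "enn2real J' powr (q - 1) \<le> (2 * c powr \<theta> * v) powr (q - 1)" using q0 by (intro powr_mono2) auto
  also have "\<dots> = 2 powr (q - 1) * (j powr (q0 - 1) / v powr (q0 - 1)) * v powr (q - 1)"
    using c v0 q0 Jj by (simp add: powr_mult powr_powr \<theta>_def c_def powr_divide)
  finally have "W t x r * enn2real J' powr (q - 1) \<le>
      W t x r * (2 powr (q - 1) * (j powr (q0 - 1) / v powr (q0 - 1)) * v powr (q - 1))"
    by (intro mult_left_mono) (auto simp: W_def)
  also have "\<dots> = 2 powr (q - 1) * (W t x r * j powr (q0 - 1)) * (v powr (q - 1) / v powr (q0 - 1))" by simp
  also have "\<dots> \<le> 2 powr (q - 1) * (C * v powr q0) * (v powr (q - 1) / v powr (q0 - 1))"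
    using le v0 by (intro mult_right_mono mult_left_mono) (auto simp: j_def v_def)
  also have "\<dots> = 2 powr (q - 1) * C * v powr q" using v0 by (simp add: powr_diff)
  finally show "emeasure (\<nu> t) (B x r) < \<infinity> \<and> Wpow (- 1 / (q - 1)) t x r < \<infinity> \<and>
     W t x r * enn2real (Wpow (- 1 / (q - 1)) t x r) powr (q - 1) \<le> 2 powr (q - 1) * C * V x r powr q"
    using fin J'f by (simp add: J'_def v_def)
qed

text \<open>On a ball \<open>1 / \<phi>\<close> is almost everywhere below its essential supremum,
  hence so is its power mean with exponent \<open>1 / (q - 1)\<close>.\<close>

lemma muckenhoupt_1_imp:
  assumes q: "1 < q" and A: "muckenhoupt d \<mu> 1 \<phi>"
  shows "muckenhoupt d \<mu> q \<phi>"
proof -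
  have le: "ennpowr (ball_avg d \<mu> x r (\<lambda>y. ennreal (\<phi> y t powr (- 1 / (q - 1))))) (q - 1)
      \<le> ball_esssup d \<mu> x r (\<lambda>y. ennreal (inverse (\<phi> y t)))" (is "ennpowr ?avg _ \<le> ?e")
    if t: "0 < t" and r: "0 < r" for t x r
  proof (cases ?e)
    case (real b)
    have [measurable]: "(\<lambda>y. \<phi> y t) \<in> borel_measurable \<mu>" using t by (intro \<phi>_meas) auto
    have "AE y in restrict_space \<mu> (B x r). ennreal (inverse (\<phi> y t)) \<le> ennreal b"
      unfolding real(2)[symmetric] ball_esssup_def by (rule esssup_AE)
    then have "AE y in \<mu>. y \<in> B x r \<longrightarrow> ennreal (inverse (\<phi> y t)) \<le> ennreal b"
      by (subst (asm) AE_restrict_space_iff) (auto simp: space_\<mu>)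
    then have "Wpow (- 1 / (q - 1)) t x r \<le> (\<integral>\<^sup>+y. ennreal (b powr (1 / (q - 1))) * indicator (B x r) y \<partial>\<mu>)"
      unfolding Wpow_def
    proof (intro nn_integral_mono_AE, eventually_elim)
      case (elim y)
      have "\<phi> y t powr (- 1 / (q - 1)) \<le> b powr (1 / (q - 1))" if "y \<in> B x r"
      proof -
        have "inverse (\<phi> y t) powr (1 / (q - 1)) \<le> b powr (1 / (q - 1))"
          using elim that real q \<phi>_pos[OF t, of y] by (intro powr_mono2) (auto simp: ennreal_le_iff)
        then show ?thesis by (simp add: inverse_powr powr_minus)
      qed
      then show ?case by (auto simp: ennreal_leI split: split_indicator)
    qed
    also have "\<dots> = ennreal (b powr (1 / (q - 1))) * emeasure \<mu> (B x r)"
      by (simp add: nn_integral_cmult_indicator)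
    finally have "?avg \<le> ennreal (b powr (1 / (q - 1)))"
      using ball_pos[OF r, of x] ball_finite[OF r, of x]
      by (simp add: ball_avg_def Wpow_def divide_le_posI_ennreal mult.commute)
    then obtain c where c: "?avg = ennreal c" "0 \<le> c" "c \<le> b powr (1 / (q - 1))"
      by (cases ?avg) (auto simp: top_unique ennreal_le_iff)
    then have "c powr (q - 1) \<le> (b powr (1 / (q - 1))) powr (q - 1)" using q by (intro powr_mono2) auto
    then show ?thesis using c q real by (simp add: ennpowr_def powr_powr ennreal_leI)
  qed simp
  have "(SUP t\<in>{0<..}. SUP x. SUP r\<in>{0<..}. ball_avg d \<mu> x r (\<lambda>y. ennreal (\<phi> y t)) *
      ennpowr (ball_avg d \<mu> x r (\<lambda>y. ennreal (\<phi> y t powr (- 1 / (q - 1))))) (q - 1)) \<le>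
    (SUP t\<in>{0<..}. SUP x. SUP r\<in>{0<..}. ball_avg d \<mu> x r (\<lambda>y. ennreal (\<phi> y t)) *
      ball_esssup d \<mu> x r (\<lambda>y. ennreal (inverse (\<phi> y t))))"
    by (intro SUP_mono' SUP_subset_mono order_refl mult_left_mono le) auto
  then show ?thesis using A q by (auto simp: muckenhoupt_def intro: le_less_trans)
qed

text \<open>Every exponent beyond the infimum lies above an admissible one. The value 1 is treated
  apart because its condition has an essential supremum in place of a mean.\<close>

lemma muckenhoupt_bound_above_index:
  assumes q: "index_p d \<mu> \<phi> < q" and inf: "muckenhoupt_infinity d \<mu> \<phi>"
  obtains C where "1 \<le> C" "muckenhoupt_bound q C"
proof -
  have "{p. 1 \<le> p \<and> muckenhoupt d \<mu> p \<phi>} \<noteq> {}" using inf by (auto simp: muckenhoupt_infinity_def)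
  then obtain q0 where q0: "1 \<le> q0" "muckenhoupt d \<mu> q0 \<phi>" "q0 < q"
    using cInf_lessD[of "{p. 1 \<le> p \<and> muckenhoupt d \<mu> p \<phi>}" q] q by (auto simp: index_p_def)
  have "\<exists>C. muckenhoupt_bound q C"
  proof (cases "q0 = 1")
    case True then show ?thesis using q0 muckenhoupt_boundI[OF _ muckenhoupt_1_imp, of q] by simp
  next
    case False
    then show ?thesis using q0 muckenhoupt_boundI[of q0] muckenhoupt_bound_mono[of q0 q] by force
  qed
  then obtain C where C: "muckenhoupt_bound q C" by blast
  have "C * V x r powr q \<le> max 1 C * V x r powr q" for x r by (intro mult_right_mono) auto
  then have "muckenhoupt_bound q (max 1 C)"
    using C unfolding muckenhoupt_bound_def by (meson order_trans)
  then show ?thesis using that[of "max 1 C"] by simp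
qed

text \<open>Hoelder's inequality for the factors \<open>\<phi> powr (1 / q)\<close> and
  \<open>\<phi> powr (- 1 / q)\<close> on \<open>E\<close>. With a smaller ball for \<open>E\<close>
  it yields doubling of the weight; with a union of selected balls it turns small weight into small
  measure.\<close>

lemma muckenhoupt_set_bound:
  assumes q: "1 < q" and C: "muckenhoupt_bound q C"
    and t: "0 < t" and r: "0 < r" and E: "E \<in> sets \<mu>" "E \<subseteq> B x r"
  shows "measure \<mu> E powr q * W t x r \<le> 2 powr q * C * V x r powr q * measure (\<nu> t) E"
proof -
  have [measurable]: "(\<lambda>y. \<phi> y t) \<in> borel_measurable \<mu>" using t by (intro \<phi>_meas) auto
  have [measurable]: "E \<in> sets \<mu>" by fact
  define J where "J = Wpow (- 1 / (q - 1)) t x r"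
  have fin: "emeasure (\<nu> t) (B x r) < \<infinity>" "J < \<infinity>" and
    le: "W t x r * enn2real J powr (q - 1) \<le> C * V x r powr q"
    using C t r by (auto simp: muckenhoupt_bound_def J_def)
  define j where "j = enn2real J"
  have Jj: "J = ennreal j" "0 < j"
    using fin Wpow_pos[OF t r] by (auto simp: j_def J_def enn2real_positive_iff less_top[symmetric])
  define b where "b = measure (\<nu> t) E"
  have "emeasure (\<nu> t) E < \<infinity>"
    using fin(1) E emeasure_mono[of E "B x r" "\<nu> t"] by (auto intro: le_less_trans)
  then have b: "emeasure (\<nu> t) E = ennreal b"
    by (simp add: b_def emeasure_eq_ennreal_measure less_top[symmetric])
  show ?thesis
  proof (cases "b = 0")
    case True
    then have "measure \<mu> E = 0" using b null_sets_\<nu>[OF t E(1)] by (simp add: measure_def)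
    then show ?thesis using True q by (simp add: b_def)
  next
    case False
    then have b0: "0 < b" by (simp add: b_def less_le)
    text \<open>Hoelder's inequality up to a factor 2: this \<open>c\<close> balances the two terms of \<open>pt\<close> after
      integration.\<close>
    define c where "c = (j / b) powr ((q - 1) / q)"
    have c: "0 < c" using Jj b0 by (simp add: c_def)
    have pt: "1 \<le> c * s + c powr (- 1 / (q - 1)) * s powr (- 1 / (q - 1))" if s: "0 < s" for s
    proof (cases "1 \<le> c * s")
      case False
      have "1 powr (- 1 / (q - 1)) \<le> (c * s) powr (- 1 / (q - 1))"
        using False c s q by (intro powr_mono2') auto
      then show ?thesis using c s by (simp add: powr_mult add_increasing)
    qed (simp add: add_increasing2)
    have "emeasure \<mu> E = (\<integral>\<^sup>+y. 1 * indicator E y \<partial>\<mu>)" by simp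
    also have "\<dots> \<le> (\<integral>\<^sup>+y. ennreal c * (ennreal (\<phi> y t) * indicator E y) + ennreal (c powr (- 1 / (q - 1))) *
        (ennreal (\<phi> y t powr (- 1 / (q - 1))) * indicator (B x r) y) \<partial>\<mu>)"
    proof (intro nn_integral_mono)
      fix y
      have "1 \<le> ennreal (c * \<phi> y t + c powr (- 1 / (q - 1)) * \<phi> y t powr (- 1 / (q - 1)))"
        using pt[OF \<phi>_pos[OF t]] by (simp add: ennreal_ge_1)
      also have "\<dots> = ennreal c * ennreal (\<phi> y t) + ennreal (c powr (- 1 / (q - 1))) * ennreal (\<phi> y t powr (- 1 / (q - 1)))"
        using c \<phi>_pos[OF t, of y] by (simp add: ennreal_mult ennreal_plus)
      finally show "1 * indicator E y \<le> ennreal c * (ennreal (\<phi> y t) * indicator E y) + ennreal (c powr (- 1 / (q - 1))) *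
        (ennreal (\<phi> y t powr (- 1 / (q - 1))) * indicator (B x r) y)"
        using E(2) by (auto split: split_indicator)
    qed
    also have "\<dots> = ennreal c * emeasure (\<nu> t) E + ennreal (c powr (- 1 / (q - 1))) * J"
      unfolding J_def Wpow_def emeasure_\<nu>[OF t E(1)] by (simp add: nn_integral_add nn_integral_cmult)
    also have "\<dots> = ennreal (c * b + c powr (- 1 / (q - 1)) * j)"
      using c b0 Jj by (simp add: b ennreal_mult ennreal_plus)
    finally have "measure \<mu> E \<le> c * b + c powr (- 1 / (q - 1)) * j"
      using c b0 Jj by (simp add: measure_def enn2real_leI)
    also have "c * b = j powr (1 - 1 / q) * b powr (1 / q)"
    proof -
      have "(q - 1) / q = 1 - 1 / q" using q by (simp add: field_simps)
      then show ?thesis using b0 Jj q by (simp add: c_def powr_divide powr_diff)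
    qed
    also have "c powr (- 1 / (q - 1)) * j = j powr (1 - 1 / q) * b powr (1 / q)"
    proof -
      have "c powr (- 1 / (q - 1)) = (j / b) powr (- (1 / q))" using q by (simp add: c_def powr_powr)
      then have "c powr (- 1 / (q - 1)) * j = (j / b) powr (- (1 / q)) * j" by (simp only:)
      also have "\<dots> = j powr (1 - 1 / q) * b powr (1 / q)"
        using b0 Jj by (simp add: powr_divide powr_diff powr_minus field_simps)
      finally show ?thesis .
    qed
    finally have "measure \<mu> E powr q \<le> (2 * (j powr (1 - 1 / q) * b powr (1 / q))) powr q"
      using q by (intro powr_mono2) (auto simp: mult_ac)
    also have "\<dots> = 2 powr q * (j powr (q - 1) * b)"
      using q b0 Jj by (simp add: powr_mult powr_powr left_diff_distrib)
    finally have "measure \<mu> E powr q * W t x r \<le> 2 powr q * (j powr (q - 1) * b) * W t x r"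
      by (intro mult_right_mono) (auto simp: W_def)
    also have "\<dots> = 2 powr q * b * (W t x r * j powr (q - 1))" by simp
    also have "\<dots> \<le> 2 powr q * b * (C * V x r powr q)"
      using le b0 by (intro mult_left_mono) (auto simp: j_def)
    finally show ?thesis by (simp add: b_def mult_ac)
  qed
qed

text \<open>For the conjugate exponent \<open>p / (p - 1)\<close> the dual power in the Muckenhoupt
  condition is \<open>1 - p\<close>, the power of the weight against which \<open>p\<close>-th
  powers of oscillations are integrated.\<close>

lemma muckenhoupt_dual_bound:
  assumes p: "1 < p" and C: "muckenhoupt_bound (p / (p - 1)) C" "0 \<le> C" and t: "0 < t" and r: "0 < r"
  shows "Wpow (1 - p) t x r \<le> ennreal (C powr (p - 1) * V x r powr p * W t x r powr (1 - p))"
proof -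
  have q1: "p / (p - 1) - 1 = 1 / (p - 1)" using p by (simp add: field_simps)
  have q2: "- 1 / (p / (p - 1) - 1) = 1 - p" using p by (simp add: q1)
  define a where "a = W t x r"
  have fin: "emeasure (\<nu> t) (B x r) < \<infinity>" "Wpow (1 - p) t x r < \<infinity>" and
    le: "a * enn2real (Wpow (1 - p) t x r) powr (1 / (p - 1)) \<le> C * V x r powr (p / (p - 1))"
    using C t r by (auto simp: muckenhoupt_bound_def q2 q1 a_def)
  have a: "0 < a"
    using emeasure_\<nu>_pos[OF t r] fin by (simp add: a_def W_def measure_def enn2real_positive_iff less_top[symmetric])
  define j where "j = enn2real (Wpow (1 - p) t x r)"
  have j: "Wpow (1 - p) t x r = ennreal j" "0 \<le> j" using fin by (auto simp: j_def less_top[symmetric])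
  define v where "v = V x r"
  have "j powr (1 / (p - 1)) \<le> C * v powr (p / (p - 1)) / a"
    using le a by (simp add: j_def v_def field_simps)
  then have "(j powr (1 / (p - 1))) powr (p - 1) \<le> (C * v powr (p / (p - 1)) / a) powr (p - 1)"
    using p by (intro powr_mono2) auto
  also have "\<dots> = C powr (p - 1) * v powr p / a powr (p - 1)"
    using p C(2) a by (simp add: powr_divide powr_mult powr_powr v_def V_def)
  also have "\<dots> = C powr (p - 1) * v powr p * a powr (1 - p)"
    using powr_minus_divide[of a "p - 1"] by simp
  finally show ?thesis using p j by (simp add: powr_powr a_def v_def ennreal_leI)
qed

end

section \<open>Luxemburg norms of balls\<close>

locale musielak = weight_family +
  fixes n q i Cd Ca Cu Cl :: real
  assumes n_pos: "0 < n" and Cd_ge_1: "1 \<le> Cd"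
    and V_doubling: "0 < r \<Longrightarrow> 1 \<le> l \<Longrightarrow> V x (l * r) \<le> Cd * l powr n * V x r"
    and \<phi>_mono: "0 \<le> s \<Longrightarrow> s \<le> t \<Longrightarrow> \<phi> x s \<le> \<phi> x t"
    and \<phi>_0: "\<phi> x 0 = 0"
    and Cu_ge_1: "1 \<le> Cu"
    and upper: "1 \<le> s \<Longrightarrow> 0 \<le> t \<Longrightarrow> \<phi> x (s * t) \<le> Cu * s * \<phi> x t"
    and Cl_ge_1: "1 \<le> Cl" and i_pos: "0 < i" and i_le_1: "i \<le> 1"
    and lower: "0 < s \<Longrightarrow> s < 1 \<Longrightarrow> 0 \<le> t \<Longrightarrow> \<phi> x (s * t) \<le> Cl * s powr i * \<phi> x t"
    and q_ge_1: "1 \<le> q" and Ca_ge_1: "1 \<le> Ca"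
    and \<nu>_finite: "0 < t \<Longrightarrow> 0 < r \<Longrightarrow> emeasure (\<nu> t) (B x r) < \<infinity>"
    and muckenhoupt_set: "0 < t \<Longrightarrow> 0 < r \<Longrightarrow> E \<in> sets \<mu> \<Longrightarrow> E \<subseteq> B x r \<Longrightarrow>
      measure \<mu> E powr q * W t x r \<le> Ca * V x r powr q * measure (\<nu> t) E"
begin

definition L :: "'a \<Rightarrow> real \<Rightarrow> real" where "L x r = lux_norm \<mu> \<phi> (indicator (B x r))"

text \<open>Up to constants, dilation by \<open>l\<close> multiplies weights by at most
  \<open>l powr (n * q)\<close>; through lower type \<open>i\<close> the norms of balls then grow at
  most like \<open>l powr \<theta>\<close>.\<close>

definition \<theta> :: real where "\<theta> = n * q / i"

definition Cw :: real where "Cw = Ca * Cd powr q"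

lemma \<theta>_pos: "0 < \<theta>"
  using n_pos q_ge_1 i_pos by (simp add: \<theta>_def)

lemma nq_le_\<theta>: "n * q \<le> \<theta>"
  using n_pos q_ge_1 i_pos i_le_1 unfolding \<theta>_def
  by (simp add: field_simps mult_left_le)

lemma powr_nq_le: "1 \<le> l \<Longrightarrow> l powr (n * q) \<le> l powr \<theta>"
  by (rule powr_mono[OF nq_le_\<theta>])

lemma powr_\<theta>_ge_1: "1 \<le> l \<Longrightarrow> 1 \<le> l powr \<theta>"
  using \<theta>_pos by (simp add: ge_one_powr_ge_zero)

lemma Cw_ge_1: "1 \<le> Cw"
proof -
  have "1 * 1 \<le> Ca * Cd powr q"
    using Ca_ge_1 Cd_ge_1 q_ge_1 by (intro mult_mono ge_one_powr_ge_zero) auto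
  then show ?thesis by (simp add: Cw_def)
qed

lemma emeasure_\<nu>_B: "0 < t \<Longrightarrow> 0 < r \<Longrightarrow> emeasure (\<nu> t) (B x r) = ennreal (W t x r)"
  using \<nu>_finite[of t r x] by (simp add: W_def emeasure_eq_ennreal_measure less_top[symmetric])

lemma W_pos: "0 < t \<Longrightarrow> 0 < r \<Longrightarrow> 0 < W t x r"
  using null_sets_\<nu>[of t "B x r"] ball_pos[of r x] emeasure_\<nu>_B[of t r x]
  by (metis ball_sets' ennreal_eq_0_iff less_irrefl not_le)

lemma W_mono: "B y s \<subseteq> B x r \<Longrightarrow> 0 < r \<Longrightarrow> 0 < t \<Longrightarrow> W t y s \<le> W t x r"
  unfolding W_def using \<nu>_finite[of t r x]
  by (intro measure_mono_fmeasurable) (auto simp: fmeasurable_def)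

section \<open>Scaling and doubling of the weights\<close>

lemma emeasure_\<nu>_scale:
  assumes "0 \<le> c" "0 \<le> s" "0 \<le> t" and "\<And>x. \<phi> x s \<le> c * \<phi> x t" and "A \<in> sets \<mu>"
  shows "emeasure (\<nu> s) A \<le> ennreal c * emeasure (\<nu> t) A"
proof -
  have [measurable]: "(\<lambda>y. \<phi> y t) \<in> borel_measurable \<mu>" "(\<lambda>y. \<phi> y s) \<in> borel_measurable \<mu>"
    using assms by (auto intro: \<phi>_meas)
  have [measurable]: "A \<in> sets \<mu>" by fact
  have nn: "0 \<le> \<phi> x t" for x using \<phi>_mono[of 0 t x] \<phi>_0 assms by simp
  have "emeasure (\<nu> s) A = (\<integral>\<^sup>+x. ennreal (\<phi> x s) * indicator A x \<partial>\<mu>)"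
    unfolding \<nu>_def by (subst emeasure_density) auto
  also have "\<dots> \<le> (\<integral>\<^sup>+x. ennreal c * (ennreal (\<phi> x t) * indicator A x) \<partial>\<mu>)"
    using assms nn by (intro nn_integral_mono)
      (auto simp: mult.assoc[symmetric] ennreal_mult[symmetric] ennreal_leI split: split_indicator)
  also have "\<dots> = ennreal c * emeasure (\<nu> t) A"
    unfolding \<nu>_def by (subst nn_integral_cmult) (auto simp: emeasure_density)
  finally show ?thesis .
qed

lemma W_scale:
  assumes "0 \<le> c" "0 < s" "0 < t" "0 < r" and "\<And>x. \<phi> x s \<le> c * \<phi> x t"
  shows "W s x r \<le> c * W t x r"
proof -
  have "ennreal (W s x r) \<le> ennreal (c * W t x r)"
    using emeasure_\<nu>_scale[of c s t "B x r"] assms W_pos[of t r x]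
    by (simp add: emeasure_\<nu>_B ennreal_mult)
  then show ?thesis using W_pos[of t r x] assms by (subst (asm) ennreal_le_iff) auto
qed

lemma W_mono_t: "0 < s \<Longrightarrow> s \<le> t \<Longrightarrow> 0 < r \<Longrightarrow> W s x r \<le> W t x r"
  using W_scale[of 1 s t r x] \<phi>_mono[of s t] by simp

lemma W_upper: "1 \<le> s \<Longrightarrow> 0 < t \<Longrightarrow> 0 < r \<Longrightarrow> W (s * t) x r \<le> Cu * s * W t x r"
  using W_scale[of "Cu * s" "s * t" t r x] upper[of s t] Cu_ge_1 by simp

lemma W_lower: "0 < s \<Longrightarrow> s < 1 \<Longrightarrow> 0 < t \<Longrightarrow> 0 < r \<Longrightarrow> W (s * t) x r \<le> Cl * s powr i * W t x r"
  using W_scale[of "Cl * s powr i" "s * t" t r x] lower[of s t] Cl_ge_1 by simp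

lemma W_doubling:
  assumes "0 < t" "0 < r" "1 \<le> l"
  shows "W t x (l * r) \<le> Cw * l powr (n * q) * W t x r"
proof -
  have lr: "0 < l * r" using assms by simp
  have sub: "B x r \<subseteq> B x (l * r)" using assms by (intro B_mono) (simp add: mult_le_cancel_right1)
  have Vp: "0 < V x r" using V_pos assms by blast
  have "V x r powr q * W t x (l * r) \<le> Ca * V x (l * r) powr q * W t x r"
    using muckenhoupt_set[OF assms(1) lr _ sub] by (simp add: V_def W_def)
  also have "\<dots> \<le> Ca * (Cd * l powr n * V x r) powr q * W t x r"
    using V_doubling[of r l x] assms V_pos[OF lr, of x] q_ge_1 Ca_ge_1 W_pos[of t r x]
    by (intro mult_right_mono mult_left_mono powr_mono2) auto
  also have "\<dots> = V x r powr q * (Cw * l powr (n * q) * W t x r)"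
    using Vp assms Cd_ge_1 by (simp add: powr_mult powr_powr Cw_def)
  finally show ?thesis using Vp by (simp add: mult_le_cancel_left_pos)
qed

lemma W_doubling_\<theta>:
  assumes "0 < t" "0 < r" "1 \<le> l"
  shows "W t x (l * r) \<le> Cw * l powr \<theta> * W t x r"
  using W_doubling[OF assms, of x] powr_nq_le[OF assms(3)] Cw_ge_1 W_pos[OF assms(1,2), of x]
  by (smt (verit) mult_left_mono mult_right_mono)

section \<open>Norms of balls, and the weight of a ball at its own scale\<close>

definition luxset :: "'a \<Rightarrow> real \<Rightarrow> real set" where
  "luxset x r = {l. 0 < l \<and> W (1 / l) x r \<le> 1}"

lemma L_eq: "0 < r \<Longrightarrow> L x r = Inf (luxset x r)"
proof -
  assume r: "0 < r"
  have "(\<integral>\<^sup>+y. ennreal (\<phi> y (\<bar>indicator (B x r) y\<bar> / l)) \<partial>\<mu>) = ennreal (W (1 / l) x r)"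
    if l: "0 < l" for l
  proof -
    have [measurable]: "(\<lambda>y. \<phi> y (1 / l)) \<in> borel_measurable \<mu>" using l by (intro \<phi>_meas) auto
    have "(\<integral>\<^sup>+y. ennreal (\<phi> y (\<bar>indicator (B x r) y\<bar> / l)) \<partial>\<mu>) =
        (\<integral>\<^sup>+y. ennreal (\<phi> y (1 / l)) * indicator (B x r) y \<partial>\<mu>)"
      by (intro nn_integral_cong) (auto simp: \<phi>_0 split: split_indicator)
    also have "\<dots> = emeasure (\<nu> (1 / l)) (B x r)"
      unfolding \<nu>_def by (subst emeasure_density) auto
    finally show ?thesis using emeasure_\<nu>_B[of "1 / l" r x] l r by simp
  qed
  then have "{l. 0 < l \<and> (\<integral>\<^sup>+y. ennreal (\<phi> y (\<bar>indicator (B x r) y\<bar> / l)) \<partial>\<mu>) \<le> 1} = luxset x r"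
    by (auto simp: luxset_def ennreal_le_1)
  then show ?thesis by (simp add: L_def lux_norm_def)
qed

lemma luxset_nonempty:
  assumes "0 < r" shows "luxset x r \<noteq> {}"
proof -
  \<comment> \<open>Chosen so that \<open>l powr i\<close> exceeds \<open>Cl * W 1 x r\<close>. The
    summand 2 gives \<open>l > 1\<close>, since lower type needs a factor below 1.\<close>
  define l where "l = (Cl * W 1 x r + 2) powr (1 / i)"
  have W1: "0 < W 1 x r" using W_pos assms by simp
  have b: "2 < Cl * W 1 x r + 2" using W1 Cl_ge_1 by simp
  have "1 powr (1 / i) < l" unfolding l_def using b i_pos by (intro powr_less_mono2) auto
  then have l: "1 < l" by simp
  have li: "l powr i = Cl * W 1 x r + 2" using b i_pos by (simp add: l_def powr_powr)
  have "W (1 / l * 1) x r \<le> Cl * (1 / l) powr i * W 1 x r"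
    using l assms by (intro W_lower) auto
  also have "\<dots> = Cl * W 1 x r / (Cl * W 1 x r + 2)" using l by (simp add: powr_divide li)
  also have "\<dots> \<le> 1" using b by simp
  finally show ?thesis using l by (auto simp: luxset_def intro!: exI[of _ l])
qed

lemma luxset_bdd_below: "bdd_below (luxset x r)"
  by (auto simp: luxset_def intro!: bdd_belowI[of _ 0])

lemma L_pos:
  assumes "0 < r" shows "0 < L x r"
proof -
  have W1: "0 < W 1 x r" using W_pos assms by simp
  \<comment> \<open>For \<open>l < 1\<close>, lower type bounds \<open>W 1 x r\<close> by
    \<open>Cl * l powr i\<close> times \<open>W (1 / l) x r\<close>, and the latter is at most 1 on
    \<open>luxset x r\<close>.\<close>
  define l0 where "l0 = min 1 ((W 1 x r / Cl) powr (1 / i))"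
  have l0: "0 < l0" using W1 Cl_ge_1 by (simp add: l0_def)
  have "l0 \<le> l" if "l \<in> luxset x r" for l
  proof (cases "1 \<le> l")
    case False
    have l: "0 < l" "W (1 / l) x r \<le> 1" using that by (auto simp: luxset_def)
    have "W 1 x r = W (l * (1 / l)) x r" using l by simp
    also have "\<dots> \<le> Cl * l powr i * W (1 / l) x r" using l False assms by (intro W_lower) auto
    also have "\<dots> \<le> Cl * l powr i" using l Cl_ge_1 by (intro mult_left_le) auto
    finally have "W 1 x r / Cl \<le> l powr i" using Cl_ge_1 by (simp add: field_simps)
    then have "(W 1 x r / Cl) powr (1 / i) \<le> (l powr i) powr (1 / i)"
      using W1 Cl_ge_1 i_pos by (intro powr_mono2) auto
    then show ?thesis using l i_pos by (simp add: powr_powr l0_def min_def split: if_splits)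
  qed (simp add: l0_def)
  then have "l0 \<le> Inf (luxset x r)" using luxset_nonempty[OF assms] by (intro cInf_greatest) auto
  then show ?thesis using l0 L_eq[OF assms] by simp
qed

lemma L_le: "0 < r \<Longrightarrow> 0 < l \<Longrightarrow> W (1 / l) x r \<le> 1 \<Longrightarrow> L x r \<le> l"
  unfolding L_eq by (intro cInf_lower luxset_bdd_below) (simp add: luxset_def)

text \<open>As \<open>\<phi>\<close> need not be continuous in \<open>t\<close>, the modular at the
  norm need not be 1. Upper type 1 makes it harmless to step off the infimum by a factor 2, upwards
  here and downwards in the next bound.\<close>

lemma W_L_le:
  assumes "0 < r" shows "W (1 / L x r) x r \<le> 2 * Cu"
proof -
  have "Inf (luxset x r) < 2 * L x r" using L_pos[OF assms] L_eq[OF assms] by simp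
  then obtain l where l: "0 < l" "W (1 / l) x r \<le> 1" "l < 2 * L x r"
    using cInf_lessD[OF luxset_nonempty[OF assms]] by (auto simp: luxset_def)
  have "W (1 / L x r) x r \<le> W (2 * (1 / l)) x r"
    using l assms L_pos[OF assms, of x] by (intro W_mono_t) (auto simp: field_simps)
  also have "\<dots> \<le> Cu * 2 * W (1 / l) x r" using l assms by (intro W_upper) auto
  also have "\<dots> \<le> 2 * Cu" using l Cu_ge_1 by simp
  finally show ?thesis .
qed

lemma W_L_ge:
  assumes "0 < r" shows "1 / (2 * Cu) \<le> W (1 / L x r) x r"
proof -
  have Lp: "0 < L x r" using L_pos assms by blast
  have "\<not> W (1 / (L x r / 2)) x r \<le> 1" using L_le[OF assms, of "L x r / 2" x] Lp by auto
  moreover have "W (2 * (1 / L x r)) x r \<le> Cu * 2 * W (1 / L x r) x r"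
    using assms Lp by (intro W_upper) auto
  ultimately show ?thesis using Cu_ge_1 by (simp add: field_simps)
qed

lemma L_mono:
  assumes "B y s \<subseteq> B x r" "0 < s" "0 < r" shows "L y s \<le> L x r"
  unfolding L_eq[OF assms(2)] L_eq[OF assms(3)]
proof (rule cInf_superset_mono)
  show "luxset x r \<subseteq> luxset y s"
    using W_mono[OF assms(1,3)] by (auto simp: luxset_def) (meson order_trans zero_less_divide_1_iff)
qed (use luxset_nonempty luxset_bdd_below assms in auto)

lemma L_subball:
  assumes sub: "B y s \<subseteq> B x r" and s: "0 < s" and r: "0 < r"
  shows "L y s \<le> 2 * Cu\<^sup>2 * L x r * W (1 / L x r) y s"
proof -
  have Ly: "0 < L y s" and Lx: "0 < L x r" using L_pos s r by auto
  define \<sigma> where "\<sigma> = L x r / L y s"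
  have \<sigma>: "1 \<le> \<sigma>" using L_mono[OF assms] Ly by (simp add: \<sigma>_def)
  have "1 / (2 * Cu) \<le> W (1 / L y s) y s" by (rule W_L_ge[OF s])
  also have "1 / L y s = \<sigma> * (1 / L x r)" using Lx by (simp add: \<sigma>_def)
  also have "W (\<sigma> * (1 / L x r)) y s \<le> Cu * \<sigma> * W (1 / L x r) y s"
    using \<sigma> Lx s by (intro W_upper) auto
  finally have "1 \<le> 2 * Cu\<^sup>2 * (L x r / L y s) * W (1 / L x r) y s"
    using Cu_ge_1 by (simp add: \<sigma>_def field_simps power2_eq_square)
  then show ?thesis using Ly by (simp add: field_simps)
qed

definition CL :: real where "CL = (Cl * Cw * 2 * Cu + 1) powr (1 / i)"

lemma CL_ge_1: "1 \<le> CL"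
  using Cl_ge_1 Cw_ge_1 Cu_ge_1 i_pos unfolding CL_def
  by (intro ge_one_powr_ge_zero) auto

text \<open>The dilated ball costs the factor \<open>Cw * l powr (n * q)\<close> in weight, and
  enlarging the norm by \<open>\<Lambda>\<close> gains \<open>\<Lambda> powr (- i)\<close>.
  \<open>CL\<close> balances the two; the 1 inside it makes \<open>\<Lambda> > 1\<close> strict, as
  lower type requires.\<close>

lemma L_growth:
  assumes r: "0 < r" and l: "1 \<le> l"
  shows "L x (l * r) \<le> CL * l powr \<theta> * L x r"
proof -
  define D where "D = Cl * Cw * 2 * Cu"
  have D: "0 < D" using Cl_ge_1 Cw_ge_1 Cu_ge_1 by (simp add: D_def)
  define \<Lambda> where "\<Lambda> = CL * l powr \<theta>"
  have Lx: "0 < L x r" using L_pos r by blast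
  have "1 powr (1 / i) < CL" unfolding CL_def D_def[symmetric] using D i_pos
    by (intro powr_less_mono2) auto
  then have "1 * 1 < CL * l powr \<theta>" using powr_\<theta>_ge_1[OF l] by (intro mult_less_le_imp_less) auto
  then have \<Lambda>: "1 < \<Lambda>" by (simp add: \<Lambda>_def)
  have \<Lambda>i: "\<Lambda> powr i = (D + 1) * l powr (n * q)"
    using D i_pos l by (simp add: \<Lambda>_def CL_def D_def[symmetric] powr_mult powr_powr \<theta>_def)
  have "W (1 / (\<Lambda> * L x r)) x (l * r) \<le> Cw * l powr (n * q) * W (1 / (\<Lambda> * L x r)) x r"
    using \<Lambda> Lx r l by (intro W_doubling) auto
  also have "1 / (\<Lambda> * L x r) = 1 / \<Lambda> * (1 / L x r)" by simp
  also have "W (1 / \<Lambda> * (1 / L x r)) x r \<le> Cl * (1 / \<Lambda>) powr i * W (1 / L x r) x r"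
    using \<Lambda> Lx r by (intro W_lower) auto
  also have "\<dots> \<le> Cl * (1 / \<Lambda>) powr i * (2 * Cu)"
    using Cl_ge_1 W_L_le[OF r] by (intro mult_left_mono) auto
  also have "\<dots> = Cl * 2 * Cu / ((D + 1) * l powr (n * q))"
    using \<Lambda> by (simp add: powr_divide \<Lambda>i)
  also have "Cw * l powr (n * q) * (Cl * 2 * Cu / ((D + 1) * l powr (n * q))) = D / (D + 1)"
    using l by (simp add: D_def)
  finally have "W (1 / (\<Lambda> * L x r)) x (l * r) \<le> D / (D + 1)"
    using Cw_ge_1 by (simp add: mult_left_mono)
  also have "\<dots> \<le> 1" using D by simp
  finally show ?thesis
    using L_le[of "l * r" "\<Lambda> * L x r" x] \<Lambda> Lx r l by (simp add: \<Lambda>_def)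
qed

text \<open>Balls centred in \<open>B x r\<close> may stick out of it, so they are placed in a
  dilate, while the weight remains that of \<open>B x r\<close>. The dilate has the larger norm,
  hence the smaller weight.\<close>

lemma L_subball_dilated:
  assumes sub: "B y s \<subseteq> B x (l * r)" and s: "0 < s" and r: "0 < r" and l: "1 \<le> l"
  shows "L y s \<le> 2 * Cu\<^sup>2 * CL * l powr \<theta> * L x r * W (1 / L x r) y s"
proof -
  have lr: "0 < l * r" using r l by simp
  have pos: "0 < L x r" "0 < L x (l * r)" using L_pos r lr by auto
  have "B x r \<subseteq> B x (l * r)" using r l by (intro B_mono) (simp add: mult_le_cancel_right1)
  then have LL: "L x r \<le> L x (l * r)" using r lr by (intro L_mono)
  have "L y s \<le> 2 * Cu\<^sup>2 * L x (l * r) * W (1 / L x (l * r)) y s"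
    by (rule L_subball[OF sub s lr])
  also have "\<dots> \<le> 2 * Cu\<^sup>2 * L x (l * r) * W (1 / L x r) y s"
    using pos LL s Cu_ge_1 by (intro mult_left_mono W_mono_t) (auto simp: field_simps)
  also have "\<dots> \<le> 2 * Cu\<^sup>2 * (CL * l powr \<theta> * L x r) * W (1 / L x r) y s"
    using L_growth[OF r l, of x] W_pos[of "1 / L x r" s y] pos s
    by (intro mult_left_mono mult_right_mono) auto
  finally show ?thesis by (simp add: mult.assoc)
qed

text \<open>In the application \<open>u r = f - A\<^bsub>t\<^esub> f\<close> with \<open>t = r powr m\<close>, and \<open>K\<close> bounds the norm of \<open>f\<close> for the
  exponent 1.\<close>

definition osc :: "(real \<Rightarrow> 'a \<Rightarrow> complex) \<Rightarrow> real \<Rightarrow> bool" where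
  "osc u K \<longleftrightarrow> (\<forall>r>0. u r \<in> borel_measurable \<mu>) \<and> 0 < K \<and>
     (\<forall>x. \<forall>r>0. emeasure (density \<mu> (\<lambda>y. ennreal (cmod (u r y)))) (B x r) \<le> ennreal (K * L x r))"

definition \<tau> :: "(real \<Rightarrow> 'a \<Rightarrow> complex) \<Rightarrow> real \<Rightarrow> 'a measure" where
  "\<tau> u r = density \<mu> (\<lambda>y. ennreal (cmod (u r y)))"

lemma sets_\<tau> [simp, measurable_cong]: "sets (\<tau> u r) = sets \<mu>"
  by (simp add: \<tau>_def)

lemma oscD:
  assumes "osc u K"
  shows "0 < r \<Longrightarrow> u r \<in> borel_measurable \<mu>" "0 < K"
    "0 < r \<Longrightarrow> emeasure (\<tau> u r) (B x r) \<le> ennreal (K * L x r)"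
  using assms by (auto simp: osc_def \<tau>_def)

text \<open>This constant, like all the later ones, must not depend on \<open>u\<close> and \<open>K\<close>, and is therefore spelled
  out.\<close>

definition Cst :: real where
  "Cst = 2 * Cu\<^sup>2 * CL * (2 * \<kappa>) powr \<theta> * Cw * (4 * \<kappa>) powr \<theta> * (Cw * (2 * \<kappa>) powr \<theta> * (2 * Cu))"

text \<open>\<open>osc\<close> bounds \<open>u r\<close> only on balls of radius \<open>r\<close>.
  Covering a larger ball by these loses no factor depending on \<open>R / r\<close>: each norm is
  bounded by a multiple of the weight of a smaller ball, and the weights of these disjoint balls add
  up.\<close>

lemma osc_small_scale:
  assumes u: "osc u K" and r: "0 < r" and rR: "r \<le> R"
  shows "emeasure (\<tau> u r) (B x R) \<le> ennreal (Cst * K * L x R)"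
proof -
  have R: "0 < R" using r rR by simp
  have k: "1 \<le> 2 * \<kappa>" "1 \<le> 4 * \<kappa>" "0 < 2 * \<kappa> * R" using \<kappa>_ge_1 R by auto
  \<comment> \<open>The enlarged Vitali balls then have radius exactly \<open>r\<close>, the one
    \<open>osc\<close> speaks of.\<close>
  define s where "s = r / (4 * \<kappa>)"
  have s: "0 < s" "4 * \<kappa> * s = r" "s \<le> r" using r \<kappa>_ge_1 by (auto simp: s_def field_simps)
  define w where "w = 1 / L x R"
  have w: "0 < w" using L_pos[OF R] by (simp add: w_def)
  have K: "0 < K" using oscD(2)[OF u] .
  have sub: "B y r \<subseteq> B x (2 * \<kappa> * R)" "B y s \<subseteq> B x (2 * \<kappa> * R)" if "y \<in> B x R" for y
  proof -
    show "B y r \<subseteq> B x (2 * \<kappa> * R)"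
      using that rR \<kappa>_ge_1 by (intro ball_subset[of _ _ R]) (auto simp: algebra_simps)
    then show "B y s \<subseteq> B x (2 * \<kappa> * R)" using s(3) B_mono[of s r y] by auto
  qed
  obtain y :: "nat \<Rightarrow> 'a" and J where y: "\<And>j. j \<in> J \<Longrightarrow> y j \<in> B x R"
    "disjoint_family_on (\<lambda>j. B (y j) s) J" "B x R \<subseteq> (\<Union>j\<in>J. B (y j) (4 * \<kappa> * s))"
    by (rule vitali[of "B x R" "\<lambda>_. s" s "B x (2 * \<kappa> * R)"]) (use s sub k ball_finite in auto)
  define c where "c = K * (2 * Cu\<^sup>2 * CL * (2 * \<kappa>) powr \<theta> * L x R * (Cw * (4 * \<kappa>) powr \<theta>))"
  have c: "0 \<le> c" using K Cu_ge_1 CL_ge_1 L_pos[OF R, of x] Cw_ge_1 by (auto simp: c_def)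
  have "emeasure (\<tau> u r) (B x R) \<le> (\<Sum>j. indicator J j * emeasure (\<tau> u r) (B (y j) (4 * \<kappa> * s)))"
    by (rule emeasure_suminf_cover[OF y(3)]) simp
  also have "\<dots> \<le> ennreal c * emeasure (\<nu> w) (\<Union>j\<in>J. B (y j) s)"
  proof (rule suminf_le_disjoint[OF y(2)])
    fix j assume j: "j \<in> J"
    have "emeasure (\<tau> u r) (B (y j) (4 * \<kappa> * s)) \<le> ennreal (K * L (y j) r)"
      using oscD(3)[OF u r] s by simp
    also have "\<dots> \<le> ennreal (c * W w (y j) s)"
    proof (rule ennreal_leI)
      have "K * L (y j) r \<le> K * (2 * Cu\<^sup>2 * CL * (2 * \<kappa>) powr \<theta> * L x R * W w (y j) r)"
        using L_subball_dilated[of "y j" r x "2 * \<kappa>" R] sub[OF y(1)[OF j]] r R k K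
        by (intro mult_left_mono) (auto simp: w_def)
      also have "\<dots> \<le> K * (2 * Cu\<^sup>2 * CL * (2 * \<kappa>) powr \<theta> * L x R * (Cw * (4 * \<kappa>) powr \<theta> * W w (y j) s))"
        using W_doubling_\<theta>[of w s "4 * \<kappa>" "y j"] w s k K CL_ge_1 L_pos[OF R, of x]
        by (intro mult_left_mono) auto
      also have "\<dots> = c * W w (y j) s" by (simp add: c_def)
      finally show "K * L (y j) r \<le> c * W w (y j) s" .
    qed
    finally show "emeasure (\<tau> u r) (B (y j) (4 * \<kappa> * s)) \<le> ennreal c * emeasure (\<nu> w) (B (y j) s)"
      using w s c W_pos[OF w s(1), of "y j"] by (simp add: emeasure_\<nu>_B ennreal_mult)
  qed simp
  also have "\<dots> \<le> ennreal c * emeasure (\<nu> w) (B x (2 * \<kappa> * R))"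
    using sub(2)[OF y(1)] by (intro mult_left_mono emeasure_mono) auto
  also have "\<dots> = ennreal (c * W w x (2 * \<kappa> * R))"
    using w k(3) c W_pos[OF w k(3), of x] by (simp add: emeasure_\<nu>_B ennreal_mult)
  also have "\<dots> \<le> ennreal (c * (Cw * (2 * \<kappa>) powr \<theta> * (2 * Cu)))"
  proof (intro ennreal_leI mult_left_mono c)
    have "W w x (2 * \<kappa> * R) \<le> Cw * (2 * \<kappa>) powr \<theta> * W w x R"
      using W_doubling_\<theta>[of w R "2 * \<kappa>" x] w R k by simp
    also have "\<dots> \<le> Cw * (2 * \<kappa>) powr \<theta> * (2 * Cu)"
      using W_L_le[OF R, of x] Cw_ge_1 by (intro mult_left_mono) (auto simp: w_def)
    finally show "W w x (2 * \<kappa> * R) \<le> Cw * (2 * \<kappa>) powr \<theta> * (2 * Cu)" .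
  qed
  also have "c * (Cw * (2 * \<kappa>) powr \<theta> * (2 * Cu)) = Cst * K * L x R"
    by (simp add: c_def Cst_def)
  finally show ?thesis .
qed

lemma Cst_pos: "0 < Cst"
  using Cu_ge_1 CL_ge_1 Cw_ge_1 \<kappa>_ge_1 by (simp add: Cst_def)

end

section \<open>Stopping balls\<close>

locale musielak_kernel = musielak +
  fixes M G p Cp :: real
  assumes \<theta>_less_M: "n * q / i < M" and G_nonneg: "0 \<le> G" and p_gt_1: "1 < p" and Cp_pos: "0 < Cp"
    and dual_weight: "0 < t \<Longrightarrow> 0 < r \<Longrightarrow>
      Wpow (1 - p) t x r \<le> ennreal (Cp * V x r powr p * W t x r powr (1 - p))"
begin

text \<open>Majorant of the operator at scale \<open>\<rho>\<close> applied to a function whose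
  modulus is the density of \<open>\<eta>\<close>. With a measure as argument, its growth on balls
  is the only input needed.\<close>

definition ker :: "real \<Rightarrow> 'a measure \<Rightarrow> 'a \<Rightarrow> ennreal" where
  "ker \<rho> \<eta> x = (\<integral>\<^sup>+y. ennreal (G / V x \<rho> * (1 + d x y / \<rho>) powr (- M)) \<partial>\<eta>)"

lemma d_meas [measurable]: "(\<lambda>y. d x y) \<in> borel_measurable \<mu>"
proof (rule borel_measurableI_less)
  fix r
  have "{y \<in> space \<mu>. d x y < r} = B x r" using space_\<mu> d_sym[of x] by (auto simp: qball_def)
  then show "{y \<in> space \<mu>. d x y < r} \<in> sets \<mu>" by simp
qed

definition Ck :: real where "Ck = 2 powr M / (1 - 2 powr (\<theta> - M))"

lemma Ck_pos: "0 < Ck"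
proof -
  have "2 powr (\<theta> - M) < 2 powr 0" using \<theta>_less_M by (intro powr_less_mono) (auto simp: \<theta>_def)
  then show ?thesis by (simp add: Ck_def)
qed

text \<open>On the \<open>k\<close>-th dyadic annulus the kernel decays like
  \<open>2 powr (- M * k)\<close> while the mass grows like \<open>2 powr (\<theta> * k)\<close>; as
  \<open>\<theta> < M\<close>, the geometric series converges.\<close>

lemma nn_integral_kernel_le:
  assumes \<eta>: "sets \<eta> = sets \<mu>" and \<rho>: "0 < \<rho>" and D: "0 \<le> D"
    and le: "\<And>s. \<rho> \<le> s \<Longrightarrow> emeasure \<eta> (B x s) \<le> ennreal (D * (s / \<rho>) powr \<theta>)"
  shows "(\<integral>\<^sup>+y. ennreal ((1 + d x y / \<rho>) powr (- M)) \<partial>\<eta>) \<le> ennreal (Ck * D)"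
proof -
  note [measurable_cong] = \<eta>
  have M: "0 < M" using \<theta>_less_M \<theta>_pos by (simp add: \<theta>_def)
  define b where "b = 2 powr (\<theta> - M)"
  have "2 powr (\<theta> - M) < 2 powr 0" using \<theta>_less_M by (intro powr_less_mono) (auto simp: \<theta>_def)
  then have b: "0 < b" "b < 1" by (auto simp: b_def)
  have p2: "(2::real) ^ k = 2 powr k" for k :: nat by (simp add: powr_realpow)
  have pt: "ennreal ((1 + d x y / \<rho>) powr (- M)) \<le>
      (\<Sum>k. ennreal (2 powr M * (2 powr (- M)) ^ k) * indicator (B x (2 ^ k * \<rho>)) y)" for y
  proof -
    have dn: "0 \<le> d x y / \<rho>" using d_nonneg \<rho> by simp
    obtain k0 where k0: "d x y / \<rho> < 2 ^ k0" using real_arch_pow[of 2 "d x y / \<rho>"] by auto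
    \<comment> \<open>The least dyadic ball containing \<open>y\<close>. For \<open>k = 0\<close>
      the distance has no lower bound, and the factor \<open>2 powr M\<close> covers that
      case.\<close>
    define k where "k = (LEAST k. d x y / \<rho> < 2 ^ k)"
    have k: "d x y / \<rho> < 2 ^ k" unfolding k_def using k0 by (rule LeastI)
    have "(1 + d x y / \<rho>) powr (- M) \<le> 2 powr M * (2 powr (- M)) ^ k"
    proof (cases k)
      case 0
      have "(1 + d x y / \<rho>) powr (- M) \<le> 1 powr (- M)" using dn M by (intro powr_mono2') auto
      also have "\<dots> \<le> 2 powr M" using M by (simp add: ge_one_powr_ge_zero)
      finally show ?thesis using 0 by simp
    next
      case (Suc j)
      have "\<not> d x y / \<rho> < 2 ^ j" using not_less_Least[of j "\<lambda>k. d x y / \<rho> < 2 ^ k"] Suc by (simp add: k_def)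
      then have "(1 + d x y / \<rho>) powr (- M) \<le> (2 ^ j) powr (- M)" using M by (intro powr_mono2') auto
      also have "\<dots> = 2 powr M * (2 powr (- M)) ^ k"
        by (simp add: p2 powr_powr Suc powr_add[symmetric] powr_realpow[symmetric] algebra_simps)
      finally show ?thesis .
    qed
    then have "ennreal ((1 + d x y / \<rho>) powr (- M)) \<le>
        ennreal (2 powr M * (2 powr (- M)) ^ k) * indicator (B x (2 ^ k * \<rho>)) y"
      using k \<rho> d_sym[of x y] by (simp add: field_simps ennreal_leI)
    also have "\<dots> \<le> (\<Sum>j. ennreal (2 powr M * (2 powr (- M)) ^ j) * indicator (B x (2 ^ j * \<rho>)) y)"
    proof -
      have "f k \<le> suminf f" for f :: "nat \<Rightarrow> ennreal" using sum_le_suminf[of f "{k}"] by simp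
      then show ?thesis .
    qed
    finally show ?thesis .
  qed
  have "(\<integral>\<^sup>+y. ennreal ((1 + d x y / \<rho>) powr (- M)) \<partial>\<eta>) \<le>
      (\<integral>\<^sup>+y. (\<Sum>k. ennreal (2 powr M * (2 powr (- M)) ^ k) * indicator (B x (2 ^ k * \<rho>)) y) \<partial>\<eta>)"
    by (intro nn_integral_mono pt)
  also have "\<dots> = (\<Sum>k. ennreal (2 powr M * (2 powr (- M)) ^ k) * emeasure \<eta> (B x (2 ^ k * \<rho>)))"
    by (subst nn_integral_suminf) (auto simp: nn_integral_cmult_indicator \<eta>)
  also have "\<dots> \<le> (\<Sum>k. ennreal (2 powr M * D * b ^ k))"
  proof (intro suminf_le summableI)
    fix k
    have "ennreal (2 powr M * (2 powr (- M)) ^ k) * emeasure \<eta> (B x (2 ^ k * \<rho>)) \<le>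
        ennreal (2 powr M * (2 powr (- M)) ^ k) * ennreal (D * (2 ^ k * \<rho> / \<rho>) powr \<theta>)"
      using \<rho> by (intro mult_left_mono le) auto
    also have "\<dots> = ennreal (2 powr M * D * b ^ k)"
    proof -
      have "((2::real) ^ k) powr \<theta> = (2 powr \<theta>) ^ k"
        unfolding p2 by (simp add: powr_powr powr_power mult.commute)
      then have "(2 powr (- M)) ^ k * (2 ^ k) powr \<theta> = b ^ k"
        by (simp add: b_def power_mult_distrib[symmetric] powr_add[symmetric])
      then have "2 powr M * (2 powr (- M)) ^ k * (D * (2 ^ k * \<rho> / \<rho>) powr \<theta>) = 2 powr M * D * b ^ k"
        using \<rho> by (simp add: mult_ac)
      moreover have "ennreal (2 powr M * (2 powr (- M)) ^ k) * ennreal (D * (2 ^ k * \<rho> / \<rho>) powr \<theta>) =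
          ennreal (2 powr M * (2 powr (- M)) ^ k * (D * (2 ^ k * \<rho> / \<rho>) powr \<theta>))"
        using D by (intro ennreal_mult[symmetric]) auto
      ultimately show ?thesis by (simp only:)
    qed
    finally show "ennreal (2 powr M * (2 powr (- M)) ^ k) * emeasure \<eta> (B x (2 ^ k * \<rho>)) \<le> ennreal (2 powr M * D * b ^ k)" .
  qed
  also have "\<dots> = ennreal (2 powr M * D * (1 / (1 - b)))"
    using b D by (intro suminf_ennreal_eq sums_mult geometric_sums) auto
  also have "2 powr M * D * (1 / (1 - b)) = Ck * D" by (simp add: Ck_def b_def)
  finally show ?thesis .
qed

lemma ker_le:
  assumes \<eta>: "sets \<eta> = sets \<mu>" and \<rho>: "0 < \<rho>" and D: "0 \<le> D"
    and le: "\<And>s. \<rho> \<le> s \<Longrightarrow> emeasure \<eta> (B x s) \<le> ennreal (D * (s / \<rho>) powr \<theta>)"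
  shows "ker \<rho> \<eta> x \<le> ennreal (G / V x \<rho> * (Ck * D))"
proof -
  note [measurable_cong] = \<eta>
  have "0 \<le> G / V x \<rho>" using G_nonneg V_pos[OF \<rho>, of x] by simp
  then have "ker \<rho> \<eta> x = ennreal (G / V x \<rho>) * (\<integral>\<^sup>+y. ennreal ((1 + d x y / \<rho>) powr (- M)) \<partial>\<eta>)"
    unfolding ker_def by (subst nn_integral_cmult[symmetric]) (auto simp flip: ennreal_mult)
  also have "\<dots> \<le> ennreal (G / V x \<rho>) * ennreal (Ck * D)"
    by (intro mult_left_mono nn_integral_kernel_le assms) auto
  also have "\<dots> = ennreal (G / V x \<rho> * (Ck * D))"
    using \<open>0 \<le> G / V x \<rho>\<close> Ck_pos D by (intro ennreal_mult[symmetric]) auto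
  finally show ?thesis .
qed

text \<open>\<open>G + 1\<close> rather than \<open>G\<close> keeps the constant positive, as
  \<open>G\<close> may be 0.\<close>

definition CN :: real where "CN = (G + 1) * Cd * (2 * \<kappa>) powr n * Ck * (2 * \<kappa>) powr \<theta>"

lemma CN_pos: "0 < CN"
  using Ck_pos Cd_ge_1 G_nonneg \<kappa>_ge_1 by (simp add: CN_def)

text \<open>Growth is known around \<open>z\<close>, but the kernel is centred at \<open>x\<close>.
  Moving the centre by less than \<open>\<rho>\<close> costs a dilation by
  \<open>2 * \<kappa>\<close>, once in the mass and once in the volume.\<close>

lemma ker_le_near:
  assumes \<eta>: "sets \<eta> = sets \<mu>" and \<rho>: "0 < \<rho>" and D: "0 \<le> D" and x: "x \<in> B z \<rho>"
    and le: "\<And>s. \<rho> \<le> s \<Longrightarrow> emeasure \<eta> (B z s) \<le> ennreal (D * (s / \<rho>) powr \<theta>)"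
  shows "ker \<rho> \<eta> x \<le> ennreal (CN * D / V z \<rho>)"
proof -
  have k2: "1 \<le> 2 * \<kappa>" using \<kappa>_ge_1 by simp
  have "emeasure \<eta> (B x s) \<le> ennreal (D * (2 * \<kappa>) powr \<theta> * (s / \<rho>) powr \<theta>)" if s: "\<rho> \<le> s" for s
  proof -
    have "B x s \<subseteq> B z (2 * \<kappa> * s)"
      using x s \<kappa>_ge_1 by (intro ball_subset[of _ _ \<rho>]) (auto simp: algebra_simps)
    then have "emeasure \<eta> (B x s) \<le> emeasure \<eta> (B z (2 * \<kappa> * s))" by (intro emeasure_mono) (auto simp: \<eta>)
    also have "\<dots> \<le> ennreal (D * (2 * \<kappa> * s / \<rho>) powr \<theta>)"
      using s \<rho> k2 mult_mono[of 1 "2 * \<kappa>" \<rho> s] by (intro le) auto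
    also have "2 * \<kappa> * s / \<rho> = (2 * \<kappa>) * (s / \<rho>)" by simp
    finally show ?thesis using s \<rho> \<kappa>_ge_1 by (subst (asm) powr_mult) (auto simp: mult_ac)
  qed
  then have "ker \<rho> \<eta> x \<le> ennreal (G / V x \<rho> * (Ck * (D * (2 * \<kappa>) powr \<theta>)))"
    using D \<rho> \<eta> by (intro ker_le) auto
  also have "\<dots> \<le> ennreal (CN * D / V z \<rho>)"
  proof (rule ennreal_leI)
    have Vx: "0 < V x \<rho>" and Vz: "0 < V z \<rho>" using V_pos \<rho> by auto
    have "V z \<rho> \<le> V x (2 * \<kappa> * \<rho>)"
      using x \<rho> \<kappa>_ge_1 by (intro V_mono ball_subset[of _ _ \<rho>]) (auto simp: d_sym[of z x] algebra_simps)
    also have "\<dots> \<le> Cd * (2 * \<kappa>) powr n * V x \<rho>" using V_doubling[of \<rho> "2 * \<kappa>" x] \<rho> k2 by simp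
    finally have "1 / V x \<rho> \<le> Cd * (2 * \<kappa>) powr n / V z \<rho>" using Vx Vz by (simp add: field_simps)
    then have "G / V x \<rho> \<le> (G + 1) * (Cd * (2 * \<kappa>) powr n / V z \<rho>)"
      using mult_mono[of G "G + 1" "1 / V x \<rho>" "Cd * (2 * \<kappa>) powr n / V z \<rho>"] G_nonneg Vx by simp
    then have "G / V x \<rho> * (Ck * (D * (2 * \<kappa>) powr \<theta>)) \<le>
        (G + 1) * (Cd * (2 * \<kappa>) powr n / V z \<rho>) * (Ck * (D * (2 * \<kappa>) powr \<theta>))"
      using Ck_pos D by (intro mult_right_mono) auto
    also have "\<dots> = CN * D / V z \<rho>" by (simp add: CN_def mult_ac)
    finally show "G / V x \<rho> * (Ck * (D * (2 * \<kappa>) powr \<theta>)) \<le> CN * D / V z \<rho>" .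
  qed
  finally show ?thesis .
qed

text \<open>The integral of \<open>u\<close> is compared with the weight instead of the underlying measure. The weak-type
  bound then holds for the weight itself, and the stopping balls have small weight without any
  appeal to a reverse Hoelder inequality.\<close>

definition bad :: "(real \<Rightarrow> 'a \<Rightarrow> complex) \<Rightarrow> real \<Rightarrow> real \<Rightarrow> 'a \<Rightarrow> real \<Rightarrow> 'a \<Rightarrow> real \<Rightarrow> bool" where
  "bad u K l c R x s \<longleftrightarrow>
     ennreal (l * K * L c R) * emeasure (\<nu> (1 / L c R)) (B x s) < emeasure (\<tau> u R) (B x s)"

definition CA :: real where
  "CA = CN * (Cw + Cst * CL * (5 * \<kappa>\<^sup>2) powr \<theta> * (2 * Cu * Cw * (2 * \<kappa>) powr \<theta>))"

lemma CA_pos: "0 < CA"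
  using CN_pos Cst_pos Cw_ge_1 Cu_ge_1 CL_ge_1 \<kappa>_ge_1 by (auto simp: CA_def intro!: mult_pos_pos add_pos_nonneg)

text \<open>Radii up to \<open>R / (4 * \<kappa>)\<close> obey the stopping rule, which bounds the
  mass by the weight. Beyond that the mass is bounded by the norm of a dilate of
  \<open>B c R\<close>, and \<open>Wl\<close> rewrites the bound in terms of the weight around
  \<open>z\<close>.\<close>

lemma ker_small_ball:
  assumes u: "osc u K" and zQ: "z \<in> B c R" and \<rho>: "0 < \<rho>" "\<rho> \<le> R" and l: "1 \<le> l"
    and good: "\<And>s. \<rho> \<le> s \<Longrightarrow> s \<le> R / (4 * \<kappa>) \<Longrightarrow> \<not> bad u K l c R z s"
    and x: "x \<in> B z \<rho>"
  shows "ker \<rho> (\<tau> u R) x \<le> ennreal (CA * l * K * L c R * W (1 / L c R) z \<rho> / V z \<rho>)"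
proof -
  have R: "0 < R" using \<rho> by simp
  define w where "w = 1 / L c R"
  have w: "0 < w" using L_pos[OF R] by (simp add: w_def)
  have K: "0 < K" using oscD(2)[OF u] .
  have L0: "0 < L c R" using L_pos[OF R] .
  have W0: "0 < W w z \<rho>" using W_pos w \<rho> by simp
  have k2: "1 \<le> 2 * \<kappa>" using \<kappa>_ge_1 by simp
  have kk: "1 \<le> \<kappa>\<^sup>2" using \<kappa>_ge_1 by simp
  define C2 where "C2 = Cst * CL * (5 * \<kappa>\<^sup>2) powr \<theta> * (2 * Cu * Cw * (2 * \<kappa>) powr \<theta>)"
  have C2: "0 \<le> C2" using Cst_pos CL_ge_1 Cu_ge_1 Cw_ge_1 by (simp add: C2_def)
  define D0 where "D0 = (Cw + C2) * l * K * L c R * W w z \<rho>"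
  have D0: "0 \<le> D0" using C2 Cw_ge_1 l K L0 W0 by (simp add: D0_def)
  \<comment> \<open>\<open>B c R\<close> has weight at least \<open>1 / (2 * Cu)\<close> and lies in
    a dilate of \<open>B z \<rho>\<close>, so doubling bounds the weight of
    \<open>B z \<rho>\<close> from below.\<close>
  have Wl: "1 / (2 * Cu) \<le> Cw * (2 * \<kappa> * R / \<rho>) powr \<theta> * W w z \<rho>"
  proof -
    have "1 / (2 * Cu) \<le> W w c R" unfolding w_def by (rule W_L_ge[OF R])
    also have "\<dots> \<le> W w z (2 * \<kappa> * R)"
      using zQ R \<kappa>_ge_1 w by (intro W_mono ball_subset[of _ _ R]) (auto simp: d_sym[of c z] algebra_simps)
    also have "2 * \<kappa> * R = 2 * \<kappa> * R / \<rho> * \<rho>" using \<rho> by simp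
    also have "1 \<le> 2 * \<kappa> * R / \<rho>" using mult_mono[of 1 "2 * \<kappa>" \<rho> R] k2 \<rho> by (simp add: field_simps)
    then have "W w z (2 * \<kappa> * R / \<rho> * \<rho>) \<le> Cw * (2 * \<kappa> * R / \<rho>) powr \<theta> * W w z \<rho>"
      using w \<rho> by (intro W_doubling_\<theta>)
    finally show ?thesis .
  qed
  have main: "emeasure (\<tau> u R) (B z s) \<le> ennreal (D0 * (s / \<rho>) powr \<theta>)" if s: "\<rho> \<le> s" for s
  proof (cases "s \<le> R / (4 * \<kappa>)")
    case True
    have s0: "0 < s" "1 \<le> s / \<rho>" using s \<rho> by auto
    have "emeasure (\<tau> u R) (B z s) \<le> ennreal (l * K * L c R) * emeasure (\<nu> w) (B z s)"
      using good[OF s True] by (simp add: bad_def w_def not_less)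
    also have "\<dots> = ennreal (l * K * L c R * W w z s)"
      using l K L0 w s0 W_pos[OF w s0(1), of z] by (simp add: emeasure_\<nu>_B ennreal_mult)
    also have "\<dots> \<le> ennreal (D0 * (s / \<rho>) powr \<theta>)"
    proof (rule ennreal_leI)
      have "W w z s \<le> Cw * (s / \<rho>) powr \<theta> * W w z \<rho>"
        using W_doubling_\<theta>[of w \<rho> "s / \<rho>" z] w \<rho> s0 by simp
      then have "l * K * L c R * W w z s \<le> l * K * L c R * (Cw * (s / \<rho>) powr \<theta> * W w z \<rho>)"
        using l K L0 by (intro mult_left_mono) auto
      also have "\<dots> = Cw * (l * K * L c R * W w z \<rho> * (s / \<rho>) powr \<theta>)" by simp
      also have "\<dots> \<le> (Cw + C2) * (l * K * L c R * W w z \<rho> * (s / \<rho>) powr \<theta>)"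
        using l K L0 W0 C2 by (intro mult_right_mono) auto
      finally show "l * K * L c R * W w z s \<le> D0 * (s / \<rho>) powr \<theta>" by (simp add: D0_def mult_ac)
    qed
    finally show ?thesis .
  next
    case False
    then have sR: "R \<le> 4 * \<kappa> * s" using \<kappa>_ge_1 by (simp add: field_simps)
    have s0: "0 < s" using s \<rho> by simp
    \<comment> \<open>Since \<open>R \<le> 4 * \<kappa> * s\<close>, the number
      \<open>\<kappa> * (R + s)\<close> is at most \<open>5 * \<kappa>\<^sup>2 * s\<close>, the
      radius of a dilate of \<open>B c R\<close> that contains \<open>B z s\<close>.\<close>
    define l' where "l' = 5 * \<kappa>\<^sup>2 * s / R"
    have ks: "\<kappa> * s \<le> \<kappa>\<^sup>2 * s" "s \<le> \<kappa> * s" using \<kappa>_ge_1 s0 mult_right_mono[of 1 \<kappa> "\<kappa> * s"] by (auto simp: power2_eq_square)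
    have l': "1 \<le> l'" proof -
      have "R \<le> 5 * \<kappa>\<^sup>2 * s" using sR ks s0 by linarith
      then show ?thesis using R by (simp add: l'_def)
    qed
    have l'R: "l' * R = 5 * \<kappa>\<^sup>2 * s" using R by (simp add: l'_def)
    have "B z s \<subseteq> B c (l' * R)"
    proof (rule ball_subset[of _ _ R])
      show "d z c \<le> R" using zQ by simp
      have "\<kappa> * (R + s) \<le> \<kappa> * (4 * \<kappa> * s + s)" using sR \<kappa>_ge_1 by (intro mult_left_mono) auto
      also have "\<dots> = 4 * (\<kappa>\<^sup>2 * s) + \<kappa> * s" by (simp add: algebra_simps power2_eq_square)
      also have "\<dots> \<le> l' * R" unfolding l'R using ks by linarith
      finally show "\<kappa> * (R + s) \<le> l' * R" .
    qed
    then have "emeasure (\<tau> u R) (B z s) \<le> emeasure (\<tau> u R) (B c (l' * R))" by (intro emeasure_mono) auto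
    also have "\<dots> \<le> ennreal (Cst * K * L c (l' * R))"
      using R l' by (intro osc_small_scale[OF u]) (auto simp: mult_le_cancel_right1)
    also have "\<dots> \<le> ennreal (D0 * (s / \<rho>) powr \<theta>)"
    proof (rule ennreal_leI)
      define X where "X = Cst * K * CL * L c R * (5 * \<kappa>\<^sup>2) powr \<theta>"
      have X: "0 \<le> X" using Cst_pos K CL_ge_1 L0 by (simp add: X_def)
      have "Cst * K * L c (l' * R) \<le> Cst * K * (CL * l' powr \<theta> * L c R)"
        using L_growth[OF R l', of c] Cst_pos K by (intro mult_left_mono) auto
      also have "\<dots> = X * (s / R) powr \<theta>"
        using s0 R \<kappa>_ge_1 powr_mult[of "5 * \<kappa>\<^sup>2" "s / R" \<theta>] by (simp add: X_def l'_def mult_ac)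
      \<comment> \<open>The new factor is at least 1 by \<open>Wl\<close>. It replaces
        \<open>R\<close> by \<open>\<rho>\<close> in the growth and brings in the weight.\<close>
      also have "\<dots> \<le> X * ((s / R) powr \<theta> * (2 * Cu * (Cw * (2 * \<kappa> * R / \<rho>) powr \<theta> * W w z \<rho>)))"
      proof (intro mult_left_mono X)
        have "1 \<le> 2 * Cu * (Cw * (2 * \<kappa> * R / \<rho>) powr \<theta> * W w z \<rho>)"
          using Wl Cu_ge_1 by (simp add: field_simps)
        then show "(s / R) powr \<theta> \<le> (s / R) powr \<theta> * (2 * Cu * (Cw * (2 * \<kappa> * R / \<rho>) powr \<theta> * W w z \<rho>))"
          using mult_left_mono[of 1 _ "(s / R) powr \<theta>"] by simp
      qed
      also have "(s / R) powr \<theta> * (2 * Cu * (Cw * (2 * \<kappa> * R / \<rho>) powr \<theta> * W w z \<rho>))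
        = ((s / R) * (2 * \<kappa> * R / \<rho>)) powr \<theta> * (2 * Cu * (Cw * W w z \<rho>))"
        using s0 R \<rho> \<kappa>_ge_1 by (subst powr_mult) auto
      also have "(s / R) * (2 * \<kappa> * R / \<rho>) = 2 * \<kappa> * (s / \<rho>)" using R by simp
      also have "(2 * \<kappa> * (s / \<rho>)) powr \<theta> = (2 * \<kappa>) powr \<theta> * (s / \<rho>) powr \<theta>"
        using s0 \<rho> \<kappa>_ge_1 by (subst powr_mult) auto
      also have "X * ((2 * \<kappa>) powr \<theta> * (s / \<rho>) powr \<theta> * (2 * Cu * (Cw * W w z \<rho>)))
         = C2 * (K * L c R * W w z \<rho> * (s / \<rho>) powr \<theta>)" by (simp add: X_def C2_def mult_ac)
      also have "\<dots> \<le> ((Cw + C2) * l) * (K * L c R * W w z \<rho> * (s / \<rho>) powr \<theta>)"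
      proof (intro mult_right_mono)
        have "C2 * 1 \<le> (Cw + C2) * l" using C2 Cw_ge_1 l by (intro mult_mono) auto
        then show "C2 \<le> (Cw + C2) * l" by simp
      qed (use K L0 W0 in auto)
      finally show "Cst * K * L c (l' * R) \<le> D0 * (s / \<rho>) powr \<theta>" by (simp add: D0_def mult_ac)
    qed
    finally show ?thesis .
  qed
  have "ker \<rho> (\<tau> u R) x \<le> ennreal (CN * D0 / V z \<rho>)"
    by (rule ker_le_near[OF _ \<rho>(1) D0 x main]) simp
  also have "CN * D0 / V z \<rho> = CA * l * K * L c R * W w z \<rho> / V z \<rho>"
    by (simp add: CA_def C2_def D0_def mult_ac)
  finally show ?thesis by (simp add: w_def)
qed

definition CB :: real where "CB = CN * Cst * CL"

lemma CB_pos: "0 < CB"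
  using CN_pos Cst_pos CL_ge_1 by (simp add: CB_def)

text \<open>Here \<open>osc_small_scale\<close> suffices: as \<open>\<rho> \<le> R\<close>, it
  applies to every ball around \<open>c\<close> of radius at least \<open>R\<close>.\<close>

lemma ker_large_ball:
  assumes u: "osc u K" and xQ: "x \<in> B c R" and \<rho>: "0 < \<rho>" "\<rho> \<le> R"
  shows "ker R (\<tau> u \<rho>) x \<le> ennreal (CB * K * L c R / V c R)"
proof -
  have R: "0 < R" using \<rho> by simp
  have K: "0 < K" using oscD(2)[OF u] .
  define D0 where "D0 = Cst * K * CL * L c R"
  have D0: "0 \<le> D0" using Cst_pos K CL_ge_1 L_pos[OF R, of c] by (simp add: D0_def)
  have main: "emeasure (\<tau> u \<rho>) (B c s) \<le> ennreal (D0 * (s / R) powr \<theta>)" if s: "R \<le> s" for s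
  proof -
    have "emeasure (\<tau> u \<rho>) (B c s) \<le> ennreal (Cst * K * L c s)"
      using \<rho> s by (intro osc_small_scale[OF u]) auto
    also have "\<dots> \<le> ennreal (Cst * K * (CL * (s / R) powr \<theta> * L c R))"
      using L_growth[OF R, of "s / R" c] s R Cst_pos K by (intro ennreal_leI mult_left_mono) auto
    finally show ?thesis by (simp add: D0_def mult_ac)
  qed
  have "ker R (\<tau> u \<rho>) x \<le> ennreal (CN * D0 / V c R)"
    by (rule ker_le_near[OF _ R D0 xQ main]) simp
  also have "CN * D0 / V c R = CB * K * L c R / V c R" by (simp add: CB_def D0_def)
  finally show ?thesis .
qed

text \<open>The factor \<open>Cst * CL * (2 * \<kappa>) powr \<theta>\<close>, here and in
  \<open>CV\<close>, bounds the oscillation over the dilate that contains all selected balls, in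
  units of \<open>K * L c R\<close>.\<close>

definition CW :: real where "CW = Cw * (4 * \<kappa>) powr \<theta> * (Cst * CL * (2 * \<kappa>) powr \<theta>)"

definition CV :: real where
  "CV = Cd * (4 * \<kappa>) powr n * (Cd * (2 * \<kappa>) powr n * (2 * Cu * Ca * (Cst * CL * (2 * \<kappa>) powr \<theta>)) powr (1 / q))"

definition CG :: real where "CG = Cw * (4 * \<kappa>) powr \<theta>"

text \<open>The bound on the weight is the weak-type estimate for the selected disjoint balls; the
  bound on the measure follows from it through \<open>muckenhoupt_set\<close>.\<close>

lemma stopping_balls:
  assumes u: "osc u K" and R: "0 < R" and l: "1 \<le> l"
  obtains y :: "nat \<Rightarrow> 'a" and \<rho> J where
    "\<And>j. j \<in> J \<Longrightarrow> y j \<in> B c R \<and> 0 < \<rho> j \<and> \<rho> j \<le> R"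
    "\<And>j s. j \<in> J \<Longrightarrow> \<rho> j \<le> s \<Longrightarrow> s \<le> R / (4 * \<kappa>) \<Longrightarrow> \<not> bad u K l c R (y j) s"
    "(\<Sum>j. indicator J j * emeasure (\<nu> (1 / L c R)) (B (y j) (\<rho> j))) \<le> ennreal (CW / l)"
    "(\<Sum>j. indicator J j * emeasure \<mu> (B (y j) (\<rho> j))) \<le> ennreal (CV * l powr (- 1 / q) * V c R)"
    "AE x in \<mu>. x \<in> B c R \<longrightarrow> x \<notin> (\<Union>j\<in>J. B (y j) (\<rho> j)) \<longrightarrow>
       cmod (u R x) \<le> CG * l * K * L c R * \<phi> x (1 / L c R)"
proof -
  have K: "0 < K" using oscD(2)[OF u] .
  have L0: "0 < L c R" using L_pos[OF R] .
  define w where "w = 1 / L c R"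
  have w: "0 < w" using L0 by (simp add: w_def)
  have k2: "1 \<le> 2 * \<kappa>" "1 \<le> 4 * \<kappa>" using \<kappa>_ge_1 by auto
  \<comment> \<open>Bad radii are sought only up to \<open>R'\<close>, so that balls enlarged by
    \<open>4 * \<kappa>\<close> have radius at most \<open>R\<close>.\<close>
  define R' where "R' = R / (4 * \<kappa>)"
  have R': "0 < R'" "4 * \<kappa> * R' = R" "R' \<le> R" using R \<kappa>_ge_1 by (auto simp: R'_def field_simps)
  define Z where "Z = B c (2 * \<kappa> * R)"
  have kR: "0 < 2 * \<kappa> * R" using R \<kappa>_ge_1 by simp
  define X where "X = l * K * L c R"
  have X: "0 < X" using l K L0 by (simp add: X_def)
  define E where "E = {x \<in> B c R. \<exists>s. 0 < s \<and> s \<le> R' \<and> bad u K l c R x s}"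
  have subZ: "B x s \<subseteq> Z" if "x \<in> B c R" "s \<le> R" for x s
    unfolding Z_def using that \<kappa>_ge_1 by (intro ball_subset[of _ _ R]) (auto simp: algebra_simps)
  \<comment> \<open>The supremum of the bad radii need not be attained. A bad radius above half of
    it suffices, because the enlarged ball has radius \<open>4 * \<kappa> * s \<ge> 2 * s\<close>,
    and from \<open>2 * s\<close> up to \<open>R'\<close> nothing is bad.\<close>
  have "\<exists>s. 0 < s \<and> s \<le> R' \<and> bad u K l c R x s \<and> (\<forall>s'. 2 * s \<le> s' \<longrightarrow> s' \<le> R' \<longrightarrow> \<not> bad u K l c R x s')"
    if "x \<in> E" for x
  proof -
    define S where "S = {s. 0 < s \<and> s \<le> R' \<and> bad u K l c R x s}"
    have ne: "S \<noteq> {}" using that by (auto simp: E_def S_def)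
    have bdd: "bdd_above S" by (auto simp: S_def intro!: bdd_aboveI[of _ R'])
    obtain s1 where "s1 \<in> S" using ne by auto
    then have "0 < Sup S" using cSup_upper[OF _ bdd, of s1] by (force simp: S_def)
    then have "Sup S / 2 < Sup S" by simp
    then obtain s where s: "s \<in> S" "Sup S / 2 < s" using less_cSup_iff[OF ne bdd] by blast
    have "s' \<notin> S" if "2 * s \<le> s'" for s' using cSup_upper[OF _ bdd, of s'] s that by auto
    then show ?thesis using s by (intro exI[of _ s]) (auto simp: S_def)
  qed
  then obtain s where s: "\<And>x. x \<in> E \<Longrightarrow> 0 < s x \<and> s x \<le> R' \<and> bad u K l c R x (s x)"
    "\<And>x s'. x \<in> E \<Longrightarrow> 2 * s x \<le> s' \<Longrightarrow> s' \<le> R' \<Longrightarrow> \<not> bad u K l c R x s'" by metis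
  have EQ: "E \<subseteq> B c R" by (auto simp: E_def)
  obtain y :: "nat \<Rightarrow> 'a" and J where y: "\<And>j. j \<in> J \<Longrightarrow> y j \<in> E"
    "disjoint_family_on (\<lambda>j. B (y j) (s (y j))) J" "E \<subseteq> (\<Union>j\<in>J. B (y j) (4 * \<kappa> * s (y j)))"
  proof (rule vitali[of E s R' Z])
    show "0 < s x \<and> s x \<le> R' \<and> B x (s x) \<subseteq> Z" if "x \<in> E" for x
      using s(1)[OF that] EQ that R'(3) subZ[of x "s x"] by (meson order_trans subsetD)
    show "emeasure \<mu> Z < \<infinity>" unfolding Z_def by (rule ball_finite[OF kR])
  qed (auto simp: Z_def)
  define \<rho> where "\<rho> j = 4 * \<kappa> * s (y j)" for j
  define U where "U = (\<Union>j\<in>J. B (y j) (s (y j)))"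
  have sj: "0 < s (y j)" "s (y j) \<le> R'" "bad u K l c R (y j) (s (y j))" "y j \<in> B c R" if "j \<in> J" for j
    using s(1)[OF y(1)[OF that]] EQ y(1)[OF that] by auto
  have UZ: "U \<subseteq> Z"
    unfolding U_def using subZ sj(2,4) R' by (meson UN_least order_trans)
  have Us [measurable]: "U \<in> sets \<mu>" unfolding U_def by auto
  have \<rho>: "y j \<in> B c R \<and> 0 < \<rho> j \<and> \<rho> j \<le> R" if "j \<in> J" for j
    using sj[OF that] \<kappa>_ge_1 R'(2) mult_left_mono[of "s (y j)" R' "4 * \<kappa>"] by (auto simp: \<rho>_def)
  define T where "T = Cst * CL * (2 * \<kappa>) powr \<theta>"
  have T: "0 < T" using Cst_pos CL_ge_1 \<kappa>_ge_1 by (simp add: T_def)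
  \<comment> \<open>Every selected ball is bad, so \<open>X\<close> times the weight of the disjoint
    union is at most the oscillation over it, hence at most that over \<open>Z\<close>.\<close>
  have \<nu>U: "emeasure (\<nu> w) U \<le> ennreal (T / l)"
  proof -
    have "ennreal X * emeasure (\<nu> w) U = (\<Sum>j. ennreal X * (indicator J j * emeasure (\<nu> w) (B (y j) (s (y j)))))"
      unfolding U_def by (subst emeasure_suminf_disjoint[symmetric, OF y(2)]) auto
    also have "\<dots> \<le> (\<Sum>j. indicator J j * emeasure (\<tau> u R) (B (y j) (s (y j))))"
    proof (intro suminf_le summableI)
      fix j show "ennreal X * (indicator J j * emeasure (\<nu> w) (B (y j) (s (y j)))) \<le>
          indicator J j * emeasure (\<tau> u R) (B (y j) (s (y j)))"
        using sj(3)[of j] by (cases "j \<in> J") (auto simp: bad_def X_def w_def)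
    qed
    also have "\<dots> = emeasure (\<tau> u R) U"
      unfolding U_def by (subst emeasure_suminf_disjoint[symmetric, OF y(2)]) auto
    also have "\<dots> \<le> emeasure (\<tau> u R) Z" using UZ by (intro emeasure_mono) (auto simp: Z_def)
    also have "\<dots> \<le> ennreal (Cst * K * L c (2 * \<kappa> * R))"
      unfolding Z_def using R k2 by (intro osc_small_scale[OF u]) (auto simp: mult_le_cancel_right1)
    also have "\<dots> \<le> ennreal (Cst * K * (CL * (2 * \<kappa>) powr \<theta> * L c R))"
      using L_growth[OF R k2(1), of c] Cst_pos K by (intro ennreal_leI mult_left_mono) auto
    also have "Cst * K * (CL * (2 * \<kappa>) powr \<theta> * L c R) = X * (T / l)"
      using l by (simp add: X_def T_def)
    also have "ennreal (X * (T / l)) = ennreal X * ennreal (T / l)" using X T l by (intro ennreal_mult) auto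
    finally show ?thesis using X by (subst (asm) ennreal_mult_le_mult_iff) auto
  qed
  show ?thesis
  proof (rule that[of J y \<rho>])
    show "\<not> bad u K l c R (y j) s'" if "j \<in> J" "\<rho> j \<le> s'" "s' \<le> R / (4 * \<kappa>)" for j s'
    proof (rule s(2)[OF y(1)[OF that(1)]])
      have "2 * s (y j) \<le> \<rho> j" using sj[OF that(1)] \<kappa>_ge_1 by (simp add: \<rho>_def)
      then show "2 * s (y j) \<le> s'" using that by simp
    qed (use that in \<open>simp add: R'_def\<close>)
    have "(\<Sum>j. indicator J j * emeasure (\<nu> w) (B (y j) (\<rho> j))) \<le> ennreal (Cw * (4 * \<kappa>) powr \<theta>) * emeasure (\<nu> w) U"
      unfolding U_def
    proof (rule suminf_le_disjoint[OF y(2)])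
      fix j assume "j \<in> J"
      then show "emeasure (\<nu> w) (B (y j) (\<rho> j)) \<le>
        ennreal (Cw * (4 * \<kappa>) powr \<theta>) * emeasure (\<nu> w) (B (y j) (s (y j)))"
        using W_doubling_\<theta>[of w "s (y j)" "4 * \<kappa>" "y j"] w k2 sj[of j] Cw_ge_1 \<rho>[of j] W_pos[of w "s (y j)" "y j"]
        by (auto simp: \<rho>_def emeasure_\<nu>_B ennreal_mult[symmetric] ennreal_leI)
    qed simp
    also have "\<dots> \<le> ennreal (Cw * (4 * \<kappa>) powr \<theta>) * ennreal (T / l)"
      by (intro mult_left_mono \<nu>U) auto
    also have "\<dots> = ennreal (CW / l)"
      using Cw_ge_1 T l by (simp add: ennreal_mult[symmetric] CW_def T_def)
    finally show "(\<Sum>j. indicator J j * emeasure (\<nu> (1 / L c R)) (B (y j) (\<rho> j))) \<le> ennreal (CW / l)"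
      by (simp add: w_def)
    have fmZ: "emeasure \<mu> U < \<infinity>"
      using UZ ball_finite[OF kR, of c] emeasure_mono[of U Z \<mu>] by (auto simp: Z_def intro: le_less_trans)
    have \<mu>U: "emeasure \<mu> U \<le> ennreal (Cd * (2 * \<kappa>) powr n * (2 * Cu * Ca * T) powr (1 / q) * l powr (- 1 / q) * V c R)"
    proof -
      have q0: "0 < q" using q_ge_1 by simp
      define m where "m = measure \<mu> U"
      have VZ: "0 < V c (2 * \<kappa> * R)" by (rule V_pos[OF kR])
      have nU: "measure (\<nu> w) U \<le> T / l"
        using \<nu>U T l by (metis enn2real_leI less_imp_le measure_def divide_nonneg_nonneg order_trans zero_le_one)
      have "1 / (2 * Cu) \<le> W w c R" unfolding w_def by (rule W_L_ge[OF R])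
      also have "\<dots> \<le> W w c (2 * \<kappa> * R)"
        using w R k2 kR by (intro W_mono B_mono) (auto simp: mult_le_cancel_right1)
      finally have WZ: "1 / (2 * Cu) \<le> W w c (2 * \<kappa> * R)" .
      have "m powr q * (1 / (2 * Cu)) \<le> m powr q * W w c (2 * \<kappa> * R)"
        using WZ by (intro mult_left_mono) auto
      also have "\<dots> \<le> Ca * V c (2 * \<kappa> * R) powr q * measure (\<nu> w) U"
        unfolding m_def using w kR UZ Us by (intro muckenhoupt_set) (auto simp: Z_def)
      also have "\<dots> \<le> Ca * V c (2 * \<kappa> * R) powr q * (T / l)"
        using nU Ca_ge_1 by (intro mult_left_mono) auto
      finally have "m powr q \<le> V c (2 * \<kappa> * R) powr q * (2 * Cu * Ca * T / l)"
        using Cu_ge_1 by (simp add: field_simps)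
      then have "(m powr q) powr (1 / q) \<le> (V c (2 * \<kappa> * R) powr q * (2 * Cu * Ca * T / l)) powr (1 / q)"
        using q0 by (intro powr_mono2) auto
      also have "\<dots> = V c (2 * \<kappa> * R) * ((2 * Cu * Ca * T) powr (1 / q) * l powr (- 1 / q))"
        using q0 VZ Cu_ge_1 Ca_ge_1 T l by (simp add: powr_mult powr_powr powr_divide powr_minus_divide)
      also have "\<dots> \<le> Cd * (2 * \<kappa>) powr n * V c R * ((2 * Cu * Ca * T) powr (1 / q) * l powr (- 1 / q))"
        using V_doubling[OF R k2(1), of c] by (intro mult_right_mono) auto
      finally have "m \<le> Cd * (2 * \<kappa>) powr n * (2 * Cu * Ca * T) powr (1 / q) * l powr (- 1 / q) * V c R"
        using q0 by (simp add: powr_powr m_def mult_ac)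
      then show ?thesis using fmZ by (simp add: m_def emeasure_eq_ennreal_measure less_top[symmetric] ennreal_leI)
    qed
    have "(\<Sum>j. indicator J j * emeasure \<mu> (B (y j) (\<rho> j))) \<le> ennreal (Cd * (4 * \<kappa>) powr n) * emeasure \<mu> U"
      unfolding U_def
    proof (rule suminf_le_disjoint[OF y(2)])
      fix j assume "j \<in> J"
      then show "emeasure \<mu> (B (y j) (\<rho> j)) \<le> ennreal (Cd * (4 * \<kappa>) powr n) * emeasure \<mu> (B (y j) (s (y j)))"
        using V_doubling[of "s (y j)" "4 * \<kappa>" "y j"] k2 sj[of j] Cd_ge_1 \<rho>[of j] V_pos[of "s (y j)" "y j"]
        by (auto simp: \<rho>_def emeasure_B ennreal_mult[symmetric] ennreal_leI)
    qed simp
    also have "\<dots> \<le> ennreal (Cd * (4 * \<kappa>) powr n) *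
        ennreal (Cd * (2 * \<kappa>) powr n * (2 * Cu * Ca * T) powr (1 / q) * l powr (- 1 / q) * V c R)"
      by (intro mult_left_mono \<mu>U) auto
    also have "\<dots> = ennreal (CV * l powr (- 1 / q) * V c R)"
      using Cd_ge_1 V_pos[OF R, of c] by (simp add: ennreal_mult[symmetric] CV_def T_def mult_ac)
    finally show "(\<Sum>j. indicator J j * emeasure \<mu> (B (y j) (\<rho> j))) \<le> ennreal (CV * l powr (- 1 / q) * V c R)" .
    \<comment> \<open>The points off the enlarged balls at which the claimed bound fails; they will
      form a null set.\<close>
    define F where "F = {x \<in> B c R - (\<Union>j\<in>J. B (y j) (\<rho> j)). CG * X * \<phi> x w < cmod (u R x)}"
    have [measurable]: "(\<lambda>x. \<phi> x w) \<in> borel_measurable \<mu>" "u R \<in> borel_measurable \<mu>"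
      using w by (auto intro!: \<phi>_meas oscD(1)[OF u R])
    have Fs [measurable]: "F \<in> sets \<mu>"
    proof -
      have "F = {x \<in> space \<mu>. CG * X * \<phi> x w < cmod (u R x)} \<inter> (B c R - (\<Union>j\<in>J. B (y j) (\<rho> j)))"
        using space_\<mu> by (auto simp: F_def)
      also have "\<dots> \<in> sets \<mu>" by measurable
      finally show ?thesis .
    qed
    \<comment> \<open>\<open>domination\<close> asks for a finite measure, and the weight is only
      known to be finite on balls. It is cut off outside \<open>Z\<close>, which contains every ball
      that occurs.\<close>
    define \<nu>' where "\<nu>' = density (\<nu> w) (indicator Z)"
    have Zs [measurable]: "Z \<in> sets \<mu>" by (simp add: Z_def)
    have \<nu>': "emeasure \<nu>' A = emeasure (\<nu> w) (A \<inter> Z)" if "A \<in> sets \<mu>" for A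
      unfolding \<nu>'_def using that
      by (subst emeasure_density) (auto simp flip: indicator_inter_arith simp: Int_commute)
    have WZ: "emeasure (\<nu> w) Z = ennreal (W w c (2 * \<kappa> * R))" using w kR by (simp add: Z_def emeasure_\<nu>_B)
    have fin: "finite_measure \<nu>'"
      by (rule finite_measureI) (use \<nu>'[of UNIV] sets.top[of \<mu>] space_\<mu> WZ in \<open>auto simp: \<nu>'_def \<nu>_def\<close>)
    have CG: "0 \<le> CG" using Cw_ge_1 by (simp add: CG_def)
    have "emeasure (\<tau> u R) F \<le> ennreal X * ennreal CG * emeasure \<nu>' F"
    proof (rule domination[OF fin _ _ Fs R'(1), where Z = Z])
      show "emeasure \<mu> Z < \<infinity>" unfolding Z_def by (rule ball_finite[OF kR])
      fix x assume "x \<in> F"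
      \<comment> \<open>The enlarged balls cover \<open>E\<close>, so a point of \<open>F\<close> is
        not in \<open>E\<close> and all radii up to \<open>R'\<close> around it are good.\<close>
      then have xQ: "x \<in> B c R" and xE: "x \<notin> E" using y(3) by (auto simp: F_def \<rho>_def)
      show "B x R' \<subseteq> Z" using subZ xQ R' by auto
      fix s' assume s': "0 < s'" "s' \<le> R'"
      have sub: "B x s' \<inter> Z = B x s'" "B x (4 * \<kappa> * s') \<inter> Z = B x (4 * \<kappa> * s')"
        using subZ[OF xQ, of s'] subZ[OF xQ, of "4 * \<kappa> * s'"] s' R' \<kappa>_ge_1
          mult_left_mono[of s' R' "4 * \<kappa>"] by auto
      show "emeasure (\<tau> u R) (B x s') \<le> ennreal X * emeasure \<nu>' (B x s')"
        using xE s' xQ sub by (auto simp: E_def bad_def X_def w_def \<nu>' not_less)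
      show "emeasure \<nu>' (B x (4 * \<kappa> * s')) \<le> ennreal CG * emeasure \<nu>' (B x s')"
        using W_doubling_\<theta>[of w s' "4 * \<kappa>" x] w k2 s' CG W_pos[OF w s'(1), of x] \<kappa>_ge_1
        by (simp add: \<nu>' sub emeasure_\<nu>_B CG_def ennreal_mult[symmetric] ennreal_leI)
    qed (auto simp: \<nu>'_def)
    also have "\<dots> = ennreal (CG * X) * emeasure (\<nu> w) F"
    proof -
      have "F \<inter> Z = F" using subZ[of _ R'] R' center_in_B[OF R'(1)] by (fastforce simp: F_def)
      then show ?thesis using \<nu>'[OF Fs] X CG by (simp add: ennreal_mult mult.commute)
    qed
    finally have le: "emeasure (\<tau> u R) F \<le> ennreal (CG * X) * emeasure (\<nu> w) F" .
    have fF: "emeasure (\<nu> w) F < \<infinity>"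
    proof -
      have "emeasure (\<nu> w) F \<le> emeasure (\<nu> w) (B c R)" by (intro emeasure_mono) (auto simp: F_def)
      then show ?thesis using w R by (simp add: emeasure_\<nu>_B) (metis ennreal_less_top order_le_less_trans)
    qed
    \<comment> \<open>On \<open>F\<close> the oscillation exceeds \<open>CG * X\<close> times the
      weight pointwise, while \<open>le\<close> gives the reverse for the integrals. As these are
      finite, \<open>F\<close> is null.\<close>
    have "AE x in \<mu>. x \<notin> F"
    proof -
      define f where "f x = ennreal (CG * X * \<phi> x w) * indicator F x" for x
      define g where "g x = ennreal (cmod (u R x)) * indicator F x" for x
      have [measurable]: "f \<in> borel_measurable \<mu>" "g \<in> borel_measurable \<mu>"
        unfolding f_def g_def by measurable
      have pw: "0 < \<phi> x w" for x using \<phi>_pos w by simp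
      have If: "(\<integral>\<^sup>+x. f x \<partial>\<mu>) = ennreal (CG * X) * emeasure (\<nu> w) F"
        unfolding f_def \<nu>_def using CG X pw
        by (simp add: emeasure_density ennreal_mult less_imp_le mult.assoc nn_integral_cmult)
      have Ig: "(\<integral>\<^sup>+x. g x \<partial>\<mu>) = emeasure (\<tau> u R) F"
        unfolding g_def \<tau>_def by (simp add: emeasure_density)
      have fg: "f x \<le> g x" for x by (auto simp: f_def g_def F_def ennreal_leI split: split_indicator)
      have fi: "(\<integral>\<^sup>+x. f x \<partial>\<mu>) \<noteq> \<infinity>" using If fF by (simp add: ennreal_mult_eq_top_iff)
      have "(\<integral>\<^sup>+x. g x - f x \<partial>\<mu>) = (\<integral>\<^sup>+x. g x \<partial>\<mu>) - (\<integral>\<^sup>+x. f x \<partial>\<mu>)"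
        using fi fg by (intro nn_integral_diff) auto
      also have "\<dots> = 0" using If Ig le fi by (metis diff_eq_0_iff_ennreal infinity_ennreal_def le_less_trans less_top)
      finally have "AE x in \<mu>. g x - f x = 0" by (subst (asm) nn_integral_0_iff_AE) auto
      then show ?thesis
      proof (rule AE_mp, intro AE_I2 impI notI)
        fix x assume x: "g x - f x = 0" "x \<in> F"
        then have "ennreal (cmod (u R x)) - ennreal (CG * X * \<phi> x w) = 0"
          by (simp add: f_def g_def)
        then have "cmod (u R x) \<le> CG * X * \<phi> x w"
          using CG X pw[of x] by (simp add: diff_eq_0_iff_ennreal)
        then show False using x(2) by (simp add: F_def)
      qed
    qed
    then show "AE x in \<mu>. x \<in> B c R \<longrightarrow> x \<notin> (\<Union>j\<in>J. B (y j) (\<rho> j)) \<longrightarrow>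
       cmod (u R x) \<le> CG * l * K * L c R * \<phi> x (1 / L c R)"
      by (auto elim!: eventually_mono simp: F_def X_def w_def not_less mult_ac)
  qed (use \<rho> in auto)
qed

end

section \<open>The John--Nirenberg inequality\<close>

lemma powr_add3_le:
  fixes a b e p :: real
  assumes "0 \<le> a" "0 \<le> b" "0 \<le> e" "0 < p"
  shows "(a + b + e) powr p \<le> 3 powr p * (a powr p + b powr p + e powr p)"
proof -
  define m where "m = max a (max b e)"
  have "(a + b + e) powr p \<le> (3 * m) powr p"
    using assms by (intro powr_mono2) (auto simp: m_def max_def)
  also have "\<dots> = 3 powr p * m powr p" using assms by (simp add: powr_mult m_def max_def)
  also have "m powr p \<le> a powr p + b powr p + e powr p" by (auto simp: m_def max_def)
  finally show ?thesis by simp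
qed

context musielak_kernel
begin

text \<open>As the operators form a semigroup, \<open>u R - u \<rho>\<close> is the difference of the operator at scale \<open>\<rho>\<close>
  applied to \<open>u R\<close> and the operator at scale \<open>R\<close> applied to \<open>u \<rho>\<close>.\<close>

definition commutes :: "(real \<Rightarrow> 'a \<Rightarrow> complex) \<Rightarrow> bool" where
  "commutes u \<longleftrightarrow> (\<forall>\<rho>>0. \<forall>R>0. AE x in \<mu>.
     ennreal (cmod (u R x - u \<rho> x)) \<le> ker \<rho> (\<tau> u R) x + ker R (\<tau> u \<rho>) x)"

text \<open>The integrand of the norm for the exponent \<open>p\<close>: the weight divides
  \<open>p\<close> times and multiplies once, which leaves the power \<open>1 - p\<close>.\<close>

definition F :: "(real \<Rightarrow> 'a \<Rightarrow> complex) \<Rightarrow> 'a \<Rightarrow> real \<Rightarrow> 'a \<Rightarrow> ennreal" where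
  "F u c R x = ennreal (cmod (u R x) powr p * \<phi> x (1 / L c R) powr (1 - p))"

lemma F_meas: "osc u K \<Longrightarrow> 0 < R \<Longrightarrow> F u c R \<in> borel_measurable \<mu>"
proof -
  assume a: "osc u K" "0 < R"
  have [measurable]: "(\<lambda>x. \<phi> x (1 / L c R)) \<in> borel_measurable \<mu>" "u R \<in> borel_measurable \<mu>"
    using L_pos[OF a(2), of c] by (auto intro!: \<phi>_meas oscD(1)[OF a])
  show ?thesis unfolding F_def by measurable
qed

definition C3 :: real where "C3 = Cu * CL * (2 * \<kappa>) powr \<theta>"

lemma C3_pos: "0 < C3"
  using Cu_ge_1 CL_ge_1 \<kappa>_ge_1 by (simp add: C3_def)

text \<open>As \<open>1 - p\<close> is negative, the parent's weight must be bounded below by that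
  of the stopping ball, which upper type 1 does. The stopping ball may stick out and have the larger
  norm; the factor \<open>b\<close> from \<open>L_growth\<close> brings the ratio of the norms to at
  least 1.\<close>

lemma weight_change:
  assumes sub: "B y \<rho> \<subseteq> B c (2 * \<kappa> * R)" and \<rho>: "0 < \<rho>" and R: "0 < R"
  shows "\<phi> x (1 / L c R) powr (1 - p) \<le> (C3 * L c R / L y \<rho>) powr (p - 1) * \<phi> x (1 / L y \<rho>) powr (1 - p)"
proof -
  have k2: "1 \<le> 2 * \<kappa>" and kR: "0 < 2 * \<kappa> * R" using \<kappa>_ge_1 R by auto
  define b where "b = CL * (2 * \<kappa>) powr \<theta>"
  have b: "1 \<le> b" using mult_mono[OF CL_ge_1 powr_\<theta>_ge_1[OF k2]] CL_ge_1 by (simp add: b_def)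
  have Lp: "0 < L y \<rho>" "0 < L c R" using L_pos \<rho> R by auto
  have "L y \<rho> \<le> L c (2 * \<kappa> * R)" by (rule L_mono[OF sub \<rho> kR])
  also have "\<dots> \<le> b * L c R" unfolding b_def by (rule L_growth[OF R k2])
  finally have s: "1 \<le> b * L c R / L y \<rho>" using Lp by simp
  have pos: "0 < \<phi> x (1 / L y \<rho>)" "0 < \<phi> x (1 / L c R)" using \<phi>_pos Lp by auto
  have "\<phi> x (1 / L y \<rho>) = \<phi> x (b * L c R / L y \<rho> * (1 / (b * L c R)))" using Lp b by simp
  also have "\<dots> \<le> Cu * (b * L c R / L y \<rho>) * \<phi> x (1 / (b * L c R))"
    using s Lp b by (intro upper) auto
  also have "\<dots> \<le> Cu * (b * L c R / L y \<rho>) * \<phi> x (1 / L c R)"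
    using s Lp b Cu_ge_1 by (intro mult_left_mono \<phi>_mono) (auto simp: field_simps)
  also have "Cu * (b * L c R / L y \<rho>) = C3 * L c R / L y \<rho>" by (simp add: C3_def b_def)
  finally have "\<phi> x (1 / L y \<rho>) / (C3 * L c R / L y \<rho>) \<le> \<phi> x (1 / L c R)"
    using C3_pos Lp by (simp add: field_simps)
  then have "\<phi> x (1 / L c R) powr (1 - p) \<le> (\<phi> x (1 / L y \<rho>) / (C3 * L c R / L y \<rho>)) powr (1 - p)"
    using pos C3_pos Lp p_gt_1 by (intro powr_mono2') auto
  also have "\<dots> = (C3 * L c R / L y \<rho>) powr (p - 1) * \<phi> x (1 / L y \<rho>) powr (1 - p)"
    using pos C3_pos Lp by (subst powr_divide) (auto simp: powr_minus_divide[symmetric] divide_powr_uminus)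
  finally show ?thesis .
qed

text \<open>The summands come from the points off the stopping balls and from the operators at the
  small and the large scale, that is from \<open>f1\<close>, \<open>f3\<close> and \<open>f4\<close>
  in \<open>level_step\<close>. The inherited bound gets the factor \<open>C2 / l\<close>
  instead.\<close>

definition C1 :: "real \<Rightarrow> real" where
  "C1 l = (CG * l) powr p * (2 * Cu) + 3 powr p * Cp * (CA * l) powr p * (CW / l) +
     3 powr p * CB powr p * Cp * (2 * Cu) powr (p - 1)"

definition C2 :: real where
  "C2 = 3 powr p * C3 powr (p - 1) * (2 * Cu\<^sup>2 * CL * (2 * \<kappa>) powr \<theta>) * CW"

lemma C1_nonneg: "1 \<le> l \<Longrightarrow> 0 \<le> C1 l"
  using Cp_pos Cu_ge_1 Cst_pos CL_ge_1 Cw_ge_1 by (simp add: C1_def CW_def)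

lemma C2_pos: "0 < C2"
  using Cu_ge_1 Cst_pos CL_ge_1 Cw_ge_1 C3_pos \<kappa>_ge_1 by (simp add: C2_def CW_def)

lemmas dual_weight' = dual_weight[unfolded Wpow_def]

text \<open>\<open>E\<close> is what is left over after finitely many generations of stopping balls, on which nothing is
  known yet.\<close>

definition level :: "real \<Rightarrow> (real \<Rightarrow> 'a \<Rightarrow> complex) \<Rightarrow> real \<Rightarrow> real \<Rightarrow> 'a \<Rightarrow> real \<Rightarrow> bool" where
  "level A u K \<eta> c R \<longleftrightarrow> (\<exists>E\<in>sets \<mu>. emeasure \<mu> E \<le> ennreal (\<eta> * V c R) \<and>
     (\<integral>\<^sup>+x. F u c R x * indicator (B c R - E) x \<partial>\<mu>) \<le> ennreal (A * (K * L c R) powr p))"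

text \<open>Inside a stopping ball \<open>u R\<close> is the oscillation of that ball plus two
  operator terms. After the change of weight the inherited bound is linear in the norm of the
  stopping ball, \<open>LW\<close> passes to its weight, and the total weight supplies the factor
  \<open>1 / l\<close>.\<close>

lemma level_step:
  assumes u: "osc u K" and comm: "commutes u" and A: "0 \<le> A" and \<eta>: "0 \<le> \<eta>"
    and IH: "\<And>c R. 0 < R \<Longrightarrow> level A u K \<eta> c R" and R: "0 < R" and l: "1 \<le> l"
  shows "level (C1 l + C2 / l * A) u K (\<eta> * (CV * l powr (- 1 / q))) c R"
proof -
  have K: "0 < K" using oscD(2)[OF u] .
  have L0: "0 < L c R" using L_pos[OF R] .
  have k2: "1 \<le> 2 * \<kappa>" and kR: "0 < 2 * \<kappa> * R" using \<kappa>_ge_1 R by auto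
  define w where "w = 1 / L c R"
  have w: "0 < w" using L0 by (simp add: w_def)
  have wpos: "0 < \<phi> x w" for x using \<phi>_pos w by simp
  have [measurable]: "(\<lambda>x. \<phi> x w) \<in> borel_measurable \<mu>" using w by (intro \<phi>_meas) auto
  have p0: "0 < p" using p_gt_1 by simp
  define Q where "Q = (K * L c R) powr p"
  have Q: "0 \<le> Q" by (simp add: Q_def)
  obtain y :: "nat \<Rightarrow> 'a" and \<rho> J where
    y: "\<And>j. j \<in> J \<Longrightarrow> y j \<in> B c R \<and> 0 < \<rho> j \<and> \<rho> j \<le> R" and
    ok: "\<And>j s. j \<in> J \<Longrightarrow> \<rho> j \<le> s \<Longrightarrow> s \<le> R / (4 * \<kappa>) \<Longrightarrow> \<not> bad u K l c R (y j) s" and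
    sw: "(\<Sum>j. indicator J j * emeasure (\<nu> (1 / L c R)) (B (y j) (\<rho> j))) \<le> ennreal (CW / l)" and
    sm: "(\<Sum>j. indicator J j * emeasure \<mu> (B (y j) (\<rho> j))) \<le> ennreal (CV * l powr (- 1 / q) * V c R)" and
    off: "AE x in \<mu>. x \<in> B c R \<longrightarrow> x \<notin> (\<Union>j\<in>J. B (y j) (\<rho> j)) \<longrightarrow>
       cmod (u R x) \<le> CG * l * K * L c R * \<phi> x (1 / L c R)"
    by (rule stopping_balls[OF u R l, of c], rule that)
  have sub: "B (y j) (\<rho> j) \<subseteq> B c (2 * \<kappa> * R)" if "j \<in> J" for j
    using y[OF that] \<kappa>_ge_1 by (intro ball_subset[of _ _ R]) (auto simp: algebra_simps)
  define P where "P j = B (y j) (\<rho> j)" for j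
  define Wj where "Wj j = W w (y j) (\<rho> j)" for j
  define Vj where "Vj j = V (y j) (\<rho> j)" for j
  define Lj where "Lj j = L (y j) (\<rho> j)" for j
  have pos: "0 < Wj j" "0 < Vj j" "0 < Lj j" if "j \<in> J" for j
    using y[OF that] W_pos[OF w] V_pos L_pos by (auto simp: Wj_def Vj_def Lj_def)
  have LW: "Lj j \<le> 2 * Cu\<^sup>2 * CL * (2 * \<kappa>) powr \<theta> * L c R * Wj j" if "j \<in> J" for j
    unfolding Lj_def Wj_def w_def using sub[OF that] y[OF that] R k2
    by (intro L_subball_dilated) auto
  have sW: "(\<Sum>j. indicator J j * ennreal (Wj j)) \<le> ennreal (CW / l)"
  proof -
    have "(\<Sum>j. indicator J j * ennreal (Wj j)) = (\<Sum>j. indicator J j * emeasure (\<nu> w) (P j))"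
      using y w by (intro suminf_cong) (auto simp: P_def Wj_def emeasure_\<nu>_B split: split_indicator)
    then show ?thesis using sw by (simp add: P_def w_def)
  qed
  have sumW: "(\<Sum>j. indicator J j * ennreal (a * Wj j)) \<le> ennreal (a * (CW / l))" if a: "0 \<le> a" for a
  proof -
    have "(\<Sum>j. indicator J j * ennreal (a * Wj j)) = (\<Sum>j. ennreal a * (indicator J j * ennreal (Wj j)))"
      using a pos(1) by (intro suminf_cong) (auto simp: ennreal_mult less_imp_le split: split_indicator)
    also have "\<dots> = ennreal a * (\<Sum>j. indicator J j * ennreal (Wj j))" by (simp add: ennreal_suminf_cmult)
    also have "\<dots> \<le> ennreal a * ennreal (CW / l)" by (intro mult_left_mono sW) auto
    also have "\<dots> = ennreal (a * (CW / l))"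
      using a l Cst_pos CL_ge_1 Cw_ge_1 by (intro ennreal_mult[symmetric]) (auto simp: CW_def)
    finally show ?thesis .
  qed
  have "\<forall>j\<in>J. \<exists>E. E \<in> sets \<mu> \<and> emeasure \<mu> E \<le> ennreal (\<eta> * Vj j) \<and>
     (\<integral>\<^sup>+x. F u (y j) (\<rho> j) x * indicator (P j - E) x \<partial>\<mu>) \<le> ennreal (A * (K * Lj j) powr p)"
    using IH y unfolding level_def P_def Vj_def Lj_def by blast
  then obtain E where E: "\<And>j. j \<in> J \<Longrightarrow> E j \<in> sets \<mu>" "\<And>j. j \<in> J \<Longrightarrow> emeasure \<mu> (E j) \<le> ennreal (\<eta> * Vj j)"
    "\<And>j. j \<in> J \<Longrightarrow> (\<integral>\<^sup>+x. F u (y j) (\<rho> j) x * indicator (P j - E j) x \<partial>\<mu>) \<le> ennreal (A * (K * Lj j) powr p)"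
    by metis
  define E' where "E' = (\<Union>j\<in>J. E j)"
  have E's: "E' \<in> sets \<mu>" unfolding E'_def using E(1) by (intro sets.countable_UN') auto
  have mE: "emeasure \<mu> E' \<le> ennreal (\<eta> * (CV * l powr (- 1 / q)) * V c R)"
  proof -
    have "emeasure \<mu> E' \<le> (\<Sum>j. indicator J j * emeasure \<mu> (E j))"
      by (rule emeasure_suminf_cover) (use E(1) in \<open>auto simp: E'_def\<close>)
    also have "\<dots> \<le> (\<Sum>j. ennreal \<eta> * (indicator J j * emeasure \<mu> (P j)))"
      using E(2) y \<eta> pos(2) by (intro suminf_le summableI)
        (auto simp: P_def Vj_def emeasure_B ennreal_mult less_imp_le split: split_indicator)
    also have "\<dots> = ennreal \<eta> * (\<Sum>j. indicator J j * emeasure \<mu> (P j))" by (simp add: ennreal_suminf_cmult)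
    also have "\<dots> \<le> ennreal \<eta> * ennreal (CV * l powr (- 1 / q) * V c R)"
      using sm by (intro mult_left_mono) (auto simp: P_def)
    also have "\<dots> = ennreal (\<eta> * (CV * l powr (- 1 / q)) * V c R)"
      using \<eta> Cd_ge_1 V_pos[OF R, of c] by (simp add: ennreal_mult[symmetric] CV_def mult.assoc)
    finally show ?thesis .
  qed
  have wc: "\<phi> x w powr (1 - p) \<le> (C3 * L c R / Lj j) powr (p - 1) * \<phi> x (1 / Lj j) powr (1 - p)"
    if "j \<in> J" for x j
    unfolding w_def Lj_def using y[OF that] sub[OF that] R by (intro weight_change) auto
  \<comment> \<open>\<open>f1\<close> serves the points off the stopping balls; \<open>f2\<close>,
    \<open>f3\<close>, \<open>f4\<close> are the inherited part, the small-scale term and the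
    large-scale term. The bound in \<open>f4\<close> is the same for all stopping balls, so it stays
    outside the series, whose balls may overlap.\<close>
  define f1 where "f1 x = ennreal ((CG * l * K * L c R) powr p) * (ennreal (\<phi> x w) * indicator (B c R) x)" for x
  define f2 where "f2 j x = indicator J j * (ennreal (3 powr p * (C3 * L c R / Lj j) powr (p - 1)) *
    (F u (y j) (\<rho> j) x * indicator (P j - E j) x))" for j :: nat and x
  define f3 where "f3 j x = indicator J j * (ennreal (3 powr p * (CA * l * K * L c R * Wj j / Vj j) powr p) *
    (ennreal (\<phi> x w powr (1 - p)) * indicator (P j) x))" for j :: nat and x
  define f4 where "f4 x = ennreal (3 powr p * (CB * K * L c R / V c R) powr p) *
    (ennreal (\<phi> x w powr (1 - p)) * indicator (B c R) x)" for x
  have meas: "f1 \<in> borel_measurable \<mu>" "f2 j \<in> borel_measurable \<mu>" "f3 j \<in> borel_measurable \<mu>"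
    "f4 \<in> borel_measurable \<mu>" for j
  proof -
    show "f1 \<in> borel_measurable \<mu>" "f3 j \<in> borel_measurable \<mu>" "f4 \<in> borel_measurable \<mu>"
      unfolding f1_def f3_def f4_def P_def by measurable
    show "f2 j \<in> borel_measurable \<mu>"
    proof (cases "j \<in> J")
      case True
      have [measurable]: "F u (y j) (\<rho> j) \<in> borel_measurable \<mu>" "E j \<in> sets \<mu>"
        using True y E by (auto intro: F_meas[OF u])
      show ?thesis unfolding f2_def P_def by measurable
    qed (simp add: f2_def[abs_def])
  qed
  note [measurable] = meas
  \<comment> \<open>\<open>commutes\<close> has one null set for each pair of scales; the stopping
    balls are countably many, so a common one exists.\<close>
  have "AE x in \<mu>. \<forall>j\<in>J. ennreal (cmod (u R x - u (\<rho> j) x)) \<le> ker (\<rho> j) (\<tau> u R) x + ker R (\<tau> u (\<rho> j)) x"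
    using comm y R unfolding commutes_def by (subst AE_ball_countable) auto
  then have ae: "AE x in \<mu>. F u c R x * indicator (B c R - E') x \<le> f1 x + (\<Sum>j. f2 j x) + (\<Sum>j. f3 j x) + f4 x"
    using off
  proof eventually_elim
    case (elim x)
    show ?case
    proof (cases "x \<in> B c R - E'")
      case x: True
      have Fx: "F u c R x = ennreal (cmod (u R x) powr p * \<phi> x w powr (1 - p))" by (simp add: F_def w_def)
      show ?thesis
      proof (cases "x \<in> (\<Union>j\<in>J. P j)")
        case False
        then have "cmod (u R x) \<le> CG * l * K * L c R * \<phi> x w" using elim(2) x by (simp add: P_def w_def)
        then have "cmod (u R x) powr p * \<phi> x w powr (1 - p) \<le>
            (CG * l * K * L c R * \<phi> x w) powr p * \<phi> x w powr (1 - p)"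
          using p0 by (intro mult_right_mono powr_mono2) auto
        also have "\<dots> = (CG * l * K * L c R) powr p * (\<phi> x w powr p * \<phi> x w powr (1 - p))"
          using Cw_ge_1 l K L0 wpos[of x] by (subst powr_mult) (auto simp: CG_def less_imp_le)
        also have "\<phi> x w powr p * \<phi> x w powr (1 - p) = \<phi> x w" using wpos[of x] by (simp add: powr_add[symmetric])
        finally have "F u c R x * indicator (B c R - E') x \<le> f1 x"
          using x wpos[of x] by (simp add: Fx f1_def ennreal_mult[symmetric] ennreal_leI less_imp_le)
        then show ?thesis by (simp add: add.assoc add_increasing2)
      next
        case True
        then obtain j where j: "j \<in> J" "x \<in> P j" by auto
        have xE: "x \<in> P j - E j" using x j by (auto simp: E'_def)
        note yj = y[OF j(1)]
        define a where "a = cmod (u (\<rho> j) x)"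
        define b where "b = CA * l * K * L c R * Wj j / Vj j"
        define e where "e = CB * K * L c R / V c R"
        have b: "0 \<le> b" using CA_pos l K L0 pos[OF j(1)] by (simp add: b_def)
        have e: "0 \<le> e" using CB_pos K L0 V_pos[OF R, of c] by (simp add: e_def)
        have "ennreal (cmod (u R x - u (\<rho> j) x)) \<le> ker (\<rho> j) (\<tau> u R) x + ker R (\<tau> u (\<rho> j)) x"
          using elim(1) j by auto
        also have "ker (\<rho> j) (\<tau> u R) x \<le> ennreal b"
          unfolding b_def Wj_def Vj_def w_def using yj j ok by (intro ker_small_ball[OF u]) (auto simp: l P_def)
        also have "ker R (\<tau> u (\<rho> j)) x \<le> ennreal e"
          unfolding e_def using yj x by (intro ker_large_ball[OF u]) auto
        finally have "cmod (u R x - u (\<rho> j) x) \<le> b + e"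
          using b e by (simp add: ennreal_plus[symmetric] add_left_mono del: ennreal_plus)
        then have "cmod (u R x) \<le> a + b + e"
          using norm_triangle_ineq2[of "u R x" "u (\<rho> j) x"] by (simp add: a_def)
        then have "cmod (u R x) powr p \<le> (a + b + e) powr p" using p0 by (intro powr_mono2) auto
        also have "\<dots> \<le> 3 powr p * (a powr p + b powr p + e powr p)"
          using b e p0 by (intro powr_add3_le) (auto simp: a_def)
        finally have "cmod (u R x) powr p * \<phi> x w powr (1 - p) \<le>
            3 powr p * (a powr p + b powr p + e powr p) * \<phi> x w powr (1 - p)"
          by (intro mult_right_mono) auto
        also have "\<dots> = 3 powr p * a powr p * \<phi> x w powr (1 - p) + 3 powr p * b powr p * \<phi> x w powr (1 - p)
            + 3 powr p * e powr p * \<phi> x w powr (1 - p)" by (simp add: algebra_simps)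
        also have "3 powr p * a powr p * \<phi> x w powr (1 - p) \<le>
            3 powr p * a powr p * ((C3 * L c R / Lj j) powr (p - 1) * \<phi> x (1 / Lj j) powr (1 - p))"
          by (intro mult_left_mono wc j) auto
        also have "\<dots> = 3 powr p * (C3 * L c R / Lj j) powr (p - 1) * (a powr p * \<phi> x (1 / Lj j) powr (1 - p))" by simp
        finally have "cmod (u R x) powr p * \<phi> x w powr (1 - p) \<le>
            3 powr p * (C3 * L c R / Lj j) powr (p - 1) * (a powr p * \<phi> x (1 / Lj j) powr (1 - p))
            + 3 powr p * b powr p * \<phi> x w powr (1 - p) + 3 powr p * e powr p * \<phi> x w powr (1 - p)"
          by simp
        then have "F u c R x \<le> ennreal (3 powr p * (C3 * L c R / Lj j) powr (p - 1) * (a powr p * \<phi> x (1 / Lj j) powr (1 - p))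
            + 3 powr p * b powr p * \<phi> x w powr (1 - p) + 3 powr p * e powr p * \<phi> x w powr (1 - p))"
          unfolding Fx by (rule ennreal_leI)
        also have "\<dots> = f2 j x + f3 j x + f4 x"
          using j xE x by (simp add: f2_def f3_def f4_def F_def ennreal_mult a_def Lj_def b_def e_def)
        also have "\<dots> \<le> (\<Sum>j. f2 j x) + (\<Sum>j. f3 j x) + f4 x"
        proof -
          have "h j \<le> suminf h" for h :: "nat \<Rightarrow> ennreal" using sum_le_suminf[of h "{j}"] by simp
          then show ?thesis by (intro add_mono) auto
        qed
        finally have "F u c R x * indicator (B c R - E') x \<le> (\<Sum>j. f2 j x) + (\<Sum>j. f3 j x) + f4 x"
          using x by simp
        then show ?thesis by (simp add: add.assoc add_increasing)
      qed
    qed simp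
  qed
  have I1: "(\<integral>\<^sup>+x. f1 x \<partial>\<mu>) \<le> ennreal ((CG * l) powr p * (2 * Cu) * Q)"
  proof -
    have "(\<integral>\<^sup>+x. f1 x \<partial>\<mu>) = ennreal ((CG * l * K * L c R) powr p) * emeasure (\<nu> w) (B c R)"
      unfolding f1_def \<nu>_def by (simp add: nn_integral_cmult emeasure_density)
    also have "\<dots> = ennreal ((CG * l * K * L c R) powr p * W w c R)"
      using w R W_pos[OF w R, of c] by (simp add: emeasure_\<nu>_B ennreal_mult)
    also have "\<dots> \<le> ennreal ((CG * l * K * L c R) powr p * (2 * Cu))"
      using W_L_le[OF R, of c] by (intro ennreal_leI mult_left_mono) (auto simp: w_def)
    also have "(CG * l * K * L c R) powr p = (CG * l) powr p * Q"
      unfolding Q_def using Cw_ge_1 l K L0 by (subst powr_mult[symmetric]) (auto simp: CG_def mult.assoc)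
    finally show ?thesis by (simp add: mult_ac)
  qed
  have I2: "(\<integral>\<^sup>+x. (\<Sum>j. f2 j x) \<partial>\<mu>) \<le> ennreal (C2 / l * A * Q)"
  proof -
    define a where "a = 3 powr p * C3 powr (p - 1) * (2 * Cu\<^sup>2 * CL * (2 * \<kappa>) powr \<theta>) * A * Q"
    have a: "0 \<le> a" using A CL_ge_1 Q by (simp add: a_def)
    have "(\<integral>\<^sup>+x. (\<Sum>j. f2 j x) \<partial>\<mu>) = (\<Sum>j. \<integral>\<^sup>+x. f2 j x \<partial>\<mu>)" by (rule nn_integral_suminf) simp
    also have "\<dots> \<le> (\<Sum>j. indicator J j * ennreal (a * Wj j))"
    proof (intro suminf_le summableI)
      fix j show "(\<integral>\<^sup>+x. f2 j x \<partial>\<mu>) \<le> indicator J j * ennreal (a * Wj j)"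
      proof (cases "j \<in> J")
        case True
        note pj = pos[OF True]
        have [measurable]: "F u (y j) (\<rho> j) \<in> borel_measurable \<mu>" "E j \<in> sets \<mu>" "P j \<in> sets \<mu>"
          using True y E by (auto intro: F_meas[OF u] simp: P_def)
        have "(\<integral>\<^sup>+x. f2 j x \<partial>\<mu>) = ennreal (3 powr p * (C3 * L c R / Lj j) powr (p - 1)) *
            (\<integral>\<^sup>+x. F u (y j) (\<rho> j) x * indicator (P j - E j) x \<partial>\<mu>)"
          unfolding f2_def using True by (simp add: nn_integral_cmult)
        also have "\<dots> \<le> ennreal (3 powr p * (C3 * L c R / Lj j) powr (p - 1)) * ennreal (A * (K * Lj j) powr p)"
          by (intro mult_left_mono E(3) True) auto
        also have "\<dots> = ennreal (3 powr p * (C3 * L c R / Lj j) powr (p - 1) * (A * (K * Lj j) powr p))"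
          using A by (intro ennreal_mult[symmetric]) auto
        also have "3 powr p * (C3 * L c R / Lj j) powr (p - 1) * (A * (K * Lj j) powr p) =
            3 powr p * C3 powr (p - 1) * A * (K powr p * L c R powr (p - 1)) * Lj j"
          using C3_pos L0 pj K by (simp add: powr_mult powr_divide powr_diff)
        also have "\<dots> \<le> 3 powr p * C3 powr (p - 1) * A * (K powr p * L c R powr (p - 1)) *
            (2 * Cu\<^sup>2 * CL * (2 * \<kappa>) powr \<theta> * L c R * Wj j)"
          using A by (intro mult_left_mono LW True) auto
        also have "\<dots> = a * Wj j" using L0 K by (simp add: a_def Q_def powr_mult powr_diff)
        finally show ?thesis using True by (simp add: ennreal_leI)
      qed (simp add: f2_def)
    qed
    also have "\<dots> \<le> ennreal (a * (CW / l))" by (rule sumW[OF a])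
    also have "a * (CW / l) = C2 / l * A * Q" by (simp add: a_def C2_def)
    finally show ?thesis .
  qed
  have I3: "(\<integral>\<^sup>+x. (\<Sum>j. f3 j x) \<partial>\<mu>) \<le> ennreal (3 powr p * Cp * (CA * l) powr p * (CW / l) * Q)"
  proof -
    define a where "a = 3 powr p * Cp * (CA * l) powr p * Q"
    have a: "0 \<le> a" using Cp_pos Q by (simp add: a_def)
    have "(\<integral>\<^sup>+x. (\<Sum>j. f3 j x) \<partial>\<mu>) = (\<Sum>j. \<integral>\<^sup>+x. f3 j x \<partial>\<mu>)" by (rule nn_integral_suminf) simp
    also have "\<dots> \<le> (\<Sum>j. indicator J j * ennreal (a * Wj j))"
    proof (intro suminf_le summableI)
      fix j show "(\<integral>\<^sup>+x. f3 j x \<partial>\<mu>) \<le> indicator J j * ennreal (a * Wj j)"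
      proof (cases "j \<in> J")
        case True
        note pj = pos[OF True]
        define X where "X = 3 powr p * (CA * l * K * L c R * Wj j / Vj j) powr p"
        have "(\<integral>\<^sup>+x. f3 j x \<partial>\<mu>) = ennreal X *
            (\<integral>\<^sup>+x. ennreal (\<phi> x w powr (1 - p)) * indicator (P j) x \<partial>\<mu>)"
          unfolding f3_def X_def using True by (simp add: nn_integral_cmult P_def)
        also have "\<dots> \<le> ennreal X * ennreal (Cp * Vj j powr p * Wj j powr (1 - p))"
          unfolding P_def Vj_def Wj_def using y[OF True] w by (intro mult_left_mono dual_weight') auto
        also have "\<dots> = ennreal (X * (Cp * Vj j powr p * Wj j powr (1 - p)))"
          using Cp_pos by (intro ennreal_mult[symmetric]) (auto simp: X_def)
        \<comment> \<open>The volumes cancel and the weight remains to the first power, ready for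
          \<open>sumW\<close>.\<close>
        also have "X * (Cp * Vj j powr p * Wj j powr (1 - p)) = a * (Wj j powr p * Wj j powr (1 - p))"
        proof -
          have "CA * l * K * L c R * Wj j / Vj j = (CA * l) * (K * L c R) * Wj j / Vj j" by simp
          also have "\<dots> powr p = (CA * l) powr p * Q * Wj j powr p / Vj j powr p"
            using CA_pos l K L0 pj by (subst powr_divide powr_mult; simp add: Q_def)+
          finally have "X = 3 powr p * ((CA * l) powr p * Q * Wj j powr p / Vj j powr p)" by (simp add: X_def)
          then show ?thesis using pj by (simp add: a_def)
        qed
        also have "Wj j powr p * Wj j powr (1 - p) = Wj j" using pj by (simp add: powr_add[symmetric])
        finally show ?thesis using True by simp
      qed (simp add: f3_def)
    qed
    also have "\<dots> \<le> ennreal (a * (CW / l))" by (rule sumW[OF a])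
    also have "a * (CW / l) = 3 powr p * Cp * (CA * l) powr p * (CW / l) * Q" by (simp add: a_def)
    finally show ?thesis .
  qed
  have I4: "(\<integral>\<^sup>+x. f4 x \<partial>\<mu>) \<le> ennreal (3 powr p * CB powr p * Cp * (2 * Cu) powr (p - 1) * Q)"
  proof -
    have Vp: "0 < V c R" using V_pos[OF R] .
    define X where "X = 3 powr p * (CB * K * L c R / V c R) powr p"
    have "(\<integral>\<^sup>+x. f4 x \<partial>\<mu>) = ennreal X * (\<integral>\<^sup>+x. ennreal (\<phi> x w powr (1 - p)) * indicator (B c R) x \<partial>\<mu>)"
      unfolding f4_def X_def by (simp add: nn_integral_cmult)
    also have "\<dots> \<le> ennreal X * ennreal (Cp * V c R powr p * W w c R powr (1 - p))"
      using R w by (intro mult_left_mono dual_weight') auto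
    also have "\<dots> = ennreal (X * (Cp * V c R powr p * W w c R powr (1 - p)))"
      using Cp_pos by (intro ennreal_mult[symmetric]) (auto simp: X_def)
    also have "\<dots> \<le> ennreal (3 powr p * CB powr p * Cp * (2 * Cu) powr (p - 1) * Q)"
    proof (rule ennreal_leI)
      \<comment> \<open>The exponent is negative, so the lower bound on the weight of the ball is
        the one required.\<close>
      have "W w c R powr (1 - p) \<le> (1 / (2 * Cu)) powr (1 - p)"
        using W_L_ge[OF R, of c] Cu_ge_1 p_gt_1 by (intro powr_mono2') (auto simp: w_def)
      also have "\<dots> = (2 * Cu) powr (p - 1)"
        using Cu_ge_1 powr_minus_divide[of "2 * Cu" "1 - p"] by (simp add: powr_divide)
      finally have "X * (Cp * V c R powr p * W w c R powr (1 - p)) \<le> X * (Cp * V c R powr p * (2 * Cu) powr (p - 1))"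
        using Cp_pos by (intro mult_left_mono) (auto simp: X_def)
      also have "\<dots> = 3 powr p * CB powr p * Cp * (2 * Cu) powr (p - 1) * Q"
        using CB_pos K L0 Vp unfolding X_def by (simp add: powr_divide powr_mult Q_def)
      finally show "X * (Cp * V c R powr p * W w c R powr (1 - p)) \<le> 3 powr p * CB powr p * Cp * (2 * Cu) powr (p - 1) * Q" .
    qed
    finally show ?thesis .
  qed
  have "(\<integral>\<^sup>+x. F u c R x * indicator (B c R - E') x \<partial>\<mu>) \<le>
      (\<integral>\<^sup>+x. f1 x + (\<Sum>j. f2 j x) + (\<Sum>j. f3 j x) + f4 x \<partial>\<mu>)"
    by (rule nn_integral_mono_AE[OF ae])
  also have "\<dots> = (\<integral>\<^sup>+x. f1 x \<partial>\<mu>) + (\<integral>\<^sup>+x. (\<Sum>j. f2 j x) \<partial>\<mu>) + (\<integral>\<^sup>+x. (\<Sum>j. f3 j x) \<partial>\<mu>) + (\<integral>\<^sup>+x. f4 x \<partial>\<mu>)"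
    by (simp add: nn_integral_add)
  also have "\<dots> \<le> ennreal ((CG * l) powr p * (2 * Cu) * Q) + ennreal (C2 / l * A * Q) +
      ennreal (3 powr p * Cp * (CA * l) powr p * (CW / l) * Q) + ennreal (3 powr p * CB powr p * Cp * (2 * Cu) powr (p - 1) * Q)"
    by (intro add_mono I1 I2 I3 I4)
  also have "\<dots> = ennreal ((CG * l) powr p * (2 * Cu) * Q + C2 / l * A * Q +
      3 powr p * Cp * (CA * l) powr p * (CW / l) * Q + 3 powr p * CB powr p * Cp * (2 * Cu) powr (p - 1) * Q)"
    using Q Cu_ge_1 C2_pos A l Cp_pos Cst_pos CL_ge_1 Cw_ge_1 by (simp add: ennreal_plus CW_def)
  also have "(CG * l) powr p * (2 * Cu) * Q + C2 / l * A * Q +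
      3 powr p * Cp * (CA * l) powr p * (CW / l) * Q + 3 powr p * CB powr p * Cp * (2 * Cu) powr (p - 1) * Q
      = (C1 l + C2 / l * A) * Q" by (simp add: C1_def algebra_simps)
  finally show ?thesis using E's mE unfolding level_def Q_def by blast
qed

text \<open>For suitable \<open>l\<close> the coefficient \<open>A = 2 * C1 l\<close> reproduces
  itself under \<open>level_step\<close>, while the bound on the leftover set halves. The leftover
  sets then vanish almost everywhere, and Fatou's lemma gives the integral over the whole
  ball.\<close>

theorem john_nirenberg:
  "\<exists>A\<ge>0. \<forall>u K c R. osc u K \<longrightarrow> commutes u \<longrightarrow> 0 < R \<longrightarrow>
     (\<integral>\<^sup>+x. F u c R x * indicator (B c R) x \<partial>\<mu>) \<le> ennreal (A * (K * L c R) powr p)"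
proof -
  \<comment> \<open>The maxima make both \<open>C2 / l\<close> and
    \<open>CV * l powr (- 1 / q)\<close> at most 1/2.\<close>
  define l where "l = max 1 (max (2 * C2) ((2 * CV) powr q))"
  have q0: "0 < q" using q_ge_1 by simp
  have l: "1 \<le> l" "2 * C2 \<le> l" "(2 * CV) powr q \<le> l" by (auto simp: l_def)
  have CV0: "0 \<le> CV" using Cd_ge_1 by (simp add: CV_def)
  have "2 * CV = ((2 * CV) powr q) powr (1 / q)" using CV0 q0 by (simp add: powr_powr)
  also have "\<dots> \<le> l powr (1 / q)" using l q0 by (intro powr_mono2) auto
  finally have lV: "CV * l powr (- 1 / q) \<le> 1 / 2"
    using l by (simp add: powr_minus_divide field_simps)
  have lC: "C2 / l \<le> 1 / 2" using l by (simp add: field_simps)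
  define A where "A = 2 * C1 l"
  have A: "0 \<le> A" using C1_nonneg[OF l(1)] by (simp add: A_def)
  have "(\<integral>\<^sup>+x. F u c R x * indicator (B c R) x \<partial>\<mu>) \<le> ennreal (A * (K * L c R) powr p)"
    if u: "osc u K" "commutes u" and R: "0 < R" for u K c R
  proof -
    have lev: "0 < R \<Longrightarrow> level A u K ((1 / 2) ^ k) c R" for k c R
    proof (induction k arbitrary: c R)
      case 0
      \<comment> \<open>With the whole ball left over, the restricted integral is 0; this starts the
        iteration without knowing that \<open>F u c R\<close> is integrable.\<close>
      then show ?case using A by (auto simp: level_def emeasure_B intro!: bexI[of _ "B c R"])
    next
      case (Suc k)
      have "level (C1 l + C2 / l * A) u K ((1 / 2) ^ k * (CV * l powr (- 1 / q))) c R"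
        using Suc by (intro level_step[OF u A]) (auto simp: l)
      then obtain E where E: "E \<in> sets \<mu>" "emeasure \<mu> E \<le> ennreal ((1 / 2) ^ k * (CV * l powr (- 1 / q)) * V c R)"
        "(\<integral>\<^sup>+x. F u c R x * indicator (B c R - E) x \<partial>\<mu>) \<le> ennreal ((C1 l + C2 / l * A) * (K * L c R) powr p)"
        unfolding level_def by blast
      have "(1 / 2) ^ k * (CV * l powr (- 1 / q)) * V c R \<le> (1 / 2) ^ k * (1 / 2) * V c R"
        using lV V_pos[OF Suc.prems, of c] by (intro mult_right_mono mult_left_mono) auto
      also have "(1 / 2) ^ k * (1 / 2) * V c R = (1 / 2) ^ Suc k * V c R" by simp
      finally have "emeasure \<mu> E \<le> ennreal ((1 / 2) ^ Suc k * V c R)"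
        by (rule order_trans[OF E(2) ennreal_leI])
      moreover have "C1 l + C2 / l * A \<le> A"
        using mult_right_mono[OF lC A] by (simp add: A_def)
      then have "(C1 l + C2 / l * A) * (K * L c R) powr p \<le> A * (K * L c R) powr p"
        by (intro mult_right_mono) auto
      then have "(\<integral>\<^sup>+x. F u c R x * indicator (B c R - E) x \<partial>\<mu>) \<le> ennreal (A * (K * L c R) powr p)"
        by (rule order_trans[OF E(3) ennreal_leI])
      ultimately show ?case using E(1) unfolding level_def by blast
    qed
    have "\<forall>k. \<exists>E\<in>sets \<mu>. emeasure \<mu> E \<le> ennreal ((1 / 2) ^ k * V c R) \<and>
       (\<integral>\<^sup>+x. F u c R x * indicator (B c R - E) x \<partial>\<mu>) \<le> ennreal (A * (K * L c R) powr p)"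
      using lev[OF R] unfolding level_def by blast
    then obtain E where E [measurable]: "\<And>k. E k \<in> sets \<mu>"
      and Em: "\<And>k. emeasure \<mu> (E k) \<le> ennreal ((1 / 2) ^ k * V c R)"
      and EF: "\<And>k. (\<integral>\<^sup>+x. F u c R x * indicator (B c R - E k) x \<partial>\<mu>) \<le> ennreal (A * (K * L c R) powr p)"
      by metis
    have Vp: "0 < V c R" using V_pos[OF R] .
    have [measurable]: "F u c R \<in> borel_measurable \<mu>" by (rule F_meas[OF u(1) R])
    have fin: "emeasure \<mu> (E k) < \<infinity>" for k using Em[of k] by (metis ennreal_less_top infinity_ennreal_def order_le_less_trans)
    have mle: "measure \<mu> (E k) \<le> (1 / 2) ^ k * V c R" for k
      using Em[of k] Vp by (simp add: measure_def enn2real_leI)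
    have "summable (\<lambda>k. measure \<mu> (E k))"
      by (rule summable_comparison_test'[of "\<lambda>k. (1 / 2) ^ k * V c R" 0])
         (use mle in \<open>auto intro!: summable_mult2 summable_geometric\<close>)
    \<comment> \<open>By Borel-Cantelli almost every point lies in only finitely many
      \<open>E k\<close>.\<close>
    then have ev: "AE x in \<mu>. eventually (\<lambda>k. x \<in> space \<mu> - E k) sequentially"
      by (intro borel_cantelli_AE1) (use fin in auto)
    have "(\<integral>\<^sup>+x. F u c R x * indicator (B c R) x \<partial>\<mu>) \<le>
        (\<integral>\<^sup>+x. liminf (\<lambda>k. F u c R x * indicator (B c R - E k) x) \<partial>\<mu>)"
    proof (rule nn_integral_mono_AE, use ev in eventually_elim)
      case (elim x)
      then have "\<forall>\<^sub>F k in sequentially. F u c R x * indicator (B c R) x \<le> F u c R x * indicator (B c R - E k) x"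
        by (elim eventually_mono) (auto split: split_indicator)
      then show ?case by (rule Liminf_bounded)
    qed
    also have "\<dots> \<le> liminf (\<lambda>k. \<integral>\<^sup>+x. F u c R x * indicator (B c R - E k) x \<partial>\<mu>)"
      by (rule nn_integral_liminf) measurable
    also have "\<dots> \<le> limsup (\<lambda>k. \<integral>\<^sup>+x. F u c R x * indicator (B c R - E k) x \<partial>\<mu>)"
      by (rule Liminf_le_Limsup) simp
    also have "\<dots> \<le> ennreal (A * (K * L c R) powr p)"
      by (rule Limsup_bounded) (use EF in auto)
    finally show ?thesis .
  qed
  then show ?thesis using A by blast
qed

end

section \<open>Degrees, indices and approximations to the identity\<close>

lemma homogeneous_type_imp_quasi_metric_measure:
  assumes "homogeneous_type d \<mu>"
  shows "\<exists>\<kappa>. quasi_metric_measure d \<mu> \<kappa>"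
proof -
  obtain \<kappa> where \<kappa>: "1 \<le> \<kappa>" "\<And>x y z. d x y \<le> \<kappa> * (d x z + d z y)"
    using assms by (auto simp: homogeneous_type_def quasi_metric_def)
  obtain C2 :: real where C2: "1 \<le> C2" "\<And>x r. 0 < r \<Longrightarrow> ennreal C2 * emeasure \<mu> (qball d x r) < \<infinity>"
    using assms by (auto simp: homogeneous_type_def)
  have "emeasure \<mu> (qball d x r) < \<infinity>" if "0 < r" for x r
  proof -
    have "1 * emeasure \<mu> (qball d x r) \<le> ennreal C2 * emeasure \<mu> (qball d x r)"
      using C2(1) by (intro mult_right_mono) auto
    then show ?thesis using C2(2)[OF that, of x] by (auto intro: le_less_trans)
  qed
  then have "quasi_metric_measure d \<mu> \<kappa>"
    using assms \<kappa> by unfold_locales (auto simp: homogeneous_type_def quasi_metric_def)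
  then show ?thesis by blast
qed

text \<open>Doubling is iterated along powers of 2. Without an admissible exponent the infimum
  \<open>deg_n0\<close> would be an unspecified number.\<close>

lemma cond_D_exists:
  assumes "homogeneous_type d \<mu>"
  shows "\<exists>n. cond_D d \<mu> n"
proof -
  obtain \<kappa> where "quasi_metric_measure d \<mu> \<kappa>"
    using homogeneous_type_imp_quasi_metric_measure[OF assms] by blast
  then interpret quasi_metric_measure d \<mu> \<kappa> .
  obtain C2 :: real where C2: "1 \<le> C2"
    "\<And>x r. 0 < r \<Longrightarrow> emeasure \<mu> (B x (2 * r)) \<le> ennreal C2 * emeasure \<mu> (B x r)"
    using assms by (auto simp: homogeneous_type_def)
  have em: "emeasure \<mu> (B x r) = ennreal (measure \<mu> (B x r))" if "0 < r" for x r
    using ball_finite[OF that, of x] by (simp add: emeasure_eq_ennreal_measure less_top[symmetric])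
  have d2: "measure \<mu> (B x (2 * r)) \<le> C2 * measure \<mu> (B x r)" if r: "0 < r" for x r
    using C2(2)[OF r, of x] C2(1) r em[OF r, of x] em[of "2 * r" x]
    by (simp add: ennreal_mult[symmetric])
  have dk: "measure \<mu> (B x (2 ^ k * r)) \<le> C2 ^ k * measure \<mu> (B x r)" if r: "0 < r" for x r k
  proof (induction k)
    case (Suc k)
    have "measure \<mu> (B x (2 * (2 ^ k * r))) \<le> C2 * measure \<mu> (B x (2 ^ k * r))"
      using r by (intro d2) auto
    also have "\<dots> \<le> C2 * (C2 ^ k * measure \<mu> (B x r))" using Suc C2(1) by (intro mult_left_mono) auto
    finally show ?case by (simp add: mult_ac)
  qed simp
  \<comment> \<open>The additional 1 makes the exponent positive even if \<open>C2 = 1\<close>, as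
    \<open>cond_D\<close> demands.\<close>
  define n where "n = log 2 C2 + 1"
  have n: "1 \<le> n" using C2(1) by (simp add: n_def)
  have "measure \<mu> (B x (l * r)) \<le> 2 powr n * l powr n * measure \<mu> (B x r)" if r: "0 < r" and l: "1 \<le> l" for x r l
  proof -
    define k where "k = nat \<lceil>log 2 l\<rceil>"
    have l0: "0 \<le> log 2 l" using l by simp
    then have k: "log 2 l \<le> k" "k \<le> log 2 l + 1" by (simp_all add: k_def)
    have "l = 2 powr log 2 l" using l by simp
    also have "\<dots> \<le> 2 powr k" using k by (intro powr_mono) auto
    finally have lk: "l \<le> 2 ^ k" by (simp add: powr_realpow)
    have "measure \<mu> (B x (l * r)) \<le> measure \<mu> (B x (2 ^ k * r))"
    proof (rule measure_mono_fmeasurable)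
      show "B x (l * r) \<subseteq> B x (2 ^ k * r)" using lk r by (intro B_mono mult_right_mono) auto
      show "B x (2 ^ k * r) \<in> fmeasurable \<mu>" using ball_finite[of "2 ^ k * r" x] r by (simp add: fmeasurable_def)
    qed simp
    also have "\<dots> \<le> C2 ^ k * measure \<mu> (B x r)" by (rule dk[OF r])
    also have "C2 ^ k = (2 powr k) powr (log 2 C2)"
    proof -
      have "C2 ^ k = (2 powr log 2 C2) powr k" using C2(1) by (simp add: powr_realpow)
      then show ?thesis by (simp add: powr_powr mult.commute)
    qed
    also have "\<dots> \<le> (2 * l) powr (log 2 C2)"
    proof (rule powr_mono2)
      have "2 powr k \<le> 2 powr (log 2 l + 1)" using k by (intro powr_mono) auto
      then show "2 powr real k \<le> 2 * l" using l by (simp add: powr_add)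
    qed (use C2(1) in auto)
    also have "\<dots> \<le> (2 * l) powr n" using l by (intro powr_mono) (auto simp: n_def)
    finally show ?thesis using l by (simp add: powr_mult mult_right_mono)
  qed
  then show ?thesis using n unfolding cond_D_def by (intro exI[of _ n]) auto
qed

lemma deg_n0_less:
  assumes "homogeneous_type d \<mu>" "deg_n0 d \<mu> < c"
  obtains n where "cond_D d \<mu> n" "n < c"
  using cInf_lessD[of "{n. cond_D d \<mu> n}" c] cond_D_exists[OF assms(1)] assms(2)
  by (auto simp: deg_n0_def)

lemma deg_n0_nonneg: "homogeneous_type d \<mu> \<Longrightarrow> 0 \<le> deg_n0 d \<mu>"
  unfolding deg_n0_def using cond_D_exists
  by (intro cInf_greatest) (auto simp: cond_D_def less_imp_le)

text \<open>By the definition of \<open>cond_R\<close> every admissible exponent there is at most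
  every one of \<open>cond_D\<close>. The exponent 0 shows that the supremum is over a nonempty
  set.\<close>

lemma deg_alpha0_le:
  assumes "homogeneous_type d \<mu>"
  shows "deg_alpha0 d \<mu> \<le> deg_n0 d \<mu>"
proof -
  obtain \<kappa> where "quasi_metric_measure d \<mu> \<kappa>"
    using homogeneous_type_imp_quasi_metric_measure[OF assms] by blast
  then interpret quasi_metric_measure d \<mu> \<kappa> .
  have "measure \<mu> (B x r) \<le> measure \<mu> (B x (l * r))" if "0 < r" "1 \<le> l" for x r l
  proof (rule measure_mono_fmeasurable)
    have "0 < l * r" using that by simp
    then show "B x (l * r) \<in> fmeasurable \<mu>" using ball_finite[of "l * r" x] by (simp add: fmeasurable_def)
    show "B x r \<subseteq> B x (l * r)" using that by (intro B_mono) (simp add: mult_le_cancel_right1)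
  qed simp
  then have "cond_R d \<mu> 0" by (auto simp: cond_R_def cond_D_def intro!: exI[of _ 1])
  then have ne: "{\<alpha>. cond_R d \<mu> \<alpha>} \<noteq> {}" by auto
  show ?thesis
    unfolding deg_alpha0_def deg_n0_def
    using ne cond_D_exists[OF assms] by (intro cSup_least cInf_greatest) (auto simp: cond_R_def)
qed

text \<open>Shrinking by lower type \<open>p\<close> and enlarging back by upper type 1 gives
  \<open>1 \<le> D * C * s powr (p - 1)\<close>, which fails for small \<open>s\<close> if
  \<open>p > 1\<close>. Hence the supremum in \<open>index_i\<close> is over a bounded set.\<close>

lemma lower_type_le_1:
  assumes pos: "\<And>x t. 0 < t \<Longrightarrow> 0 < \<phi> x t" and up: "upper_type \<phi> 1" and lo: "lower_type \<phi> p"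
  shows "p \<le> 1"
proof (rule ccontr)
  assume p: "\<not> p \<le> 1"
  obtain C where C: "\<And>x t s. 0 \<le> t \<Longrightarrow> 1 \<le> s \<Longrightarrow> \<phi> x (s * t) \<le> C * s powr 1 * \<phi> x t"
    using up by (auto simp: upper_type_def)
  obtain D where D: "\<And>x t s. 0 \<le> t \<Longrightarrow> 0 < s \<Longrightarrow> s < 1 \<Longrightarrow> \<phi> x (s * t) \<le> D * s powr p * \<phi> x t"
    using lo by (auto simp: lower_type_def)
  define x :: 'a where "x = undefined"
  have main: "1 \<le> D * C * s powr (p - 1)" if s: "0 < s" "s < 1" for s
  proof -
    have D0: "0 \<le> D"
    proof (rule ccontr)
      assume "\<not> 0 \<le> D"
      then have "D * s powr p * \<phi> x 1 \<le> 0" using s pos[of 1 x] by (simp add: mult_nonpos_nonneg)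
      then show False using D[of 1 s x] s pos[of s x] by simp
    qed
    have "\<phi> x s \<le> D * s powr p * \<phi> x 1" using D[of 1 s x] s by simp
    also have "\<phi> x 1 \<le> C * (1 / s) * \<phi> x s" using C[of s "1 / s" x] s by simp
    finally have "\<phi> x s \<le> D * s powr p * (C * (1 / s) * \<phi> x s)" using D0 by (simp add: mult_left_mono)
    also have "\<dots> = D * C * s powr (p - 1) * \<phi> x s" using s by (simp add: powr_diff)
    finally show ?thesis using pos[OF s(1), of x] by simp
  qed
  have "((\<lambda>s. D * C * s powr (p - 1)) \<longlongrightarrow> D * C * 0) (at_right 0)"
    using p by (intro tendsto_mult tendsto_const tendsto_zero_powrI[where b = "p - 1"] tendsto_ident_at)
      (auto simp: eventually_at_right_less intro!: eventually_at_rightI[of 0 1])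
  then have "\<forall>\<^sub>F s in at_right 0. D * C * s powr (p - 1) < 1" by (rule order_tendstoD) simp
  moreover have "\<forall>\<^sub>F s in at_right 0. 0 < s \<and> s < (1::real)"
    by (auto intro!: eventually_at_rightI[of 0 1])
  ultimately have "\<forall>\<^sub>F s in at_right (0::real). False"
    by eventually_elim (use main in force)
  then show False by (simp add: trivial_limit_at_right_real)
qed

lemma index_i_props:
  assumes "growth_function d \<mu> \<phi>"
  shows "0 < index_i \<phi>" "\<And>c. c < index_i \<phi> \<Longrightarrow> \<exists>i. c < i \<and> 0 < i \<and> i \<le> 1 \<and> lower_type \<phi> i"
proof -
  have pos: "\<And>x t. 0 < t \<Longrightarrow> 0 < \<phi> x t" and up: "upper_type \<phi> 1"
    using assms by (auto simp: growth_function_def orlicz_function_def)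
  note le1 = lower_type_le_1[OF pos up]
  have bdd: "bdd_above {p. 0 < p \<and> lower_type \<phi> p}" using le1 by (auto intro!: bdd_aboveI[of _ 1])
  obtain p where p: "0 < p" "lower_type \<phi> p" using assms by (auto simp: growth_function_def)
  then show "0 < index_i \<phi>" unfolding index_i_def using cSup_upper[OF _ bdd, of p] by simp
  fix c assume "c < index_i \<phi>"
  then show "\<exists>i. c < i \<and> 0 < i \<and> i \<le> 1 \<and> lower_type \<phi> i"
    unfolding index_i_def using less_cSup_iff[OF _ bdd, of c] p le1 by auto
qed

lemma index_p_ge_1:
  assumes "growth_function d \<mu> \<phi>" shows "1 \<le> index_p d \<mu> \<phi>"
  unfolding index_p_def using assms
  by (intro cInf_greatest) (auto simp: growth_function_def muckenhoupt_infinity_def)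

text \<open>By continuity at \<open>e = 0\<close>, the strict inequality for \<open>M\<close> leaves
  room to move off all three extremal exponents at once.\<close>

lemma perturb_exponents:
  fixes n0 P I M :: real
  assumes "0 < I" "n0 * P / I < M"
  obtains e where "0 < e" "e < I" "(n0 + e) * (P + e) / (I - e) < M"
proof -
  have "((\<lambda>e. (n0 + e) * (P + e) / (I - e)) \<longlongrightarrow> (n0 + 0) * (P + 0) / (I - 0)) (at_right 0)"
    using assms(1) by (intro tendsto_intros tendsto_ident_at) auto
  then have "\<forall>\<^sub>F e in at_right 0. (n0 + e) * (P + e) / (I - e) < M"
    using assms(2) by (intro order_tendstoD(2)) auto
  moreover have "\<forall>\<^sub>F e in at_right 0. 0 < e \<and> e < I"
    using assms(1) by (auto intro!: eventually_at_rightI[of 0 I])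
  ultimately have "\<forall>\<^sub>F e in at_right 0. 0 < e \<and> e < I \<and> (n0 + e) * (P + e) / (I - e) < M"
    by eventually_elim auto
  then show ?thesis using that eventually_happens'[OF trivial_limit_at_right_real] by blast
qed

text \<open>The limit gives the decay for large arguments; for the others \<open>1 + s\<close> is
  bounded, and boundedness of \<open>g\<close> suffices.\<close>

lemma profile_decay:
  fixes g :: "real \<Rightarrow> real"
  assumes pos: "\<forall>s\<ge>0. 0 < g s" and bd: "bounded (g ` {0..})" and M: "0 < M"
    and lim: "((\<lambda>r. r powr M * g (r powr m)) \<longlongrightarrow> 0) at_top"
  obtains G where "0 \<le> G" "\<And>s. 0 \<le> s \<Longrightarrow> g (s powr m) \<le> G * (1 + s) powr (- M)"
proof -
  obtain b where b: "\<And>s. 0 \<le> s \<Longrightarrow> norm (g s) \<le> b" using bd by (auto simp: bounded_iff)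
  have b0: "0 \<le> b" using b[of 0] by (meson norm_ge_zero order_refl order_trans)
  have "\<forall>\<^sub>F r in at_top. r powr M * g (r powr m) < 1" using lim by (rule order_tendstoD) simp
  then obtain s0 where s0: "\<And>s. s0 \<le> s \<Longrightarrow> s powr M * g (s powr m) < 1" by (auto simp: eventually_at_top_linorder)
  define s1 where "s1 = max 1 s0"
  define G where "G = 2 powr M + b * (1 + s1) powr M"
  have "g (s powr m) \<le> G * (1 + s) powr (- M)" if s: "0 \<le> s" for s
  proof (cases "s1 \<le> s")
    case True
    then have s1: "1 \<le> s" by (simp add: s1_def)
    have "g (s powr m) \<le> s powr (- M)" using s0[of s] True s1 by (simp add: s1_def powr_minus field_simps)
    also have "\<dots> = 2 powr M * (2 * s) powr (- M)" using s1 by (simp add: powr_mult powr_minus)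
    also have "\<dots> \<le> 2 powr M * (1 + s) powr (- M)" using s1 M by (intro mult_left_mono powr_mono2') auto
    also have "\<dots> \<le> G * (1 + s) powr (- M)" using b0 by (intro mult_right_mono) (auto simp: G_def)
    finally show ?thesis .
  next
    case False
    have "g (s powr m) \<le> b * 1" using b[of "s powr m"] by simp
    also have "1 = (1 + s) powr M * (1 + s) powr (- M)" using s by (simp add: powr_add[symmetric])
    also have "b * ((1 + s) powr M * (1 + s) powr (- M)) \<le> b * ((1 + s1) powr M * (1 + s) powr (- M))"
      using False s M b0 by (intro mult_left_mono mult_right_mono powr_mono2) auto
    also have "\<dots> \<le> G * (1 + s) powr (- M)" using b0 by (simp add: G_def distrib_right)
    finally show ?thesis .
  qed
  moreover have "0 \<le> G" using b0 by (simp add: G_def)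
  ultimately show ?thesis using that by blast
qed

text \<open>\<open>osc\<close> asks for a positive \<open>K\<close>, whereas the norm
  \<open>v\<close> may be 0; an arbitrarily small excess bridges the gap.\<close>

lemma ennreal_le_mult_of_bounds:
  assumes C: "0 < C" and main: "\<And>K. 0 < K \<Longrightarrow> v \<le> ennreal K \<Longrightarrow> u \<le> ennreal (C * K)"
  shows "u \<le> ennreal C * v"
proof (cases v)
  case (real k)
  show ?thesis
  proof (rule ennreal_le_epsilon)
    fix e :: real assume e: "0 < e"
    have "u \<le> ennreal (C * (k + e / C))"
      using real e C by (intro main) (auto intro!: ennreal_leI add_nonneg_pos)
    also have "C * (k + e / C) = C * k + e" using C by (simp add: field_simps)
    finally show "u \<le> ennreal C * v + ennreal e" using real C e by (simp add: ennreal_mult ennreal_plus)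
  qed
qed (use C in \<open>simp add: ennreal_mult_top\<close>)

lemma ennpowr_le_iff:
  assumes "0 < l" "0 \<le> K" "0 < p"
  shows "ennreal (1 / l) * ennpowr I (1 / p) \<le> ennreal K \<longleftrightarrow> I \<le> ennreal ((K * l) powr p)"
proof (cases I)
  case (real s)
  have "ennreal (1 / l) * ennpowr I (1 / p) = ennreal (1 / l * s powr (1 / p))"
    using assms real by (simp add: ennpowr_def flip: ennreal_mult)
  then have "ennreal (1 / l) * ennpowr I (1 / p) \<le> ennreal K \<longleftrightarrow> s powr (1 / p) \<le> K * l"
    using assms by (simp add: ennreal_le_iff field_simps)
  also have "\<dots> \<longleftrightarrow> s \<le> (K * l) powr p"
  proof
    assume "s powr (1 / p) \<le> K * l"
    then have "(s powr (1 / p)) powr p \<le> (K * l) powr p" using assms by (intro powr_mono2) auto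
    then show "s \<le> (K * l) powr p" using assms real by (simp add: powr_powr)
  next
    assume "s \<le> (K * l) powr p"
    then have "s powr (1 / p) \<le> ((K * l) powr p) powr (1 / p)" using assms real by (intro powr_mono2) auto
    then show "s powr (1 / p) \<le> K * l" using assms by (simp add: powr_powr)
  qed
  finally show ?thesis using real by (simp add: ennreal_le_iff)
next
  case top
  then show ?thesis using assms by (simp add: ennpowr_def ennreal_mult_top top_unique)
qed

section \<open>From oscillations to the norms\<close>

context musielak
begin

lemma bmo_norm_le_iff:
  assumes "0 \<le> K" "0 < p"
  shows "bmo_norm d \<mu> \<phi> m a p f \<le> ennreal K \<longleftrightarrow>
    (\<forall>x. \<forall>r>0. (\<integral>\<^sup>+y\<in>B x r. ennreal
       ((cmod (f y - ai_op \<mu> a (r powr m) f y) / \<phi> y (1 / L x r)) powr p * \<phi> y (1 / L x r)) \<partial>\<mu>)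
     \<le> ennreal ((K * L x r) powr p))"
  unfolding bmo_norm_def Let_def L_def[symmetric]
  using L_pos assms by (simp add: SUP_le_iff ennpowr_le_iff Ball_def)

end

context musielak_kernel
begin

lemma sigma_finite: "sigma_finite_measure \<mu>"
proof
  define A where "A = range (\<lambda>k::nat. B undefined (Suc k))"
  have "\<Union>A = UNIV"
  proof -
    have "y \<in> \<Union>A" for y
    proof -
      obtain k :: nat where "d y undefined < k" using reals_Archimedean2 by blast
      then have "y \<in> B undefined (Suc k)" by simp
      then show ?thesis unfolding A_def by blast
    qed
    then show ?thesis by blast
  qed
  moreover have "emeasure \<mu> (B undefined (real (Suc k))) \<noteq> \<infinity>" for k
    using ball_finite[of "real (Suc k)" undefined] by simp
  then have "\<forall>b\<in>A. emeasure \<mu> b \<noteq> \<infinity>" unfolding A_def by blast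
  ultimately show "\<exists>A. countable A \<and> A \<subseteq> sets \<mu> \<and> \<Union>A = space \<mu> \<and> (\<forall>a\<in>A. emeasure \<mu> a \<noteq> \<infinity>)"
    by (intro exI[of _ A]) (auto simp: A_def space_\<mu>)
qed

text \<open>Needed before integrals are subtracted. The scale \<open>R\<close> may exceed
  \<open>\<rho>\<close>, so balls are dilated by \<open>l\<close> to a radius at which
  \<open>osc_small_scale\<close> applies.\<close>

lemma ker_finite:
  assumes u: "osc u K" and \<rho>: "0 < \<rho>" and R: "0 < R"
  shows "ker \<rho> (\<tau> u R) x < \<infinity>"
proof -
  have K: "0 < K" using oscD(2)[OF u] .
  define l where "l = max 1 (R / \<rho>)"
  have l: "1 \<le> l" "R \<le> l * \<rho>" using \<rho> by (auto simp: l_def max_def field_simps)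
  define D where "D = Cst * K * (CL * l powr \<theta> * L x \<rho>)"
  have D: "0 \<le> D" using Cst_pos K CL_ge_1 L_pos[OF \<rho>, of x] by (simp add: D_def)
  have "emeasure (\<tau> u R) (B x s) \<le> ennreal (D * (s / \<rho>) powr \<theta>)" if s: "\<rho> \<le> s" for s
  proof -
    have s0: "0 < s" "1 \<le> s / \<rho>" using s \<rho> by auto
    have l2: "1 \<le> l * (s / \<rho>)" using mult_mono[OF l(1) s0(2)] l by simp
    have ls: "l * (s / \<rho>) * \<rho> = l * s" using \<rho> by simp
    have "B x s \<subseteq> B x (l * s)" using l s0 by (intro B_mono) (simp add: mult_le_cancel_right1)
    then have "emeasure (\<tau> u R) (B x s) \<le> emeasure (\<tau> u R) (B x (l * s))" by (intro emeasure_mono) auto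
    also have "\<dots> \<le> ennreal (Cst * K * L x (l * s))"
    proof (rule osc_small_scale[OF u R])
      have "l * \<rho> \<le> l * s" using s l by (intro mult_left_mono) auto
      then show "R \<le> l * s" using l by linarith
    qed
    also have "\<dots> \<le> ennreal (Cst * K * (CL * (l * (s / \<rho>)) powr \<theta> * L x \<rho>))"
      using L_growth[OF \<rho> l2, of x] Cst_pos K unfolding ls by (intro ennreal_leI mult_left_mono) auto
    also have "(l * (s / \<rho>)) powr \<theta> = l powr \<theta> * (s / \<rho>) powr \<theta>"
      using l s0 by (subst powr_mult) auto
    finally show ?thesis by (simp add: D_def mult_ac)
  qed
  then have "ker \<rho> (\<tau> u R) x \<le> ennreal (G / V x \<rho> * (Ck * D))" by (intro ker_le D \<rho>) auto
  then show ?thesis by (metis ennreal_less_top infinity_ennreal_def order_le_less_trans)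
qed

text \<open>Integrability is demanded at every point, because a Bochner integral that does not exist
  is 0 by convention and would break linearity. The kernel bound is expressed through the radius
  \<open>\<rho>\<close>, that is at time \<open>\<rho> powr m\<close>.\<close>

definition admissible :: "real \<Rightarrow> (real \<Rightarrow> 'a \<Rightarrow> 'a \<Rightarrow> complex) \<Rightarrow> ('a \<Rightarrow> complex) \<Rightarrow> bool" where
  "admissible m a f \<longleftrightarrow> f \<in> borel_measurable \<mu> \<and>
     (\<forall>t>0. (\<lambda>(x, y). a t x y) \<in> borel_measurable (\<mu> \<Otimes>\<^sub>M \<mu>)) \<and>
     (\<forall>\<rho>>0. \<forall>x y. cmod (a (\<rho> powr m) x y) \<le> G / V x \<rho> * (1 + d x y / \<rho>) powr (- M)) \<and>
     (\<forall>\<rho>>0. \<forall>x. integrable \<mu> (\<lambda>y. a (\<rho> powr m) x y * f y)) \<and>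
     (\<forall>s>0. \<forall>t>0. AE x in \<mu>. ai_op \<mu> a t (ai_op \<mu> a s f) x = ai_op \<mu> a (t + s) f x)"

lemma ai_op_measurable:
  assumes "admissible m a f" "0 < t"
  shows "ai_op \<mu> a t f \<in> borel_measurable \<mu>"
proof -
  interpret sigma_finite_measure \<mu> by (rule sigma_finite)
  have [measurable]: "f \<in> borel_measurable \<mu>" "(\<lambda>(x, y). a t x y) \<in> borel_measurable (\<mu> \<Otimes>\<^sub>M \<mu>)"
    using assms by (auto simp: admissible_def)
  have "(\<lambda>x. LINT y|\<mu>. a t x y * f y) \<in> borel_measurable \<mu>"
    by (rule borel_measurable_lebesgue_integral) measurable
  then show ?thesis using assms(2) by (simp add: ai_op_def[abs_def])
qed

lemma commutes_deviation:
  assumes adm: "admissible m a f" and u: "u = (\<lambda>r x. f x - ai_op \<mu> a (r powr m) f x)" and osc: "osc u K"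
  shows "commutes u"
  unfolding commutes_def
proof (intro allI impI)
  fix \<rho> R :: real assume \<rho>: "0 < \<rho>" and R: "0 < R"
  \<comment> \<open>The difference on the left is the operator at scale \<open>r\<close> applied to
    \<open>u s\<close>. Linearity is justified by \<open>admissible\<close> for
    \<open>k y * f y\<close> and by \<open>ker_finite\<close> for
    \<open>k y * u s y\<close>.\<close>
  have split: "ennreal (cmod (ai_op \<mu> a (r powr m) f x - ai_op \<mu> a (r powr m) (ai_op \<mu> a (s powr m) f) x))
      \<le> ker r (\<tau> u s) x" if r: "0 < r" and s: "0 < s" for r s x
  proof -
    define k where "k y = a (r powr m) x y" for y
    have rm: "r powr m \<noteq> 0" "0 < r powr m" "0 < s powr m" using r s by auto
    have am: "(\<lambda>(x, y). a (r powr m) x y) \<in> borel_measurable (\<mu> \<Otimes>\<^sub>M \<mu>)"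
      using adm rm by (auto simp: admissible_def)
    have [measurable]: "k \<in> borel_measurable \<mu>"
      using measurable_Pair2[OF am, of x] space_\<mu> by (simp add: k_def[abs_def])
    have [measurable]: "u s \<in> borel_measurable \<mu>" by (rule oscD(1)[OF osc s])
    have kf: "integrable \<mu> (\<lambda>y. k y * f y)" using adm r by (auto simp: admissible_def k_def)
    have le: "(\<integral>\<^sup>+y. ennreal (norm (k y * u s y)) \<partial>\<mu>) \<le> ker r (\<tau> u s) x"
    proof -
      have kn: "0 \<le> G / V x r * (1 + d x y / r) powr (- M)" for y
        using G_nonneg V_pos[OF r, of x] by simp
      have "ker r (\<tau> u s) x = (\<integral>\<^sup>+y. ennreal (cmod (u s y)) * ennreal (G / V x r * (1 + d x y / r) powr (- M)) \<partial>\<mu>)"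
        unfolding ker_def \<tau>_def by (subst nn_integral_density) auto
      moreover have "(\<integral>\<^sup>+y. ennreal (norm (k y * u s y)) \<partial>\<mu>) \<le>
          (\<integral>\<^sup>+y. ennreal (cmod (u s y)) * ennreal (G / V x r * (1 + d x y / r) powr (- M)) \<partial>\<mu>)"
      proof (rule nn_integral_mono)
        fix y
        have "cmod (k y) \<le> G / V x r * (1 + d x y / r) powr (- M)"
          using adm r by (auto simp: admissible_def k_def)
        then have "cmod (u s y) * cmod (k y) \<le> cmod (u s y) * (G / V x r * (1 + d x y / r) powr (- M))"
          by (intro mult_left_mono) auto
        then show "ennreal (norm (k y * u s y)) \<le> ennreal (cmod (u s y)) * ennreal (G / V x r * (1 + d x y / r) powr (- M))"
          using kn[of y] by (subst ennreal_mult[symmetric]) (auto simp: norm_mult mult.commute intro!: ennreal_leI)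
      qed
      ultimately show ?thesis by simp
    qed
    have ku: "integrable \<mu> (\<lambda>y. k y * u s y)"
      using le ker_finite[OF osc r s, of x] by (intro integrableI_bounded) (auto intro: le_less_trans)
    have eq: "k y * ai_op \<mu> a (s powr m) f y = k y * f y - k y * u s y" for y
      by (simp add: u algebra_simps)
    have "(LINT y|\<mu>. k y * f y) - (LINT y|\<mu>. k y * ai_op \<mu> a (s powr m) f y) = (LINT y|\<mu>. k y * u s y)"
      unfolding eq using kf ku by simp
    then have "ai_op \<mu> a (r powr m) f x - ai_op \<mu> a (r powr m) (ai_op \<mu> a (s powr m) f) x = (LINT y|\<mu>. k y * u s y)"
      using rm by (simp add: ai_op_def[of \<mu> a "r powr m"] k_def)
    then show ?thesis using integral_norm_bound_ennreal[OF ku] le by (auto intro: order_trans)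
  qed
  have sg: "AE x in \<mu>. ai_op \<mu> a (r powr m) (ai_op \<mu> a (s powr m) f) x = ai_op \<mu> a (r powr m + s powr m) f x"
    if "0 < r" "0 < s" for r s using adm that by (auto simp: admissible_def)
  show "AE x in \<mu>. ennreal (cmod (u R x - u \<rho> x)) \<le> ker \<rho> (\<tau> u R) x + ker R (\<tau> u \<rho>) x"
    using sg[OF \<rho> R] sg[OF R \<rho>]
  proof eventually_elim
    case (elim x)
    \<comment> \<open>Both compositions agree almost everywhere with the operator at time
      \<open>\<rho> powr m + R powr m\<close>, so they cancel in \<open>p1 - p2\<close>.\<close>
    define p1 where "p1 = ai_op \<mu> a (\<rho> powr m) f x - ai_op \<mu> a (\<rho> powr m) (ai_op \<mu> a (R powr m) f) x"
    define p2 where "p2 = ai_op \<mu> a (R powr m) f x - ai_op \<mu> a (R powr m) (ai_op \<mu> a (\<rho> powr m) f) x"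
    have "u R x - u \<rho> x = p1 - p2" using elim by (simp add: u p1_def p2_def add.commute)
    then have "ennreal (cmod (u R x - u \<rho> x)) \<le> ennreal (cmod p1) + ennreal (cmod p2)"
      by (simp add: norm_triangle_ineq4 ennreal_leI flip: ennreal_plus)
    also have "\<dots> \<le> ker \<rho> (\<tau> u R) x + ker R (\<tau> u \<rho>) x"
      unfolding p1_def p2_def using \<rho> R by (intro add_mono split)
    finally show ?case .
  qed
qed

lemma bmo_norm_p_le:
  "\<exists>C>0. \<forall>m a f. admissible m a f \<longrightarrow> bmo_norm d \<mu> \<phi> m a p f \<le> ennreal C * bmo_norm d \<mu> \<phi> m a 1 f"
proof -
  obtain A where A: "0 \<le> A" "\<And>u K c R. osc u K \<Longrightarrow> commutes u \<Longrightarrow> 0 < R \<Longrightarrow>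
     (\<integral>\<^sup>+x. F u c R x * indicator (B c R) x \<partial>\<mu>) \<le> ennreal (A * (K * L c R) powr p)"
    using john_nirenberg by blast
  have p0: "0 < p" using p_gt_1 by simp
  \<comment> \<open>Fixed before \<open>m\<close>, \<open>a\<close> and \<open>f\<close>; the
    summand 1 keeps it positive when \<open>A = 0\<close>.\<close>
  define C where "C = A powr (1 / p) + 1"
  have C: "0 < C" by (simp add: C_def add_nonneg_pos)
  have AC: "A \<le> C powr p"
  proof -
    have "A = (A powr (1 / p)) powr p" using A p0 by (simp add: powr_powr)
    also have "\<dots> \<le> C powr p" using p0 by (intro powr_mono2) (auto simp: C_def)
    finally show ?thesis .
  qed
  have main: "bmo_norm d \<mu> \<phi> m a p f \<le> ennreal (C * K)"
    if adm: "admissible m a f" and le: "bmo_norm d \<mu> \<phi> m a 1 f \<le> ennreal K" and K: "0 < K" for m a f K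
  proof -
    define u where "u = (\<lambda>r x. f x - ai_op \<mu> a (r powr m) f x)"
    have um: "u r \<in> borel_measurable \<mu>" if "0 < r" for r
    proof -
      have "f \<in> borel_measurable \<mu>" using adm by (simp add: admissible_def)
      moreover have "ai_op \<mu> a (r powr m) f \<in> borel_measurable \<mu>" using that by (intro ai_op_measurable[OF adm]) auto
      ultimately show ?thesis unfolding u_def by measurable
    qed
    have "emeasure (density \<mu> (\<lambda>y. ennreal (cmod (u r y)))) (B x r) \<le> ennreal (K * L x r)" if r: "0 < r" for x r
    proof -
      have [measurable]: "u r \<in> borel_measurable \<mu>" by (rule um[OF r])
      have \<phi>p: "0 < \<phi> y (1 / L x r)" for y using L_pos[OF r, of x] by (simp add: \<phi>_pos)
      have "emeasure (density \<mu> (\<lambda>y. ennreal (cmod (u r y)))) (B x r) = (\<integral>\<^sup>+y\<in>B x r. ennreal (cmod (u r y)) \<partial>\<mu>)"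
        by (simp add: emeasure_density)
      also have "\<dots> = (\<integral>\<^sup>+y\<in>B x r. ennreal ((cmod (u r y) / \<phi> y (1 / L x r)) powr 1 * \<phi> y (1 / L x r)) \<partial>\<mu>)"
        using \<phi>p less_imp_neq[OF \<phi>p] by (intro nn_integral_cong) (simp add: less_imp_le)
      also have "\<dots> \<le> ennreal ((K * L x r) powr 1)"
        using le K r by (subst (asm) bmo_norm_le_iff) (auto simp: u_def)
      finally show ?thesis using K L_pos[OF r, of x] by simp
    qed
    then have o: "osc u K" using um K by (simp add: osc_def)
    have c: "commutes u" by (rule commutes_deviation[OF adm u_def o])
    have "(\<integral>\<^sup>+y\<in>B x r. ennreal ((cmod (u r y) / \<phi> y (1 / L x r)) powr p * \<phi> y (1 / L x r)) \<partial>\<mu>)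
        \<le> ennreal ((C * K * L x r) powr p)" if r: "0 < r" for x r
    proof -
      have \<phi>p: "0 < \<phi> y (1 / L x r)" for y using L_pos[OF r, of x] by (simp add: \<phi>_pos)
      have "(\<integral>\<^sup>+y\<in>B x r. ennreal ((cmod (u r y) / \<phi> y (1 / L x r)) powr p * \<phi> y (1 / L x r)) \<partial>\<mu>)
          = (\<integral>\<^sup>+y. F u x r y * indicator (B x r) y \<partial>\<mu>)"
      proof (intro nn_integral_cong)
        fix y
        have "(cmod (u r y) / \<phi> y (1 / L x r)) powr p * \<phi> y (1 / L x r) = cmod (u r y) powr p * \<phi> y (1 / L x r) powr (1 - p)"
          using \<phi>p[of y] by (simp add: powr_divide powr_diff)
        then show "ennreal ((cmod (u r y) / \<phi> y (1 / L x r)) powr p * \<phi> y (1 / L x r)) * indicator (B x r) y = F u x r y * indicator (B x r) y"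
          by (simp add: F_def)
      qed
      also have "\<dots> \<le> ennreal (A * (K * L x r) powr p)" by (rule A(2)[OF o c r])
      also have "\<dots> \<le> ennreal (C powr p * (K * L x r) powr p)" using AC by (intro ennreal_leI mult_right_mono) auto
      also have "C powr p * (K * L x r) powr p = (C * K * L x r) powr p"
        using C K L_pos[OF r, of x] by (subst powr_mult[symmetric]) (auto simp: mult.assoc)
      finally show ?thesis .
    qed
    then show ?thesis using C K p0 by (subst bmo_norm_le_iff) (auto simp: u_def)
  qed
  then show ?thesis using C by (blast intro: ennreal_le_mult_of_bounds)
qed

text \<open>Hoelder's inequality, the weight of a ball being at most \<open>2 * Cu\<close>. It is
  obtained from \<open>h \<le> c + c powr (1 - p) * h powr p\<close> with
  \<open>c = K * L x r\<close>, for which the second term contributes at most \<open>c\<close>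
  again.\<close>

lemma bmo_norm_1_le:
  assumes adm: "admissible m a f"
  shows "bmo_norm d \<mu> \<phi> m a 1 f \<le> ennreal (2 * Cu + 1) * bmo_norm d \<mu> \<phi> m a p f"
proof -
  have p0: "0 < p" using p_gt_1 by simp
  have C: "0 < 2 * Cu + 1" using Cu_ge_1 by simp
  define u where "u = (\<lambda>r x. f x - ai_op \<mu> a (r powr m) f x)"
  have main: "bmo_norm d \<mu> \<phi> m a 1 f \<le> ennreal ((2 * Cu + 1) * K)"
    if le: "bmo_norm d \<mu> \<phi> m a p f \<le> ennreal K" and K: "0 < K" for K
  proof -
    have "(\<integral>\<^sup>+y\<in>B x r. ennreal ((cmod (u r y) / \<phi> y (1 / L x r)) powr 1 * \<phi> y (1 / L x r)) \<partial>\<mu>)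
        \<le> ennreal (((2 * Cu + 1) * K * L x r) powr 1)" if r: "0 < r" for x r
    proof -
      have Lp: "0 < L x r" by (rule L_pos[OF r])
      define c where "c = K * L x r"
      have c: "0 < c" using K Lp by (simp add: c_def)
      have w: "0 < 1 / L x r" using Lp by simp
      have \<phi>p: "0 < \<phi> y (1 / L x r)" for y by (rule \<phi>_pos[OF w])
      have [measurable]: "(\<lambda>y. \<phi> y (1 / L x r)) \<in> borel_measurable \<mu>" using w by (intro \<phi>_meas) auto
      have fm: "f \<in> borel_measurable \<mu>" using adm by (simp add: admissible_def)
      have "ai_op \<mu> a (r powr m) f \<in> borel_measurable \<mu>" using r by (intro ai_op_measurable[OF adm]) auto
      with fm have [measurable]: "u r \<in> borel_measurable \<mu>" unfolding u_def by measurable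
      define h where "h y = cmod (u r y) / \<phi> y (1 / L x r)" for y
      have h0: "0 \<le> h y" for y using \<phi>p[of y] by (simp add: h_def)
      have pt: "h y * \<phi> y (1 / L x r) \<le> c * \<phi> y (1 / L x r) + c powr (1 - p) * (h y powr p * \<phi> y (1 / L x r))" for y
      proof -
        have "h y \<le> c + c powr (1 - p) * h y powr p"
        proof (cases "h y \<le> c")
          case False
          have "h y = h y powr (1 - p) * h y powr p" using False c by (simp add: powr_add[symmetric])
          also have "\<dots> \<le> c powr (1 - p) * h y powr p"
            using False c p_gt_1 by (intro mult_right_mono powr_mono2') auto
          finally show ?thesis using c by simp
        qed (simp add: add_increasing2)
        then show ?thesis using mult_right_mono[OF _ less_imp_le[OF \<phi>p[of y]]] by (force simp: algebra_simps)
      qed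
      have "(\<integral>\<^sup>+y\<in>B x r. ennreal (h y powr 1 * \<phi> y (1 / L x r)) \<partial>\<mu>) \<le>
          (\<integral>\<^sup>+y. ennreal c * (ennreal (\<phi> y (1 / L x r)) * indicator (B x r) y) +
            ennreal (c powr (1 - p)) * (ennreal (h y powr p * \<phi> y (1 / L x r)) * indicator (B x r) y) \<partial>\<mu>)"
      proof (intro nn_integral_mono)
        fix y
        have "ennreal (h y powr 1 * \<phi> y (1 / L x r)) \<le>
            ennreal (c * \<phi> y (1 / L x r) + c powr (1 - p) * (h y powr p * \<phi> y (1 / L x r)))"
          using pt[of y] h0[of y] by (intro ennreal_leI) simp
        also have "\<dots> = ennreal c * ennreal (\<phi> y (1 / L x r)) + ennreal (c powr (1 - p)) * ennreal (h y powr p * \<phi> y (1 / L x r))"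
          using c \<phi>p[of y] by (simp add: ennreal_mult ennreal_plus)
        finally show "ennreal (h y powr 1 * \<phi> y (1 / L x r)) * indicator (B x r) y \<le>
            ennreal c * (ennreal (\<phi> y (1 / L x r)) * indicator (B x r) y) +
            ennreal (c powr (1 - p)) * (ennreal (h y powr p * \<phi> y (1 / L x r)) * indicator (B x r) y)"
          by (auto split: split_indicator)
      qed
      also have "\<dots> = ennreal c * emeasure (\<nu> (1 / L x r)) (B x r) +
          ennreal (c powr (1 - p)) * (\<integral>\<^sup>+y\<in>B x r. ennreal (h y powr p * \<phi> y (1 / L x r)) \<partial>\<mu>)"
        unfolding h_def \<nu>_def by (simp add: nn_integral_add nn_integral_cmult emeasure_density)
      also have "\<dots> \<le> ennreal c * ennreal (2 * Cu) + ennreal (c powr (1 - p)) * ennreal (c powr p)"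
      proof (intro add_mono mult_left_mono)
        show "emeasure (\<nu> (1 / L x r)) (B x r) \<le> ennreal (2 * Cu)"
          using W_L_le[OF r, of x] w r by (simp add: emeasure_\<nu>_B ennreal_leI)
        show "(\<integral>\<^sup>+y\<in>B x r. ennreal (h y powr p * \<phi> y (1 / L x r)) \<partial>\<mu>) \<le> ennreal (c powr p)"
          using le K r p0 by (subst (asm) bmo_norm_le_iff) (auto simp: u_def h_def c_def)
      qed auto
      also have "\<dots> = ennreal (c * (2 * Cu) + c powr (1 - p) * c powr p)"
        using c Cu_ge_1 by (simp add: ennreal_mult ennreal_plus)
      also have "c * (2 * Cu) + c powr (1 - p) * c powr p = (2 * Cu + 1) * K * L x r"
        using c by (simp add: powr_add[symmetric] c_def algebra_simps)
      finally show ?thesis using C K Lp by (simp add: h_def)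
    qed
    then show ?thesis using C K by (subst bmo_norm_le_iff) (auto simp: u_def)
  qed
  then show ?thesis using C by (blast intro: ennreal_le_mult_of_bounds)
qed

text \<open>The kernel is compared with the weight in \<open>M_class_at\<close>. Doubling with
  exponent \<open>n'\<close> bounds the volume in it by a power of the distance, and by
  \<open>e\<close> the decay of the kernel absorbs the total power.\<close>

lemma kernel_integrable:
  assumes f: "f \<in> M_class_at d \<mu> \<phi> x0 \<beta>" and n': "cond_D d \<mu> n'"
    and e: "deg_n0 d \<mu> * index_p d \<mu> \<phi> / index_i \<phi> - deg_alpha0 d \<mu> + \<beta> + n' \<le> M"
    and am: "\<And>t. 0 < t \<Longrightarrow> (\<lambda>(x, y). a t x y) \<in> borel_measurable (\<mu> \<Otimes>\<^sub>M \<mu>)"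
    and ab: "\<And>\<rho> x y. 0 < \<rho> \<Longrightarrow> cmod (a (\<rho> powr m) x y) \<le> G / V x \<rho> * (1 + d x y / \<rho>) powr (- M)"
    and \<rho>: "0 < \<rho>"
  shows "integrable \<mu> (\<lambda>y. a (\<rho> powr m) x y * f y)"
proof (rule integrableI_bounded)
  have M: "0 < M" using \<theta>_less_M \<theta>_pos by (simp add: \<theta>_def)
  define \<eta> where "\<eta> = deg_n0 d \<mu> * index_p d \<mu> \<phi> / index_i \<phi> - deg_alpha0 d \<mu> + \<beta>"
  define w where "w y = (1 + d x0 y) powr \<eta> * V x0 (1 + d x0 y)" for y
  have [measurable]: "f \<in> borel_measurable \<mu>" using f by (auto simp: M_class_at_def L1_loc_def)
  have If: "(\<integral>\<^sup>+y. ennreal (cmod (f y) / w y) \<partial>\<mu>) < \<infinity>"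
    using f by (simp add: M_class_at_def w_def \<eta>_def V_def)
  have am': "(\<lambda>(x, y). a (\<rho> powr m) x y) \<in> borel_measurable (\<mu> \<Otimes>\<^sub>M \<mu>)" using \<rho> by (intro am) auto
  have am2 [measurable]: "(\<lambda>y. a (\<rho> powr m) x y) \<in> borel_measurable \<mu>"
    using measurable_Pair2[OF am', of x] space_\<mu> by simp
  show "(\<lambda>y. a (\<rho> powr m) x y * f y) \<in> borel_measurable \<mu>" by measurable
  obtain D where D: "\<And>x r l. 0 < r \<Longrightarrow> 1 \<le> l \<Longrightarrow> V x (l * r) \<le> D * l powr n' * V x r"
    using n' by (auto simp: cond_D_def V_def)
  \<comment> \<open>Chosen for \<open>1 + d x0 y \<le> c * (1 + d x y / \<rho>)\<close>, which moves
    the decay of the kernel from \<open>x\<close> to \<open>x0\<close>.\<close>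
  define c where "c = 1 + \<kappa> * d x0 x + \<kappa> * \<rho>"
  have kd: "0 \<le> \<kappa> * d x0 x" "0 \<le> \<kappa> * \<rho>" using \<kappa>_ge_1 d_nonneg[of x0 x] \<rho> by auto
  then have c: "1 \<le> c" by (simp add: c_def)
  define X where "X = G / V x \<rho> * c powr M * (\<bar>D\<bar> * V x0 1)"
  have Vp: "0 < V x \<rho>" "0 < V x0 1" using V_pos \<rho> by auto
  have X: "0 \<le> X" using G_nonneg Vp by (simp add: X_def)
  have wpos: "0 < w y" for y
    using d_nonneg[of x0 y] V_pos[of "1 + d x0 y" x0] by (simp add: w_def add_pos_nonneg)
  have pt: "cmod (a (\<rho> powr m) x y) \<le> X / w y" for y
  proof -
    have d0: "0 \<le> d x0 y" "0 \<le> d x y / \<rho>" using d_nonneg \<rho> by auto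
    have "d x0 y \<le> \<kappa> * (d x0 x + d x y)" by (rule d_triangle)
    then have "1 + d x0 y \<le> 1 + \<kappa> * d x0 x + \<kappa> * \<rho> * (d x y / \<rho>)" using \<rho> by (simp add: algebra_simps)
    also have "\<dots> \<le> c * (1 + d x y / \<rho>)"
    proof -
      have "c * (1 + d x y / \<rho>) = c + (1 + \<kappa> * d x0 x) * (d x y / \<rho>) + \<kappa> * \<rho> * (d x y / \<rho>)"
        by (simp add: c_def algebra_simps)
      moreover have "0 \<le> (1 + \<kappa> * d x0 x) * (d x y / \<rho>)" using kd d0 by (intro mult_nonneg_nonneg) auto
      ultimately show ?thesis using kd by (simp add: c_def)
    qed
    finally have le: "1 + d x0 y \<le> c * (1 + d x y / \<rho>)" .
    have le': "(c * (1 + d x y / \<rho>)) powr (- M) \<le> (1 + d x0 y) powr (- M)"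
      using le d0 M by (intro powr_mono2') auto
    have 1: "(1 + d x y / \<rho>) powr (- M) \<le> c powr M * (1 + d x0 y) powr (- M)"
    proof -
      have "(1 + d x y / \<rho>) powr (- M) = c powr M * (c * (1 + d x y / \<rho>)) powr (- M)"
        using c d0 by (subst powr_mult) (auto simp: powr_minus)
      also have "\<dots> \<le> c powr M * (1 + d x0 y) powr (- M)" by (intro mult_left_mono le') auto
      finally show ?thesis .
    qed
    have "w y \<le> (1 + d x0 y) powr \<eta> * (\<bar>D\<bar> * (1 + d x0 y) powr n' * V x0 1)"
    proof -
      have "V x0 ((1 + d x0 y) * 1) \<le> D * (1 + d x0 y) powr n' * V x0 1" using d0 by (intro D) auto
      also have "\<dots> \<le> \<bar>D\<bar> * (1 + d x0 y) powr n' * V x0 1" using Vp by (intro mult_right_mono) auto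
      finally show ?thesis unfolding w_def by (intro mult_left_mono) auto
    qed
    also have "\<dots> = \<bar>D\<bar> * V x0 1 * (1 + d x0 y) powr (\<eta> + n')" by (simp add: powr_add)
    also have "\<dots> \<le> \<bar>D\<bar> * V x0 1 * (1 + d x0 y) powr M"
      using e d0 Vp by (intro mult_left_mono powr_mono) (auto simp: \<eta>_def)
    finally have "(1 + d x0 y) powr (- M) \<le> \<bar>D\<bar> * V x0 1 / w y"
      using wpos[of y] d0 by (simp add: powr_minus field_simps)
    then have "c powr M * (1 + d x0 y) powr (- M) \<le> c powr M * (\<bar>D\<bar> * V x0 1 / w y)"
      by (intro mult_left_mono) auto
    with 1 have "(1 + d x y / \<rho>) powr (- M) \<le> c powr M * (\<bar>D\<bar> * V x0 1 / w y)" by simp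
    then have "G / V x \<rho> * (1 + d x y / \<rho>) powr (- M) \<le> G / V x \<rho> * (c powr M * (\<bar>D\<bar> * V x0 1 / w y))"
      using G_nonneg Vp by (intro mult_left_mono) auto
    then show ?thesis using ab[OF \<rho>, of x y] by (simp add: X_def)
  qed
  have "(\<integral>\<^sup>+y. ennreal (norm (a (\<rho> powr m) x y * f y)) \<partial>\<mu>) \<le> (\<integral>\<^sup>+y. ennreal X * ennreal (cmod (f y) / w y) \<partial>\<mu>)"
  proof (intro nn_integral_mono)
    fix y
    have "cmod (a (\<rho> powr m) x y) * cmod (f y) \<le> X / w y * cmod (f y)"
      using pt by (intro mult_right_mono) auto
    then show "ennreal (norm (a (\<rho> powr m) x y * f y)) \<le> ennreal X * ennreal (cmod (f y) / w y)"
      using X wpos[of y] by (subst ennreal_mult[symmetric]) (auto simp: norm_mult less_imp_le intro!: ennreal_leI)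
  qed
  also have "\<dots> < \<infinity>"
  proof (cases "X = 0")
    case False
    then show ?thesis
    proof -
      have "(\<lambda>y. V x0 (1 + d x0 y)) \<in> borel_measurable \<mu>"
      proof -
        have "mono (\<lambda>r. V x0 r)"
        proof
          fix r s :: real assume rs: "r \<le> s"
          show "V x0 r \<le> V x0 s"
          proof (cases "0 < s")
            case True then show ?thesis using rs by (intro V_mono B_mono)
          next
            case False
            then have "B x0 r = {}" using rs d_nonneg by (auto simp: qball_def) (smt (verit))
            then show ?thesis by (simp add: V_def)
          qed
        qed
        then have [measurable]: "V x0 \<in> borel_measurable borel" by (rule borel_measurable_mono)
        show ?thesis by measurable
      qed
      then have [measurable]: "w \<in> borel_measurable \<mu>" unfolding w_def by measurable
      show ?thesis using If by (simp add: nn_integral_cmult ennreal_mult_less_top)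
    qed
  qed simp
  finally show "(\<integral>\<^sup>+y. ennreal (norm (a (\<rho> powr m) x y * f y)) \<partial>\<mu>) < \<infinity>" .
qed

end

section \<open>Choice of the exponents and comparison with the exponent 1\<close>

lemma bmo_norm_equiv_1:
  fixes d :: "'a \<Rightarrow> 'a \<Rightarrow> real"
  assumes H: "homogeneous_type d \<mu>" and \<Phi>: "growth_function d \<mu> \<phi>" and A: "assumption_A d \<mu> \<phi> M m g a"
    and p: "1 \<le> p" and pp: "p = 1 \<or> index_p d \<mu> \<phi> < p / (p - 1)"
  shows "\<exists>C>0. \<forall>f\<in>M_class d \<mu> \<phi> M.
    bmo_norm d \<mu> \<phi> m a p f \<le> ennreal C * bmo_norm d \<mu> \<phi> m a 1 f \<and>
    bmo_norm d \<mu> \<phi> m a 1 f \<le> ennreal C * bmo_norm d \<mu> \<phi> m a p f"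
proof (cases "p = 1")
  case True
  then show ?thesis by (intro exI[of _ 1]) auto
next
  case False
  then have p1: "1 < p" and pp': "index_p d \<mu> \<phi> < p / (p - 1)" using p pp by auto
  obtain \<kappa> where "quasi_metric_measure d \<mu> \<kappa>"
    using homogeneous_type_imp_quasi_metric_measure[OF H] by blast
  then interpret Q: quasi_metric_measure d \<mu> \<kappa> .
  have inf: "muckenhoupt_infinity d \<mu> \<phi>" and up: "upper_type \<phi> 1" and zero: "\<And>x. \<phi> x 0 = 0"
    and mono: "\<And>x. mono_on {0..} (\<phi> x)" and pos: "\<And>x t. 0 < t \<Longrightarrow> 0 < \<phi> x t"
    using \<Phi> by (auto simp: growth_function_def orlicz_function_def)
  interpret Q: weight_family d \<mu> \<kappa> \<phi>
    by unfold_locales (use \<Phi> in \<open>auto simp: growth_function_def orlicz_function_def\<close>)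
  define n0 where "n0 = deg_n0 d \<mu>"
  define P where "P = index_p d \<mu> \<phi>"
  define I where "I = index_i \<phi>"
  have n0: "0 \<le> n0" unfolding n0_def by (rule deg_n0_nonneg[OF H])
  have P: "1 \<le> P" unfolding P_def by (rule index_p_ge_1[OF \<Phi>])
  have I: "0 < I" unfolding I_def by (rule index_i_props(1)[OF \<Phi>])
  have GA: "gen_approx_identity d \<mu> \<phi> M m g a" using A by (simp add: assumption_A_def)
  have M: "n0 * (1 + P / I) - deg_alpha0 d \<mu> < M" using GA by (simp add: gen_approx_identity_def n0_def P_def I_def)
  \<comment> \<open>As \<open>deg_alpha0 d \<mu> \<le> deg_n0 d \<mu>\<close>, the bound on
    \<open>M\<close> contains the convergence condition for the kernel integrals.\<close>
  have "n0 * P / I < M" using M deg_alpha0_le[OF H] by (simp add: n0_def algebra_simps)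
  then obtain e where e: "0 < e" "e < I" "(n0 + e) * (P + e) / (I - e) < M" using perturb_exponents[OF I] by blast
  obtain n where n: "cond_D d \<mu> n" "n < n0 + e" using deg_n0_less[OF H, of "n0 + e"] e by (auto simp: n0_def)
  have n_pos: "0 < n" using n by (simp add: cond_D_def)
  obtain i where i: "I - e < i" "0 < i" "i \<le> 1" "lower_type \<phi> i"
    using index_i_props(2)[OF \<Phi>, of "I - e"] e by (auto simp: I_def)
  define q where "q = P + e"
  have q: "1 < q" using P e by (simp add: q_def)
  have exps: "n * q / i < M"
  proof -
    have "n * q / i \<le> (n0 + e) * (P + e) / (I - e)"
      using n n_pos i e q by (intro frac_le mult_mono) (auto simp: q_def)
    then show ?thesis using e by simp
  qed
  have M0: "0 < M" using exps n_pos q i by (smt (verit) divide_pos_pos mult_pos_pos)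
  \<comment> \<open>Two Muckenhoupt exponents are used: \<open>q\<close> slightly above the index
    for doubling and growth, and \<open>p / (p - 1)\<close> for the dual power of the
    weight.\<close>
  obtain Ca where Ca: "1 \<le> Ca" "Q.muckenhoupt_bound q Ca"
    using Q.muckenhoupt_bound_above_index[OF _ inf, of q] e by (auto simp: q_def P_def)
  obtain Cp where Cp: "1 \<le> Cp" "Q.muckenhoupt_bound (p / (p - 1)) Cp"
    using Q.muckenhoupt_bound_above_index[OF pp' inf] by blast
  obtain Cd0 where Cd0: "\<And>x r l. 0 < r \<Longrightarrow> 1 \<le> l \<Longrightarrow> Q.V x (l * r) \<le> Cd0 * l powr n * Q.V x r"
    using n by (auto simp: cond_D_def Q.V_def)
  obtain Cu0 where Cu0: "\<And>x t s. 0 \<le> t \<Longrightarrow> 1 \<le> s \<Longrightarrow> \<phi> x (s * t) \<le> Cu0 * s powr 1 * \<phi> x t"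
    using up by (auto simp: upper_type_def)
  obtain Cl0 where Cl0: "\<And>x t s. 0 \<le> t \<Longrightarrow> 0 < s \<Longrightarrow> s < 1 \<Longrightarrow> \<phi> x (s * t) \<le> Cl0 * s powr i * \<phi> x t"
    using i by (auto simp: lower_type_def)
  have nn: "0 \<le> \<phi> x t" if "0 \<le> t" for x t using pos[of t x] zero[of x] that by (cases "t = 0") auto
  obtain G where G: "0 \<le> G" "\<And>s. 0 \<le> s \<Longrightarrow> g (s powr m) \<le> G * (1 + s) powr (- M)"
    using profile_decay[OF _ _ M0, of g m] GA by (auto simp: gen_approx_identity_def)
  have m0: "0 < m" using GA by (simp add: gen_approx_identity_def)
  interpret musielak_kernel d \<mu> \<kappa> \<phi> n q i "max 1 Cd0" "2 powr q * Ca" "max 1 Cu0" "max 1 Cl0" M G p "Cp powr (p - 1)"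
  proof
    show "Q.V x (l * r) \<le> max 1 Cd0 * l powr n * Q.V x r" if "0 < r" "1 \<le> l" for x r l
      by (rule order_trans[OF Cd0[OF that]]) (auto intro!: mult_right_mono simp: Q.V_def)
    show "\<phi> x s \<le> \<phi> x t" if "0 \<le> s" "s \<le> t" for x s t using mono[of x] that by (auto simp: mono_on_def)
    show "\<phi> x (s * t) \<le> max 1 Cu0 * s * \<phi> x t" if "1 \<le> s" "0 \<le> t" for x s t
    proof -
      have "\<phi> x (s * t) \<le> Cu0 * s * \<phi> x t" using Cu0[OF that(2,1), of x] that by simp
      also have "\<dots> \<le> max 1 Cu0 * s * \<phi> x t" using that nn by (intro mult_right_mono) auto
      finally show ?thesis .
    qed
    show "\<phi> x (s * t) \<le> max 1 Cl0 * s powr i * \<phi> x t" if "0 < s" "s < 1" "0 \<le> t" for x s t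
      by (rule order_trans[OF Cl0[OF that(3,1,2)]]) (use that nn in \<open>auto intro!: mult_right_mono\<close>)
    show "emeasure (Q.\<nu> t) (qball d x r) < \<infinity>" if "0 < t" "0 < r" for t x r
      using Ca that by (simp add: Q.muckenhoupt_bound_def)
    show "measure \<mu> E powr q * Q.W t x r \<le> 2 powr q * Ca * Q.V x r powr q * measure (Q.\<nu> t) E"
      if "0 < t" "0 < r" "E \<in> sets \<mu>" "E \<subseteq> qball d x r" for t r E x
      by (rule Q.muckenhoupt_set_bound[OF q Ca(2) that])
    show "Q.Wpow (1 - p) t x r \<le> ennreal (Cp powr (p - 1) * Q.V x r powr p * Q.W t x r powr (1 - p))"
      if "0 < t" "0 < r" for t r x
      by (rule Q.muckenhoupt_dual_bound[OF p1 Cp(2) _ that]) (use Cp in simp)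
    show "1 \<le> 2 powr q * Ca" using q Ca mult_mono[of 1 "2 powr q" 1 Ca] by (simp add: ge_one_powr_ge_zero)
    show "0 < Cp powr (p - 1)" using Cp by simp
  qed (use n_pos zero i q exps G p1 in auto)
  have ab: "cmod (a (\<rho> powr m) x y) \<le> G / Q.V x \<rho> * (1 + d x y / \<rho>) powr (- M)" if \<rho>: "0 < \<rho>" for \<rho> x y
  proof -
    have "cmod (a (\<rho> powr m) x y) \<le> 1 / measure \<mu> (qball d x ((\<rho> powr m) powr (1 / m))) * g (d x y powr m / \<rho> powr m)"
      using GA \<rho> by (auto simp: gen_approx_identity_def)
    also have "(\<rho> powr m) powr (1 / m) = \<rho>" using \<rho> m0 by (simp add: powr_powr)
    also have "d x y powr m / \<rho> powr m = (d x y / \<rho>) powr m" using \<rho> Q.d_nonneg[of x y] by (simp add: powr_divide)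
    also have "1 / measure \<mu> (qball d x \<rho>) * g ((d x y / \<rho>) powr m) \<le>
        1 / measure \<mu> (qball d x \<rho>) * (G * (1 + d x y / \<rho>) powr (- M))"
      using \<rho> Q.d_nonneg[of x y] by (intro mult_left_mono G) auto
    finally show ?thesis by (simp add: Q.V_def)
  qed
  have am: "(\<lambda>(x, y). a t x y) \<in> borel_measurable (\<mu> \<Otimes>\<^sub>M \<mu>)" if "0 < t" for t
    using GA that by (auto simp: gen_approx_identity_def)
  have adm: "admissible m a f" if f: "f \<in> M_class d \<mu> \<phi> M" for f
  proof -
    obtain x0 \<beta> where fb: "f \<in> M_class_at d \<mu> \<phi> x0 \<beta>"
      "0 < \<beta>" "\<beta> < M - n0 * (1 + P / I) + deg_alpha0 d \<mu>"
      using f by (auto simp: M_class_def n0_def P_def I_def)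
    \<comment> \<open>The strict upper bound on \<open>\<beta>\<close> leaves room for a doubling
      exponent \<open>n'\<close>, which may depend on \<open>f\<close>.\<close>
    have "n0 < M - (n0 * P / I - deg_alpha0 d \<mu> + \<beta>)" using fb(3) by (simp add: algebra_simps)
    then obtain n' where n': "cond_D d \<mu> n'" "n' < M - (n0 * P / I - deg_alpha0 d \<mu> + \<beta>)"
      using deg_n0_less[OF H] by (auto simp: n0_def)
    have "integrable \<mu> (\<lambda>y. a (\<rho> powr m) x y * f y)" if "0 < \<rho>" for \<rho> x
      using n' by (intro kernel_integrable[OF fb(1) n'(1) _ am ab that]) (auto simp: n0_def P_def I_def)
    moreover have "f \<in> borel_measurable \<mu>" using fb(1) by (auto simp: M_class_at_def L1_loc_def)
    moreover have "AE x in \<mu>. ai_op \<mu> a t (ai_op \<mu> a s f) x = ai_op \<mu> a (t + s) f x" if "0 < s" "0 < t" for s t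
      using A f that by (auto simp: assumption_A_def)
    ultimately show ?thesis using am ab by (auto simp: admissible_def)
  qed
  obtain C where C: "0 < C" "\<And>f. admissible m a f \<Longrightarrow> bmo_norm d \<mu> \<phi> m a p f \<le> ennreal C * bmo_norm d \<mu> \<phi> m a 1 f"
    using bmo_norm_p_le by blast
  define C' where "C' = max C (2 * max 1 Cu0 + 1)"
  have up: "u \<le> ennreal C' * v" if "u \<le> ennreal b * v" "b \<le> C'" for u v b
    using that(1) by (rule order_trans) (intro mult_right_mono ennreal_leI that(2), simp)
  have "0 < C'" using C by (simp add: C'_def)
  moreover have "bmo_norm d \<mu> \<phi> m a p f \<le> ennreal C' * bmo_norm d \<mu> \<phi> m a 1 f"
    and "bmo_norm d \<mu> \<phi> m a 1 f \<le> ennreal C' * bmo_norm d \<mu> \<phi> m a p f"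
    if f: "f \<in> M_class d \<mu> \<phi> M" for f
    using up[OF C(2)[OF adm[OF f]]] up[OF bmo_norm_1_le[OF adm[OF f]]] by (auto simp: C'_def)
  ultimately show ?thesis by blast
qed

lemma coincide_equiv_norms_trans:
  assumes "0 < C" "0 < D" and SN: "S = {f \<in> X. N f < \<infinity>}" and SN': "S' = {f \<in> X. N' f < \<infinity>}"
    and C: "\<And>f. f \<in> X \<Longrightarrow> N f \<le> ennreal C * Na f \<and> Na f \<le> ennreal C * N f"
    and D: "\<And>f. f \<in> X \<Longrightarrow> N' f \<le> ennreal D * Na f \<and> Na f \<le> ennreal D * N' f"
  shows "coincide_equiv_norms S N S' N'"
proof -
  have 1: "N f \<le> ennreal (C * D) * N' f" if "f \<in> X" for f
  proof -
    have "N f \<le> ennreal C * (ennreal D * N' f)"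
      using C[OF that] D[OF that] by (meson mult_left_mono order_trans zero_le)
    then show ?thesis using assms(1,2) by (simp add: ennreal_mult mult.assoc)
  qed
  have 2: "N' f \<le> ennreal (C * D) * N f" if "f \<in> X" for f
  proof -
    have "N' f \<le> ennreal D * (ennreal C * N f)"
      using C[OF that] D[OF that] by (meson mult_left_mono order_trans zero_le)
    then show ?thesis using assms(1,2) by (simp add: ennreal_mult mult_ac)
  qed
  have "u < \<infinity>" if "u \<le> ennreal (C * D) * v" "v < \<infinity>" for u v
    using that by (elim le_less_trans) (simp add: ennreal_mult_less_top)
  then have "N f < \<infinity> \<longleftrightarrow> N' f < \<infinity>" if "f \<in> X" for f
    using 1[OF that] 2[OF that] by blast
  then have "S = S'" unfolding SN SN' by blast
  then show ?thesis unfolding coincide_equiv_norms_def using 1 2 assms(1,2)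
    by (auto simp: SN intro!: exI[of _ "C * D"])
qed

text \<open>Being below the conjugate index is a symmetric relation: it amounts to
  \<open>P * (p - 1) < p\<close>. For \<open>P = 1\<close> the conjugate index is infinite, and the
  conclusion holds for every \<open>p\<close>.\<close>

lemma less_conj_indexD:
  assumes "1 \<le> P" "1 \<le> p" "ereal p < conj_index (ereal P)"
  shows "p = 1 \<or> P < p / (p - 1)"
proof (cases "P = 1")
  case True
  have "1 < p / (p - 1)" if "p \<noteq> 1" using that assms(2) by (simp add: field_simps)
  then show ?thesis using True by blast
next
  case False
  have "conj_index (ereal P) = ereal (1 / (1 - 1 / P))"
    using assms(1) False by (simp add: conj_index_def one_ereal_def field_simps)
  then have "p < 1 / (1 - 1 / P)" using assms(3) by simp
  then have "P * (p - 1) < p" using assms(1) False by (simp add: field_simps)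
  then have "P < p / (p - 1)" if "p \<noteq> 1" using that assms(2) by (simp add: pos_less_divide_eq)
  then show ?thesis by blast
qed

theorem theorem4p12:
  fixes d :: "'a \<Rightarrow> 'a \<Rightarrow> real" and \<mu> :: "'a measure" and \<phi> :: "'a \<Rightarrow> real \<Rightarrow> real"
    and M m :: real and g :: "real \<Rightarrow> real" and a :: "real \<Rightarrow> 'a \<Rightarrow> 'a \<Rightarrow> complex"
  assumes "homogeneous_type d \<mu>"
    and "growth_function d \<mu> \<phi>"
    and "assumption_A d \<mu> \<phi> M m g a"
  shows "(muckenhoupt d \<mu> 1 \<phi> \<longrightarrow>
           (\<forall>p\<ge>1. \<forall>q\<ge>1.
              coincide_equiv_norms
                (bmo_space d \<mu> \<phi> M m a p) (bmo_norm d \<mu> \<phi> m a p)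
                (bmo_space d \<mu> \<phi> M m a q) (bmo_norm d \<mu> \<phi> m a q))) \<and>
         (ereal (index_p d \<mu> \<phi>) \<le> 1 + 1 / conj_index (index_r d \<mu> \<phi>) \<longrightarrow>
           (\<forall>p\<ge>1. \<forall>q\<ge>1.
              ereal p < conj_index (ereal (index_p d \<mu> \<phi>)) \<and>
              ereal q < conj_index (ereal (index_p d \<mu> \<phi>)) \<longrightarrow>
              coincide_equiv_norms
                (bmo_space d \<mu> \<phi> M m a p) (bmo_norm d \<mu> \<phi> m a p)
                (bmo_space d \<mu> \<phi> M m a q) (bmo_norm d \<mu> \<phi> m a q)))"
proof -
  have main: "coincide_equiv_norms
      (bmo_space d \<mu> \<phi> M m a p) (bmo_norm d \<mu> \<phi> m a p)
      (bmo_space d \<mu> \<phi> M m a q) (bmo_norm d \<mu> \<phi> m a q)"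
    if p: "1 \<le> p" "p = 1 \<or> index_p d \<mu> \<phi> < p / (p - 1)"
      and q: "1 \<le> q" "q = 1 \<or> index_p d \<mu> \<phi> < q / (q - 1)" for p q
  proof -
    obtain C where C: "0 < C" "\<forall>f\<in>M_class d \<mu> \<phi> M.
      bmo_norm d \<mu> \<phi> m a p f \<le> ennreal C * bmo_norm d \<mu> \<phi> m a 1 f \<and>
      bmo_norm d \<mu> \<phi> m a 1 f \<le> ennreal C * bmo_norm d \<mu> \<phi> m a p f"
      using bmo_norm_equiv_1[OF assms p] by blast
    obtain D where D: "0 < D" "\<forall>f\<in>M_class d \<mu> \<phi> M.
      bmo_norm d \<mu> \<phi> m a q f \<le> ennreal D * bmo_norm d \<mu> \<phi> m a 1 f \<and>
      bmo_norm d \<mu> \<phi> m a 1 f \<le> ennreal D * bmo_norm d \<mu> \<phi> m a q f"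
      using bmo_norm_equiv_1[OF assms q] by blast
    show ?thesis
      by (rule coincide_equiv_norms_trans[OF C(1) D(1), where X = "M_class d \<mu> \<phi> M"])
         (use C(2) D(2) in \<open>auto simp: bmo_space_def\<close>)
  qed
  have P1: "index_p d \<mu> \<phi> = 1" if "muckenhoupt d \<mu> 1 \<phi>"
  proof (rule antisym)
    show "index_p d \<mu> \<phi> \<le> 1"
      unfolding index_p_def using that by (intro cInf_lower) (auto intro!: bdd_belowI[of _ 1])
  qed (rule index_p_ge_1[OF assms(2)])
  \<comment> \<open>With index 1 the condition in \<open>main\<close> holds for every exponent,
    which settles the first claim.\<close>
  have conj: "x = 1 \<or> 1 < x / (x - 1)" if "1 \<le> x" for x :: real
    using that by (cases "x = 1") (simp_all add: field_simps)
  show ?thesis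
  proof (intro conjI impI allI)
    fix p q :: real assume "muckenhoupt d \<mu> 1 \<phi>" "1 \<le> p" "1 \<le> q"
    then show "coincide_equiv_norms
      (bmo_space d \<mu> \<phi> M m a p) (bmo_norm d \<mu> \<phi> m a p)
      (bmo_space d \<mu> \<phi> M m a q) (bmo_norm d \<mu> \<phi> m a q)"
      by (intro main) (simp_all add: P1 conj)
  next
    fix p q :: real
    assume "1 \<le> p" "1 \<le> q" "ereal p < conj_index (ereal (index_p d \<mu> \<phi>)) \<and>
              ereal q < conj_index (ereal (index_p d \<mu> \<phi>))"
    then show "coincide_equiv_norms
      (bmo_space d \<mu> \<phi> M m a p) (bmo_norm d \<mu> \<phi> m a p)
      (bmo_space d \<mu> \<phi> M m a q) (bmo_norm d \<mu> \<phi> m a q)"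
      by (intro main less_conj_indexD index_p_ge_1[OF assms(2)]) auto
  qed
qed

end
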